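(* Fix $m\ge1$ and a real $\ell>0$. Let $n\to+\infty$ and $k\to+\infty$ (with $m\le n/2$) in such a way that $n/(2k)\to\ell$. Then $$\lim\lambda_k^{(n)}=4\,\frac{\ell+1/m}{(\ell+2/m)^2}.$$
   Context: For $1\le m\le n/2$: $\mathcal G_{m,n}$ is the Grassmannian of $m$-subspaces of $\mathbb R^n$; $y_i(p,q)=\cos^2\theta_i$ for principal angles; $V_n^\lambda$ irreducible $O(n,\mathbb R)$-representation indexed by $\lambda$, $L^2(\mathcal G_{m,n})\cong\bigoplus_\kappa V_n^{2\kappa}$ over partitions $\kappa$ with at most $m$ parts. $P_\kappa$ is the zonal polynomial: symmetric in $y_1,\dots,y_m$, degree $|\kappa|$, $P_\kappa(1,\dots,1)=1$, $p\mapsto P_\kappa(y(p,q))$ in the component $\cong V_n^{2\kappa}$. $S_k$ is the space of symmetric polynomials in $y_1,\dots,y_m$ of degree $\le k$, with inner product $[f,g]=\int_{[0,1]^m}f\bar g\,d\mu$, $d\mu=c\prod_{i<j}|y_i-y_j|\prod_iy_i^{-1/2}(1-y_i)^{n/2-m-1/2}dy_i$ (normalized to mass $1$). $T_k^{(n)}:S_k\to S_k$ is $P\mapsto\mathrm{pr}_{S_k}(\sigma P)$ with $\sigma=y_1+\dots+y_m$ and $\mathrm{pr}_{S_k}$ the orthogonal projection, and $\lambda_k^{(n)}$ is its largest eigenvalue. *)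

theory Defs
  imports "HOL-Analysis.Analysis"
begin

text \<open>Points of [0,1]^m are represented as functions nat => real; only the
coordinates 0..m-1 (i.e. y_1..y_m) matter. The cube and the product Lebesgue
measure on the coordinates below m.\<close>

definition cube :: "nat \<Rightarrow> (nat \<Rightarrow> real) set" where
  "cube m = PiE {..<m} (\<lambda>_. {0..1})"

definition lebm :: "nat \<Rightarrow> (nat \<Rightarrow> real) measure" where
  "lebm m = PiM {..<m} (\<lambda>_. lborel)"

definition weight :: "nat \<Rightarrow> nat \<Rightarrow> (nat \<Rightarrow> real) \<Rightarrow> real" where
  "weight n m y =
     (\<Prod>i<m. \<Prod>j\<in>{i<..<m}. \<bar>y i - y j\<bar>) *
     (\<Prod>i<m. y i powr (-1/2) * (1 - y i) powr (real n / 2 - real m - 1/2))"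

definition cnorm :: "nat \<Rightarrow> nat \<Rightarrow> real" where
  "cnorm n m = 1 / (LINT y:cube m|lebm m. weight n m y)"

definition ip :: "nat \<Rightarrow> nat \<Rightarrow> ((nat \<Rightarrow> real) \<Rightarrow> real) \<Rightarrow> ((nat \<Rightarrow> real) \<Rightarrow> real) \<Rightarrow> real" where
  "ip n m f g = cnorm n m * (LINT y:cube m|lebm m. f y * g y * weight n m y)"

definition exps :: "nat \<Rightarrow> nat \<Rightarrow> (nat \<Rightarrow> nat) set" where
  "exps m k = {\<alpha> \<in> PiE {..<m} (\<lambda>_. {..k}). sum \<alpha> {..<m} \<le> k}"

definition polys :: "nat \<Rightarrow> nat \<Rightarrow> ((nat \<Rightarrow> real) \<Rightarrow> real) set" where
  "polys m k = {f. \<exists>c :: (nat \<Rightarrow> nat) \<Rightarrow> real.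
                    \<forall>y. f y = (\<Sum>\<alpha>\<in>exps m k. c \<alpha> * (\<Prod>i<m. y i ^ \<alpha> i))}"

definition Sk :: "nat \<Rightarrow> nat \<Rightarrow> ((nat \<Rightarrow> real) \<Rightarrow> real) set" where
  "Sk m k = {f \<in> polys m k. \<forall>\<pi> y. \<pi> permutes {..<m} \<longrightarrow> f (y \<circ> \<pi>) = f y}"

definition sigma :: "nat \<Rightarrow> (nat \<Rightarrow> real) \<Rightarrow> real" where
  "sigma m y = (\<Sum>i<m. y i)"

definition projS :: "nat \<Rightarrow> nat \<Rightarrow> nat \<Rightarrow> ((nat \<Rightarrow> real) \<Rightarrow> real) \<Rightarrow> ((nat \<Rightarrow> real) \<Rightarrow> real)" where
  "projS n m k f = (THE g. g \<in> Sk m k \<and> (\<forall>h\<in>Sk m k. ip n m (\<lambda>y. f y - g y) h = 0))"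

definition Tk :: "nat \<Rightarrow> nat \<Rightarrow> nat \<Rightarrow> ((nat \<Rightarrow> real) \<Rightarrow> real) \<Rightarrow> ((nat \<Rightarrow> real) \<Rightarrow> real)" where
  "Tk n m k P = projS n m k (\<lambda>y. sigma m y * P y)"

definition eigenvalues_T :: "nat \<Rightarrow> nat \<Rightarrow> nat \<Rightarrow> real set" where
  "eigenvalues_T n m k =
     {e. \<exists>P\<in>Sk m k. P \<noteq> (\<lambda>_. 0) \<and> Tk n m k P = (\<lambda>y. e * P y)}"

definition lambda_max :: "nat \<Rightarrow> nat \<Rightarrow> nat \<Rightarrow> real" where
  "lambda_max n m k = Max (eigenvalues_T n m k)"

end

theory Submission
  imports Defs "HOL-Computational_Algebra.Polynomial" "HOL-Real_Asymp.Real_Asymp"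
begin

text \<open>
  Let \<open>w\<^sub>0(y) = \<Prod>i. y\<^sub>i powr (-1/2) * (1 - y\<^sub>i) powr a\<close> with \<open>a = n/2 - m - 1/2\<close>, and let \<open>\<Delta>\<close> be the
  Vandermonde product, so that the weight of the statement is \<open>\<bar>\<Delta>\<bar> w\<^sub>0\<close>.
  The largest eigenvalue is the maximum of the Rayleigh quotients \<open>[\<sigma> f, f] / [f, f]\<close> over \<open>S\<^sub>k\<close>.
  On the cube \<open>\<Delta>\<^sup>2 \<le> \<bar>\<Delta>\<bar> \<le> 1\<close>, and \<open>\<integral> f\<^sup>2 w\<^sub>0 \<le> D \<integral> (\<Delta> f)\<^sup>2 w\<^sub>0\<close> for polynomials of degree \<open>k\<close>, where
  \<open>D\<close> grows only polynomially in \<open>k\<close> and \<open>n\<close> (an uncertainty principle, applied to one factor \<open>y\<^sub>i - y\<^sub>j\<close>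
  at a time). Hence the norms of \<open>f\<close> for the weights \<open>\<bar>\<Delta>\<bar> w\<^sub>0\<close> and \<open>w\<^sub>0\<close> agree up to polynomial
  factors. The moments \<open>\<integral> \<sigma>\<^sup>N f\<^sup>2\<close> are log-convex in \<open>N\<close>, so a Rayleigh quotient is at most the \<open>N\<close>-th
  root of a ratio of moments, which in turn is at most the Rayleigh quotient of a polynomial of
  degree \<open>k + N\<close>. With \<open>N\<close> about \<open>sqrt k\<close> the factor \<open>D\<close> disappears in the \<open>N\<close>-th root, and
  the weight may be replaced by the product weight \<open>w\<^sub>0\<close>.

  For \<open>w\<^sub>0\<close>, multiplication by \<open>\<sigma>\<close> is a sum of Jacobi matrices in the basis of products of
  orthonormal Jacobi polynomials. The row sums of one Jacobi matrix at degree \<open>x k\<close> tend to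
  \<open>g(x) = 1 - l\<^sup>2 / (l + 2 x)\<^sup>2\<close>, which is concave, so that \<open>\<Sum>i. g(x\<^sub>i)\<close> subject to \<open>\<Sum>i. x\<^sub>i \<le> 1\<close> is at
  most \<open>m g(1/m)\<close>; this is the limit. It is attained by products \<open>\<Prod>i. v(y\<^sub>i)\<close> with \<open>v\<close> a flat combination
  of Jacobi polynomials of degree just below \<open>k/m\<close>.
\<close>

section \<open>Preliminaries: derivatives of sums, quadratics, log-convex sequences\<close>

lemma pderiv_sum: "pderiv (sum f A) = (\<Sum>i\<in>A. pderiv (f i))"
  by (induction A rule: infinite_finite_induct) (simp_all add: pderiv_add)

text \<open>The discriminant criterion, from which the Cauchy-Schwarz inequalities below are
  derived. The case \<open>A = 0\<close> matters: in the proof of \<open>max_eigenvalue\<close> the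
  leading coefficient vanishes.\<close>

lemma quadratic_nonneg_imp:
  fixes A B C :: real
  assumes "0 \<le> A" and *: "\<And>t. 0 \<le> A * t\<^sup>2 - 2 * B * t + C"
  shows "B\<^sup>2 \<le> A * C"
proof (cases "A = 0")
  case True
  have "B = 0"
  proof (rule ccontr)
    assume "B \<noteq> 0"
    \<comment> \<open>With \<open>A = 0\<close> the quadratic takes the value \<open>-1\<close> at
      this point.\<close>
    then show False using True *[of "(C + 1) / (2 * B)"] by simp
  qed
  then show ?thesis using True by simp
next
  case False
  then have "A > 0" using \<open>0 \<le> A\<close> by simp
  \<comment> \<open>For \<open>A > 0\<close> the quadratic has its minimum at
    \<open>B / A\<close>.\<close>
  then show ?thesis using *[of "B / A"] by (simp add: power2_eq_square field_simps)
qed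

text \<open>The ratios \<open>M (Suc i) / M i\<close> increase with \<open>i\<close>, and
  \<open>M N / M 0\<close> is the product of the first \<open>N\<close> of them; so it lies between
  the \<open>N\<close>-th powers of the ratios at \<open>0\<close> and at \<open>N\<close>.\<close>

lemma logconvex_ratio_le:
  fixes M :: "nat \<Rightarrow> real"
  assumes nn: "\<And>i. 0 \<le> M i" and M0: "0 < M 0" and lc: "\<And>i. (M (Suc i))\<^sup>2 \<le> M i * M (Suc (Suc i))"
  shows "(M 1 / M 0) ^ N \<le> M N / M 0" "M N / M 0 \<le> (M (Suc N) / M N) ^ N"
proof -
  have zero: "M (Suc i) = 0" if "M 1 = 0" for i
  proof (induction i)
    case (Suc i)
    then show ?case using lc[of "Suc i"] by simp
  qed (use that in simp)
  have "(M 1 / M 0) ^ N \<le> M N / M 0 \<and> M N / M 0 \<le> (M (Suc N) / M N) ^ N"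
  \<comment> \<open>If \<open>M 1 = 0\<close>, all later terms vanish as well, and the quotients by
    them are \<open>0\<close> because \<open>x / 0 = 0\<close>.\<close>
  proof (cases "M 1 = 0")
    case True
    then show ?thesis using M0 zero by (cases N) auto
  next
    case False
    have pos: "0 < M i \<and> 0 < M (Suc i)" for i
    proof (induction i)
      case 0
      then show ?case using M0 False nn[of 1] by simp
    next
      case (Suc i)
      then have "0 < (M (Suc i))\<^sup>2" by simp
      then have "0 < M i * M (Suc (Suc i))" using lc[of i] by linarith
      then show ?case using Suc by (simp add: zero_less_mult_iff)
    qed
    define r where "r i = M (Suc i) / M i" for i
    have r_pos: "0 < r i" for i using pos[of i] by (simp add: r_def)
    have r_step: "r i \<le> r (Suc i)" for i
      using pos[of i] pos[of "Suc i"] lc[of i] by (simp add: r_def divide_simps power2_eq_square mult.commute)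
    then have r_mono: "r i \<le> r j" if "i \<le> j" for i j
      using that by (rule lift_Suc_mono_le)
    have M_prod: "M N / M 0 = (\<Prod>i<N. r i)" for N
    proof (induction N)
      case (Suc N)
      have "M (Suc N) / M 0 = (M N / M 0) * r N" using pos[of N] by (simp add: r_def)
      then show ?case using Suc by simp
    qed (use M0 in simp)
    have "r 0 ^ N \<le> (\<Prod>i<N. r i)"
      using prod_mono[of "{..<N}" "\<lambda>_. r 0" r] r_mono[of 0] r_pos[of 0] by (simp add: less_imp_le)
    moreover have "(\<Prod>i<N. r i) \<le> r N ^ N"
      using prod_mono[of "{..<N}" r "\<lambda>_. r N"] r_mono[of _ N] r_pos by (simp add: less_imp_le)
    ultimately show ?thesis using M_prod[of N] by (simp add: r_def)
  qed
  then show "(M 1 / M 0) ^ N \<le> M N / M 0" "M N / M 0 \<le> (M (Suc N) / M N) ^ N" by auto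
qed

section \<open>Finite-dimensional inner product spaces of functions\<close>

definition lin :: "('a \<Rightarrow> real) set \<Rightarrow> ('a \<Rightarrow> real) set" where
  "lin S = range (\<lambda>u x. \<Sum>v\<in>S. u v * v x)"

lemma linI: "f = (\<lambda>x. \<Sum>v\<in>S. u v * v x) \<Longrightarrow> f \<in> lin S"
  by (auto simp: lin_def)

lemma lin_add_scale:
  assumes "f \<in> lin S" "g \<in> lin S"
  shows "(\<lambda>x. f x + c * g x) \<in> lin S"
proof -
  obtain u v where "f = (\<lambda>x. \<Sum>w\<in>S. u w * w x)" "g = (\<lambda>x. \<Sum>w\<in>S. v w * w x)"
    using assms unfolding lin_def by (elim rangeE)
  then have "(\<lambda>x. f x + c * g x) = (\<lambda>x. \<Sum>w\<in>S. (u w + c * v w) * w x)"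
    by (simp add: distrib_right sum.distrib sum_distrib_left mult.assoc)
  then show ?thesis by (rule linI)
qed

lemma lin_insertI:
  assumes "finite S" "g \<in> lin S"
  shows "(\<lambda>x. c * f x + g x) \<in> lin (insert f S)"
proof -
  obtain u where u: "g = (\<lambda>x. \<Sum>w\<in>S. u w * w x)" using assms(2) unfolding lin_def by (rule rangeE)
  \<comment> \<open>\<open>f\<close> may already belong to \<open>S\<close>; then \<open>c\<close>
    is added to its coefficient.\<close>
  define u' where "u' w = (if w \<in> S then u w else 0) + (if w = f then c else 0)" for w
  have "(\<Sum>w\<in>insert f S. u' w * w x) = c * f x + g x" for x
  proof -
    have "(\<Sum>w\<in>insert f S. u' w * w x) =
        (\<Sum>w\<in>insert f S. (if w \<in> S then u w else 0) * w x) + (\<Sum>w\<in>insert f S. if w = f then c * w x else 0)"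
      unfolding u'_def sum.distrib[symmetric] by (intro sum.cong refl) (simp add: distrib_right)
    also have "(\<Sum>w\<in>insert f S. (if w \<in> S then u w else 0) * w x) = (\<Sum>w\<in>S. (if w \<in> S then u w else 0) * w x)"
      by (rule sum.mono_neutral_right) (use assms(1) in auto)
    finally show ?thesis using assms(1) by (simp add: u)
  qed
  then have "(\<lambda>x. c * f x + g x) = (\<lambda>x. \<Sum>w\<in>insert f S. u' w * w x)" by simp
  then show ?thesis by (rule linI)
qed

text \<open>\<open>g\<close> need not be injective on \<open>I\<close>, so the coefficients of
  indices with the same image are added up.\<close>

lemma lin_imageI:
  assumes "finite I"
  shows "(\<lambda>x. \<Sum>i\<in>I. c i * g i x) \<in> lin (g ` I)"
proof -
  have "(\<Sum>i\<in>I. c i * g i x) = (\<Sum>w\<in>g ` I. (\<Sum>i\<in>{i \<in> I. g i = w}. c i) * w x)" for x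
    by (subst sum.image_gen[OF assms, of _ g]) (auto simp: sum_distrib_right intro!: sum.cong)
  then have "(\<lambda>x. \<Sum>i\<in>I. c i * g i x) = (\<lambda>x. \<Sum>w\<in>g ` I. (\<Sum>i\<in>{i \<in> I. g i = w}. c i) * w x)"
    by blast
  then show ?thesis by (rule linI)
qed

text \<open>Elimination of one generator at a time: if some \<open>f0\<close> in \<open>V\<close>
  involves \<open>z\<close>, subtracting a multiple of \<open>f0\<close> removes \<open>z\<close>
  from any other element of \<open>V\<close>. This provides a spanning set inside \<open>V\<close>,
  although \<open>S\<close> itself need not lie in \<open>V\<close>.\<close>

lemma subspace_finite_span:
  assumes "finite S" "V \<subseteq> lin S"
    and "\<And>f g c. f \<in> V \<Longrightarrow> g \<in> V \<Longrightarrow> (\<lambda>x. f x + c * g x) \<in> V"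
  shows "\<exists>S'. finite S' \<and> S' \<subseteq> V \<and> V \<subseteq> lin S'"
  using assms
proof (induction S arbitrary: V)
  case empty
  then show ?case by (intro exI[of _ "{}"]) simp
next
  case (insert z S)
  have "\<exists>S'. finite S' \<and> S' \<subseteq> V \<inter> lin S \<and> V \<inter> lin S \<subseteq> lin S'"
    using insert.prems(2) by (intro insert.IH) (auto intro: lin_add_scale)
  then obtain S' where S': "finite S'" "S' \<subseteq> V" "V \<inter> lin S \<subseteq> lin S'" by blast
  show ?case
  proof (cases "V \<subseteq> lin S")
    case True
    then show ?thesis using S' by blast
  next
    case False
    have split: "\<exists>u g. g \<in> lin S \<and> f = (\<lambda>x. u * z x + g x)" if f: "f \<in> V" for f
    proof -
      have "f \<in> lin (insert z S)" using f insert.prems(1) by blast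
      then obtain u where "f = (\<lambda>x. \<Sum>w\<in>insert z S. u w * w x)" unfolding lin_def by (rule rangeE)
      then have "f = (\<lambda>x. u z * z x + (\<Sum>w\<in>S. u w * w x))" using insert.hyps by simp
      moreover have "(\<lambda>x. \<Sum>w\<in>S. u w * w x) \<in> lin S" unfolding lin_def by (rule rangeI)
      ultimately show ?thesis by (intro exI conjI)
    qed
    obtain f0 where f0: "f0 \<in> V" "f0 \<notin> lin S" using False by blast
    obtain u0 g0 where g0: "g0 \<in> lin S" "f0 = (\<lambda>x. u0 * z x + g0 x)" using split[OF f0(1)] by (elim exE conjE)
    have u0: "u0 \<noteq> 0" using f0(2) g0 by auto
    have "f \<in> lin (insert f0 S')" if f: "f \<in> V" for f
    proof -
      obtain u g where g: "g \<in> lin S" "f = (\<lambda>x. u * z x + g x)" using split[OF f] by (elim exE conjE)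
      define h where "h = (\<lambda>x. f x + (- u / u0) * f0 x)"
      have "h = (\<lambda>x. g x + (- u / u0) * g0 x)"
        using u0 unfolding h_def g(2) g0(2) by (simp add: field_simps)
      then have "h \<in> lin S" using lin_add_scale[OF g(1) g0(1), of "- u / u0"] by (simp only:)
      moreover have "h \<in> V" unfolding h_def by (rule insert.prems(2)[OF f f0(1)])
      ultimately have "h \<in> lin S'" using S'(3) by blast
      from lin_insertI[OF S'(1) this, of "u / u0" f0]
      show ?thesis by (simp add: h_def)
    qed
    then show ?thesis using S' f0(1) by (intro exI[of _ "insert f0 S'"]) auto
  qed
qed

text \<open>The laws are required on \<open>V\<close> only, since integrals are additive only for
  integrable functions. Linearity is stated in the first argument; the second follows from
  \<open>B_sym\<close>.\<close>

locale ip_space =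
  fixes V :: "('a \<Rightarrow> real) set" and B :: "('a \<Rightarrow> real) \<Rightarrow> ('a \<Rightarrow> real) \<Rightarrow> real"
  assumes V_zero: "(\<lambda>_. 0) \<in> V"
    and V_add: "f \<in> V \<Longrightarrow> g \<in> V \<Longrightarrow> (\<lambda>x. f x + g x) \<in> V"
    and V_scale: "f \<in> V \<Longrightarrow> (\<lambda>x. c * f x) \<in> V"
    and V_fin: "\<exists>S. finite S \<and> S \<subseteq> V \<and> V \<subseteq> lin S"
    and B_add: "f \<in> V \<Longrightarrow> g \<in> V \<Longrightarrow> h \<in> V \<Longrightarrow> B (\<lambda>x. f x + g x) h = B f h + B g h"
    and B_scale: "f \<in> V \<Longrightarrow> h \<in> V \<Longrightarrow> B (\<lambda>x. c * f x) h = c * B f h"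
    and B_sym: "f \<in> V \<Longrightarrow> g \<in> V \<Longrightarrow> B f g = B g f"
    and B_pos: "f \<in> V \<Longrightarrow> f \<noteq> (\<lambda>_. 0) \<Longrightarrow> 0 < B f f"
begin

lemma V_sum: "(\<And>i. i \<in> I \<Longrightarrow> f i \<in> V) \<Longrightarrow> (\<lambda>x. \<Sum>i\<in>I. c i * f i x) \<in> V"
proof (induction I rule: infinite_finite_induct)
  case (insert i I)
  then show ?case using V_add[OF V_scale[of "f i" "c i"], of "\<lambda>x. \<Sum>i\<in>I. c i * f i x"] by simp
qed (simp_all add: V_zero)

lemma V_diff: "f \<in> V \<Longrightarrow> g \<in> V \<Longrightarrow> (\<lambda>x. f x - g x) \<in> V"
  using V_add[of f "\<lambda>x. (-1) * g x"] V_scale[of g "-1"] by simp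

lemma linear_sum:
  fixes \<phi> :: "('a \<Rightarrow> real) \<Rightarrow> real"
  assumes "\<And>f g. f \<in> V \<Longrightarrow> g \<in> V \<Longrightarrow> \<phi> (\<lambda>x. f x + g x) = \<phi> f + \<phi> g"
    and "\<And>c f. f \<in> V \<Longrightarrow> \<phi> (\<lambda>x. c * f x) = c * \<phi> f"
    and "\<And>i. i \<in> I \<Longrightarrow> f i \<in> V"
  shows "\<phi> (\<lambda>x. \<Sum>i\<in>I. c i * f i x) = (\<Sum>i\<in>I. c i * \<phi> (f i))"
proof -
  have zero: "\<phi> (\<lambda>_. 0) = 0" using assms(2)[OF V_zero, of 0] by simp
  show ?thesis using assms(3)
  proof (induction I rule: infinite_finite_induct)
    case (insert i I)
    then show ?case
      using assms(1)[of "\<lambda>x. c i * f i x" "\<lambda>x. \<Sum>i\<in>I. c i * f i x"] assms(2)[of "f i" "c i"]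
      by (simp add: V_scale V_sum)
  qed (simp_all add: zero)
qed

lemma B_sum: "(\<And>i. i \<in> I \<Longrightarrow> f i \<in> V) \<Longrightarrow> h \<in> V \<Longrightarrow> B (\<lambda>x. \<Sum>i\<in>I. c i * f i x) h = (\<Sum>i\<in>I. c i * B (f i) h)"
  by (rule linear_sum[of "\<lambda>f. B f h"]) (auto simp: B_add B_scale)

lemma B_zero: "h \<in> V \<Longrightarrow> B (\<lambda>_. 0) h = 0"
  using B_scale[OF V_zero, of h 0] by simp

lemma B_nonneg: "f \<in> V \<Longrightarrow> 0 \<le> B f f"
  using B_pos[of f] B_zero[OF V_zero] by (cases "f = (\<lambda>_. 0)") (auto simp: less_imp_le)

definition orthonormal :: "('a \<Rightarrow> real) set \<Rightarrow> bool" where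
  "orthonormal O' \<longleftrightarrow> finite O' \<and> O' \<subseteq> V \<and> (\<forall>u\<in>O'. \<forall>v\<in>O'. B u v = (if u = v then 1 else 0))"

lemma orthonormalD:
  assumes "orthonormal O'"
  shows "finite O'" "O' \<subseteq> V" "\<And>u v. u \<in> O' \<Longrightarrow> v \<in> O' \<Longrightarrow> B u v = (if u = v then 1 else 0)"
  using assms by (auto simp: orthonormal_def)

lemma gram_schmidt:
  assumes "finite S" "S \<subseteq> V"
  shows "\<exists>O'. orthonormal O' \<and> lin S \<subseteq> lin O'"
  using assms
proof (induction S)
  case empty
  then show ?case by (intro exI[of _ "{}"]) (simp add: orthonormal_def)
next
  case (insert z S)
  then obtain O' where on: "orthonormal O'" and sub: "lin S \<subseteq> lin O'" by blast
  note O' = orthonormalD[OF on]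
  have z: "z \<in> V" using insert.prems by simp
  define r where "r = (\<lambda>x. z x - (\<Sum>v\<in>O'. B z v * v x))"
  have r: "r \<in> V" unfolding r_def using O'(2) by (intro V_diff z V_sum) auto
  have z_eq: "z x = r x + (\<Sum>v\<in>O'. B z v * v x)" for x by (simp add: r_def)
  have r_orth: "B r v = 0" if v: "v \<in> O'" for v
  proof -
    have "z = (\<lambda>x. r x + (\<Sum>v\<in>O'. B z v * v x))" by (rule ext) (rule z_eq)
    then have "B z v = B (\<lambda>x. r x + (\<Sum>v\<in>O'. B z v * v x)) v" by (rule arg_cong)
    also have "\<dots> = B r v + (\<Sum>u\<in>O'. B z u * B u v)"
      using O'(2) v B_sum[of O' "\<lambda>v. v" v "B z"] by (subst B_add) (auto intro!: r V_sum)
    also have "(\<Sum>u\<in>O'. B z u * B u v) = B z v"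
    proof -
      have "(\<Sum>u\<in>O'. B z u * B u v) = (\<Sum>u\<in>O'. if u = v then B z u else 0)"
        using O'(3)[OF _ v] by (intro sum.cong refl) auto
      then show ?thesis using O'(1) v by simp
    qed
    finally show ?thesis by simp
  qed
  have split: "(\<Sum>v\<in>insert z S. u v * v x) = u z * r x + (\<Sum>v\<in>O'. (u z * B z v + c v) * v x)"
    if "(\<lambda>x. \<Sum>v\<in>S. u v * v x) = (\<lambda>x. \<Sum>v\<in>O'. c v * v x)" for u c x
  proof -
    have "(\<Sum>v\<in>insert z S. u v * v x) = u z * z x + (\<Sum>v\<in>O'. c v * v x)"
      using insert.hyps fun_cong[OF that, of x] by simp
    also have "\<dots> = u z * (r x + (\<Sum>v\<in>O'. B z v * v x)) + (\<Sum>v\<in>O'. c v * v x)"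
      by (simp only: z_eq[of x])
    finally show ?thesis
      by (simp add: distrib_left distrib_right sum.distrib sum_distrib_left mult.assoc)
  qed
  have lin_insert: "\<exists>u c. f = (\<lambda>x. u * r x + (\<Sum>v\<in>O'. c v * v x))" if f: "f \<in> lin (insert z S)" for f
  proof -
    obtain u where u: "f = (\<lambda>x. \<Sum>v\<in>insert z S. u v * v x)" using f unfolding lin_def by (rule rangeE)
    have "(\<lambda>x. \<Sum>v\<in>S. u v * v x) \<in> lin O'" using sub unfolding lin_def by (rule subsetD) (rule rangeI)
    then obtain c where "(\<lambda>x. \<Sum>v\<in>S. u v * v x) = (\<lambda>x. \<Sum>v\<in>O'. c v * v x)"
      unfolding lin_def by (rule rangeE)
    from split[OF this] show ?thesis unfolding u by (intro exI[of _ "u z"] exI[of _ "\<lambda>v. u z * B z v + c v"] ext)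
  qed
  show ?case
  \<comment> \<open>\<open>r\<close> vanishes exactly when \<open>z\<close> is already a combination
    of the vectors found so far; then nothing is added.\<close>
  proof (cases "r = (\<lambda>_. 0)")
    case True
    have "f \<in> lin O'" if f: "f \<in> lin (insert z S)" for f
    proof -
      obtain u c where "f = (\<lambda>x. u * r x + (\<Sum>v\<in>O'. c v * v x))" using lin_insert[OF f] by (elim exE)
      then show ?thesis unfolding True by (intro linI[of _ c]) simp
    qed
    then show ?thesis using on by blast
  next
    case False
    define n where "n = sqrt (B r r)"
    have n: "0 < n" "n * n = B r r" using B_pos[OF r False] by (simp_all add: n_def)
    define e where "e = (\<lambda>x. (1 / n) * r x)"
    have e: "e \<in> V" unfolding e_def by (rule V_scale[OF r])
    have e_orth: "B e v = 0" "B v e = 0" if "v \<in> O'" for v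
    proof -
      have v: "v \<in> V" using that O'(2) by blast
      show "B e v = 0" unfolding e_def B_scale[OF r v] r_orth[OF that] by simp
      then show "B v e = 0" using B_sym[OF v e] by simp
    qed
    have ee: "B e e = 1"
    proof -
      have "B e e = (1 / n) * B r e" by (subst (1) e_def) (rule B_scale[OF r e])
      also have "B r e = B e r" by (rule B_sym[OF r e])
      also have "\<dots> = (1 / n) * B r r" unfolding e_def by (rule B_scale[OF r r])
      finally show ?thesis using n(1) unfolding n(2)[symmetric] by simp
    qed
    have e_notin: "e \<notin> O'" using e_orth(1)[of e] ee by force
    have "f \<in> lin (insert e O')" if f: "f \<in> lin (insert z S)" for f
    proof -
      obtain u c where f_eq: "f = (\<lambda>x. u * r x + (\<Sum>v\<in>O'. c v * v x))" using lin_insert[OF f] by (elim exE)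
      have "(\<Sum>v\<in>O'. c v * v x) = (\<Sum>v\<in>O'. (c(e := u * n)) v * v x)" for x
        using e_notin by (intro sum.cong refl) auto
      then have "f = (\<lambda>x. \<Sum>v\<in>insert e O'. (c(e := u * n)) v * v x)"
        unfolding f_eq using e_notin O'(1) n(1) by (simp add: e_def)
      then show ?thesis by (rule linI)
    qed
    moreover have "orthonormal (insert e O')"
      unfolding orthonormal_def using O' e e_orth ee e_notin by auto
    ultimately show ?thesis by blast
  qed
qed

lemma orthonormal_basis:
  obtains O' where "orthonormal O'" "\<And>f. f \<in> V \<Longrightarrow> f = (\<lambda>x. \<Sum>v\<in>O'. B f v * v x)"
proof -
  obtain S where S: "finite S" "S \<subseteq> V" "V \<subseteq> lin S"
    using V_fin by blast
  obtain O' where on: "orthonormal O'" and sub: "lin S \<subseteq> lin O'"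
    using gram_schmidt[OF S(1,2)] by blast
  note O' = orthonormalD[OF on]
  have "f = (\<lambda>x. \<Sum>v\<in>O'. B f v * v x)" if f: "f \<in> V" for f
  proof -
    have "f \<in> lin O'" using S(3) sub f by blast
    then obtain c where c: "f = (\<lambda>x. \<Sum>v\<in>O'. c v * v x)" unfolding lin_def by (rule rangeE)
    have "B f v = c v" if v: "v \<in> O'" for v
    proof -
      have "B f v = (\<Sum>u\<in>O'. c u * B u v)" unfolding c using O'(2) v by (intro B_sum) auto
      then show ?thesis using O' v by (simp add: if_distrib cong: if_cong)
    qed
    then show ?thesis by (subst c) simp
  qed
  with on show ?thesis by (rule that)
qed

text \<open>In an orthonormal basis the representing vector has the coordinates
  \<open>\<phi> v\<close>. This yields the existence of the orthogonal projection in the definition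
  of \<open>Tk\<close>.\<close>

lemma riesz:
  fixes \<phi> :: "('a \<Rightarrow> real) \<Rightarrow> real"
  assumes "\<And>f g. f \<in> V \<Longrightarrow> g \<in> V \<Longrightarrow> \<phi> (\<lambda>x. f x + g x) = \<phi> f + \<phi> g"
    and "\<And>c f. f \<in> V \<Longrightarrow> \<phi> (\<lambda>x. c * f x) = c * \<phi> f"
  shows "\<exists>g\<in>V. \<forall>h\<in>V. B g h = \<phi> h"
proof -
  obtain O' where on: "orthonormal O'" and exp: "\<And>f. f \<in> V \<Longrightarrow> f = (\<lambda>x. \<Sum>v\<in>O'. B f v * v x)"
    by (rule orthonormal_basis) blast
  note O' = orthonormalD[OF on]
  define g where "g = (\<lambda>x. \<Sum>v\<in>O'. \<phi> v * v x)"
  have "B g h = \<phi> h" if h: "h \<in> V" for h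
  proof -
    have "\<phi> h = \<phi> (\<lambda>x. \<Sum>v\<in>O'. B h v * v x)" using exp[OF h] by simp
    also have "\<dots> = (\<Sum>v\<in>O'. B h v * \<phi> v)"
      by (rule linear_sum) (use assms O'(2) in auto)
    also have "\<dots> = B g h"
      unfolding g_def using O'(2) h by (subst B_sum) (auto intro!: sum.cong simp: B_sym subset_iff)
    finally show ?thesis by simp
  qed
  moreover have "g \<in> V" unfolding g_def using O'(2) by (intro V_sum) auto
  ultimately show ?thesis by blast
qed

text \<open>In orthonormal coordinates every product of two coordinates of \<open>f\<close> is at
  most \<open>B f f\<close> in absolute value, so the sum of the absolute values of the matrix
  entries of \<open>A\<close> serves as a bound.\<close>

lemma form_bounded:
  fixes A :: "('a \<Rightarrow> real) \<Rightarrow> ('a \<Rightarrow> real) \<Rightarrow> real"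
  assumes "\<And>f g h. f \<in> V \<Longrightarrow> g \<in> V \<Longrightarrow> h \<in> V \<Longrightarrow> A (\<lambda>x. f x + g x) h = A f h + A g h"
    and "\<And>c f h. f \<in> V \<Longrightarrow> h \<in> V \<Longrightarrow> A (\<lambda>x. c * f x) h = c * A f h"
    and sym: "\<And>f g. f \<in> V \<Longrightarrow> g \<in> V \<Longrightarrow> A f g = A g f"
  shows "\<exists>C>0. \<forall>f\<in>V. A f f \<le> C * B f f"
proof -
  obtain O' where on: "orthonormal O'" and exp: "\<And>f. f \<in> V \<Longrightarrow> f = (\<lambda>x. \<Sum>v\<in>O'. B f v * v x)"
    by (rule orthonormal_basis) blast
  note O' = orthonormalD[OF on]
  define C where "C = (\<Sum>u\<in>O'. \<Sum>v\<in>O'. \<bar>A u v\<bar>)"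
  have A_sum: "A (\<lambda>x. \<Sum>v\<in>O'. c v * v x) h = (\<Sum>v\<in>O'. c v * A v h)" if "h \<in> V" for c h
    by (rule linear_sum[of "\<lambda>f. A f h"]) (use that assms O'(2) in auto)
  have "A f f \<le> C * B f f" if f: "f \<in> V" for f
  proof -
    define c where "c v = B f v" for v
    have f_eq: "f = (\<lambda>x. \<Sum>v\<in>O'. c v * v x)" using exp[OF f] by (simp add: c_def)
    have Bf: "B f f = (\<Sum>v\<in>O'. (c v)\<^sup>2)"
    proof -
      have "B f f = (\<Sum>v\<in>O'. c v * B v f)"
        using O'(2) f by (subst (1) f_eq, subst B_sum) auto
      then show ?thesis
        using O'(2) f B_sym by (auto simp: c_def power2_eq_square subset_iff intro!: sum.cong)
    qed
    have "A f f = (\<Sum>v\<in>O'. c v * A v f)"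
      using f by (subst (1) f_eq) (rule A_sum)
    also have "\<dots> = (\<Sum>v\<in>O'. c v * (\<Sum>u\<in>O'. c u * A v u))"
    proof (intro sum.cong refl arg_cong2[of _ _ _ _ "(*)"])
      fix v assume v: "v \<in> O'"
      then have vV: "v \<in> V" using O'(2) by auto
      have "A v f = A f v" by (rule sym[OF vV f])
      also have "\<dots> = (\<Sum>u\<in>O'. c u * A u v)" by (subst f_eq) (rule A_sum[OF vV])
      finally show "A v f = (\<Sum>u\<in>O'. c u * A v u)"
        using O'(2) vV sym by (auto simp: subset_iff intro!: sum.cong)
    qed
    also have "\<dots> = (\<Sum>v\<in>O'. \<Sum>u\<in>O'. c v * c u * A v u)"
      by (simp add: sum_distrib_left mult.assoc)
    also have "\<dots> \<le> (\<Sum>v\<in>O'. \<Sum>u\<in>O'. B f f * \<bar>A v u\<bar>)"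
    proof (intro sum_mono)
      fix u v assume uv: "v \<in> O'" "u \<in> O'"
      have le: "(c w)\<^sup>2 \<le> B f f" if "w \<in> O'" for w
        unfolding Bf using O'(1) that by (intro member_le_sum) auto
      have "\<bar>c v * c u\<bar> \<le> ((c v)\<^sup>2 + (c u)\<^sup>2) / 2"
        using sum_squares_bound[of "\<bar>c v\<bar>" "\<bar>c u\<bar>"] by (simp add: abs_mult)
      also have "\<dots> \<le> B f f" using le[OF uv(1)] le[OF uv(2)] by simp
      finally have "\<bar>c v * c u * A v u\<bar> \<le> B f f * \<bar>A v u\<bar>"
        by (simp add: abs_mult mult_right_mono)
      then show "c v * c u * A v u \<le> B f f * \<bar>A v u\<bar>" by simp
    qed
    also have "\<dots> = C * B f f" by (simp add: C_def sum_distrib_left sum_distrib_right mult.commute)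
    finally show ?thesis .
  qed
  \<comment> \<open>Passing to \<open>C + 1\<close> makes the constant strictly positive even if
    \<open>A\<close> vanishes.\<close>
  moreover have "C * B f f \<le> (C + 1) * B f f" if "f \<in> V" for f
    using B_nonneg[OF that] by (simp add: distrib_right)
  moreover have "0 \<le> C" unfolding C_def by (intro sum_nonneg) auto
  ultimately show ?thesis by (intro exI[of _ "C + 1"]) (auto intro: order_trans)
qed

lemma parseval:
  assumes "finite O'" "O' \<subseteq> V" "\<And>f. f \<in> V \<Longrightarrow> f = (\<lambda>x. \<Sum>v\<in>O'. B f v * v x)" and f: "f \<in> V"
  shows "B f f = (\<Sum>v\<in>O'. (B v f)\<^sup>2)"
proof -
  have "B f f = B (\<lambda>x. \<Sum>v\<in>O'. B f v * v x) f" using assms(3)[OF f] by simp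
  also have "\<dots> = (\<Sum>v\<in>O'. B f v * B v f)" using assms(2) f by (intro B_sum) auto
  also have "\<dots> = (\<Sum>v\<in>O'. (B v f)\<^sup>2)"
    using assms(2) f B_sym by (auto simp: power2_eq_square subset_iff intro!: sum.cong)
  finally show ?thesis .
qed

lemma bessel:
  assumes v: "v \<in> V" and T: "finite T" "\<And>e. e \<in> T \<Longrightarrow> P e \<in> V"
    "\<And>e e'. e \<in> T \<Longrightarrow> e' \<in> T \<Longrightarrow> B (P e) (P e') = (if e = e' then 1 else 0)"
  shows "(\<Sum>e\<in>T. (B v (P e))\<^sup>2) \<le> B v v"
proof -
  define d where "d e = B v (P e)" for e
  \<comment> \<open>\<open>q\<close> is minus the orthogonal projection of \<open>v\<close> to the
    span of the \<open>P e\<close>; the claim is \<open>0 <= B (v + q) (v + q)\<close>.\<close>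
  define q where "q = (\<lambda>x. \<Sum>e\<in>T. - d e * P e x)"
  have q: "q \<in> V" unfolding q_def by (intro V_sum T)
  have Bq: "B q h = - (\<Sum>e\<in>T. d e * B (P e) h)" if "h \<in> V" for h
    unfolding q_def using that T by (subst B_sum) (auto simp: sum_negf)
  have qP: "B q (P e) = - d e" if "e \<in> T" for e
    using Bq[OF T(2)[OF that]] T that by (simp add: if_distrib cong: if_cong)
  have "B q q = - (\<Sum>e\<in>T. d e * B (P e) q)" by (rule Bq[OF q])
  also have "\<dots> = (\<Sum>e\<in>T. (d e)\<^sup>2)"
    using T q qP by (auto simp: B_sym[OF T(2) q] power2_eq_square sum_negf)
  finally have qq: "B q q = (\<Sum>e\<in>T. (d e)\<^sup>2)" .
  have "B q v = - (\<Sum>e\<in>T. d e * B (P e) v)" by (rule Bq[OF v])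
  also have "\<dots> = - (\<Sum>e\<in>T. (d e)\<^sup>2)"
    using T v by (simp add: d_def B_sym[OF T(2) v] power2_eq_square)
  finally have qv: "B q v = - (\<Sum>e\<in>T. (d e)\<^sup>2)" .
  have vq: "(\<lambda>x. v x + q x) \<in> V" by (rule V_add[OF v q])
  have "B (\<lambda>x. v x + q x) (\<lambda>x. v x + q x) = B v (\<lambda>x. v x + q x) + B q (\<lambda>x. v x + q x)"
    by (rule B_add[OF v q vq])
  also have "\<dots> = (B v v + B q v) + (B v q + B q q)"
    by (simp add: B_sym[OF v vq] B_sym[OF q vq] B_add[OF v q v] B_add[OF v q q])
  also have "\<dots> = B v v - (\<Sum>e\<in>T. (d e)\<^sup>2)"
    by (simp add: B_sym[OF v q] qq qv)
  finally show ?thesis using B_nonneg[OF vq] by (simp add: d_def)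
qed

text \<open>Eigenvectors of distinct eigenvalues are orthogonal. For normalised ones, Parseval and
  Bessel bound their number by the size of an orthonormal basis. Finiteness gives \<open>Max\<close>
  its meaning on the set of eigenvalues.\<close>

lemma finite_eigenvalues:
  fixes A :: "('a \<Rightarrow> real) \<Rightarrow> ('a \<Rightarrow> real) \<Rightarrow> real"
  assumes sym: "\<And>f g. f \<in> V \<Longrightarrow> g \<in> V \<Longrightarrow> A f g = A g f"
    and scale: "\<And>c f h. f \<in> V \<Longrightarrow> h \<in> V \<Longrightarrow> A (\<lambda>x. c * f x) h = c * A f h"
  shows "finite {e. \<exists>P\<in>V. P \<noteq> (\<lambda>_. 0) \<and> (\<forall>h\<in>V. A P h = e * B P h)}" (is "finite ?Ev")
proof (rule ccontr)
  assume inf: "infinite ?Ev"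
  obtain O' where on: "orthonormal O'" and exp: "\<And>f. f \<in> V \<Longrightarrow> f = (\<lambda>x. \<Sum>v\<in>O'. B f v * v x)"
    by (rule orthonormal_basis) blast
  note O' = orthonormalD[OF on]
  obtain T where T: "finite T" "T \<subseteq> ?Ev" "card T = Suc (card O')"
    using infinite_arbitrarily_large[OF inf] by blast
  have "\<exists>P. P \<in> V \<and> B P P = 1 \<and> (\<forall>h\<in>V. A P h = e * B P h)" if e: "e \<in> T" for e
  proof -
    have "e \<in> ?Ev" using T(2) e by blast
    then obtain P where P: "P \<in> V" "P \<noteq> (\<lambda>_. 0)" "\<And>h. h \<in> V \<Longrightarrow> A P h = e * B P h"
      by blast
    define n where "n = 1 / sqrt (B P P)"
    have n: "n * (n * B P P) = 1" using B_pos[OF P(1,2)] by (simp add: n_def)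
    define P' where "P' = (\<lambda>x. n * P x)"
    have P': "P' \<in> V" unfolding P'_def by (rule V_scale[OF P(1)])
    have BP: "B P' h = n * B P h" if "h \<in> V" for h unfolding P'_def by (rule B_scale[OF P(1) that])
    have "B P' P' = 1" using BP[OF P'] BP[OF P(1)] B_sym[OF P(1) P'] n by simp
    moreover have "A P' h = e * B P' h" if h: "h \<in> V" for h
      using scale[OF P(1) h, of n] P(3)[OF h] BP[OF h] by (simp add: P'_def)
    ultimately show ?thesis using P' by blast
  qed
  then obtain P where P: "\<And>e. e \<in> T \<Longrightarrow> P e \<in> V" "\<And>e. e \<in> T \<Longrightarrow> B (P e) (P e) = 1"
    "\<And>e h. e \<in> T \<Longrightarrow> h \<in> V \<Longrightarrow> A (P e) h = e * B (P e) h" by metis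
  have orth: "B (P e) (P e') = (if e = e' then 1 else 0)" if e: "e \<in> T" "e' \<in> T" for e e'
  proof (cases "e = e'")
    case False
    have "e * B (P e) (P e') = e' * B (P e) (P e')"
      using P(3)[OF e(1) P(1)[OF e(2)]] P(3)[OF e(2) P(1)[OF e(1)]]
        sym[OF P(1)[OF e(1)] P(1)[OF e(2)]] B_sym[OF P(1)[OF e(1)] P(1)[OF e(2)]] by auto
    then show ?thesis using False by auto
  qed (use P(2) e in simp)
  have "real (card T) = (\<Sum>e\<in>T. B (P e) (P e))" using P(2) by simp
  also have "\<dots> = (\<Sum>e\<in>T. \<Sum>v\<in>O'. (B v (P e))\<^sup>2)"
    using P(1) by (intro sum.cong refl parseval[OF O'(1,2) exp]) auto
  also have "\<dots> = (\<Sum>v\<in>O'. \<Sum>e\<in>T. (B v (P e))\<^sup>2)" by (rule sum.swap)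
  also have "\<dots> \<le> (\<Sum>v\<in>O'. B v v)"
    using O'(2) by (intro sum_mono bessel T P(1) orth) auto
  also have "\<dots> = real (card O')" using O'(3) by simp
  finally show False using T(3) by simp
qed

text \<open>If the form \<open>\<mu>B - A\<close> with \<open>\<mu>\<close> the supremum of the Rayleigh quotients were positive definite,
  it would dominate a multiple of \<open>B\<close> by finite dimension, contradicting the choice of \<open>\<mu>\<close>.\<close>

lemma max_eigenvalue:
  fixes A :: "('a \<Rightarrow> real) \<Rightarrow> ('a \<Rightarrow> real) \<Rightarrow> real"
  assumes A_add: "\<And>f g h. f \<in> V \<Longrightarrow> g \<in> V \<Longrightarrow> h \<in> V \<Longrightarrow> A (\<lambda>x. f x + g x) h = A f h + A g h"
    and A_scale: "\<And>c f h. f \<in> V \<Longrightarrow> h \<in> V \<Longrightarrow> A (\<lambda>x. c * f x) h = c * A f h"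
    and A_sym: "\<And>f g. f \<in> V \<Longrightarrow> g \<in> V \<Longrightarrow> A f g = A g f"
    and nontriv: "V \<noteq> {\<lambda>_. 0}"
  defines "Ev \<equiv> {e. \<exists>P\<in>V. P \<noteq> (\<lambda>_. 0) \<and> (\<forall>h\<in>V. A P h = e * B P h)}"
  shows "Max Ev \<in> Ev" "f \<in> V \<Longrightarrow> A f f \<le> Max Ev * B f f"
proof -
  obtain f0 where f0: "f0 \<in> V" "f0 \<noteq> (\<lambda>_. 0)" using nontriv V_zero by blast
  obtain C where C: "0 < C" "\<And>f. f \<in> V \<Longrightarrow> A f f \<le> C * B f f"
    using form_bounded[of A, OF A_add A_scale A_sym] by blast
  define R where "R = {A f f / B f f | f. f \<in> V \<and> f \<noteq> (\<lambda>_. 0)}"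
  have R_ne: "R \<noteq> {}" using f0 by (auto simp: R_def)
  have R_bdd: "bdd_above R"
    by (rule bdd_aboveI[of _ C]) (auto simp: R_def divide_le_eq B_pos C)
  define \<mu> where "\<mu> = Sup R"
  have A_le: "A f f \<le> \<mu> * B f f" if f: "f \<in> V" for f
  proof (cases "f = (\<lambda>_. 0)")
    case True
    then show ?thesis using B_zero[OF V_zero] A_scale[OF V_zero V_zero, of 0] by simp
  next
    case False
    then have "A f f / B f f \<le> \<mu>"
      unfolding \<mu>_def using f by (intro cSup_upper R_bdd) (auto simp: R_def)
    then show ?thesis using B_pos[OF f False] by (simp add: divide_le_eq)
  qed
  define Q where "Q f g = \<mu> * B f g - A f g" for f g
  have "\<exists>f\<in>V. f \<noteq> (\<lambda>_. 0) \<and> Q f f \<le> 0"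
  proof (rule ccontr)
    assume "\<not> ?thesis"
    then have Q_pos: "0 < Q f f" if "f \<in> V" "f \<noteq> (\<lambda>_. 0)" for f using that by force
    interpret Q: ip_space V Q
      by unfold_locales
        (use V_zero V_add V_scale V_fin Q_pos A_sym B_sym in
          \<open>auto simp: Q_def B_add A_add B_scale A_scale algebra_simps\<close>)
    obtain D where D: "0 < D" "\<And>f. f \<in> V \<Longrightarrow> B f f \<le> D * Q f f"
      using Q.form_bounded[of B, OF B_add B_scale B_sym] by blast
    have "\<mu> \<le> \<mu> - 1 / D"
      unfolding \<mu>_def
    proof (rule cSup_least[OF R_ne], fold \<mu>_def)
      fix x assume "x \<in> R"
      then obtain f where f: "f \<in> V" "f \<noteq> (\<lambda>_. 0)" "x = A f f / B f f" by (auto simp: R_def)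
      have "B f f / D \<le> \<mu> * B f f - A f f"
        using D(2)[OF f(1)] D(1) by (simp add: Q_def divide_le_eq mult.commute)
      then have "A f f \<le> (\<mu> - 1 / D) * B f f" by (simp add: algebra_simps)
      then show "x \<le> \<mu> - 1 / D" using B_pos[OF f(1,2)] by (simp add: f(3) divide_le_eq)
    qed
    then show False using D(1) by simp
  qed
  then obtain P where P: "P \<in> V" "P \<noteq> (\<lambda>_. 0)" "Q P P \<le> 0" by blast
  have "A P h = \<mu> * B P h" if h: "h \<in> V" for h
  proof -
    have QP: "Q P P = 0" using P(3) A_le[OF P(1)] by (simp add: Q_def)
    \<comment> \<open>\<open>Q\<close> is non-negative at \<open>h - t P\<close> for all
      \<open>t\<close>; as \<open>Q P P = 0\<close>, the term linear in \<open>t\<close> must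
      vanish, so \<open>P\<close> lies in the kernel of \<open>Q\<close>.\<close>
    have "0 \<le> Q P P * t\<^sup>2 - 2 * Q P h * t + Q h h" for t
    proof -
      define u where "u = (\<lambda>x. (- t) * P x)"
      have u: "u \<in> V" unfolding u_def by (rule V_scale[OF P(1)])
      have hu: "(\<lambda>x. h x + u x) \<in> V" by (rule V_add[OF h u])
      have Q_sym: "Q f g = Q g f" if "f \<in> V" "g \<in> V" for f g
        using A_sym B_sym that by (simp add: Q_def)
      have Q_add: "Q (\<lambda>x. f x + g x) k = Q f k + Q g k" if "f \<in> V" "g \<in> V" "k \<in> V" for f g k
        using that by (simp add: Q_def B_add A_add algebra_simps)
      have Qu: "Q u k = - t * Q P k" if "k \<in> V" for k
        unfolding u_def Q_def B_scale[OF P(1) that] A_scale[OF P(1) that] by (simp add: algebra_simps)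
      have "0 \<le> Q (\<lambda>x. h x + u x) (\<lambda>x. h x + u x)"
        using A_le[OF hu] by (simp add: Q_def)
      also have "\<dots> = Q h h + Q u h + (Q u h + Q u u)"
        using Q_add[OF h u hu] Q_sym[OF h hu] Q_sym[OF u hu] Q_add[OF h u h] Q_add[OF h u u]
          Q_sym[OF h u] by simp
      also have "Q u u = t * t * Q P P"
        using Qu[OF u] Q_sym[OF P(1) u] Qu[OF P(1)] by simp
      finally show ?thesis by (simp add: Qu[OF h] power2_eq_square algebra_simps)
    qed
    then have "(Q P h)\<^sup>2 \<le> Q P P * Q h h"
      by (intro quadratic_nonneg_imp) (simp_all add: QP)
    then have "Q P h = 0" by (simp add: QP)
    then show ?thesis by (simp add: Q_def)
  qed
  then have \<mu>_Ev: "\<mu> \<in> Ev" unfolding Ev_def using P(1,2) by blast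
  have "e \<le> \<mu>" if e: "e \<in> Ev" for e
  proof -
    obtain P where P: "P \<in> V" "P \<noteq> (\<lambda>_. 0)" "A P P = e * B P P"
      using e unfolding Ev_def by blast
    then show ?thesis using A_le[OF P(1)] B_pos[OF P(1,2)] by simp
  qed
  moreover have "finite Ev"
    unfolding Ev_def by (rule finite_eigenvalues[OF A_sym A_scale])
  ultimately have "Max Ev = \<mu>" using \<mu>_Ev by (intro Max_eqI) auto
  then show "Max Ev \<in> Ev" "f \<in> V \<Longrightarrow> A f f \<le> Max Ev * B f f"
    using \<mu>_Ev A_le by auto
qed

end

section \<open>Polynomials on the cube\<close>

lemma finite_exps [simp]: "finite (exps m k)"
  unfolding exps_def by (rule finite_subset[of _ "PiE {..<m} (\<lambda>_. {..k})"]) (auto intro: finite_PiE)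

lemma restrict_in_exps: "sum \<alpha> {..<m} \<le> k \<Longrightarrow> restrict \<alpha> {..<m} \<in> exps m k"
proof -
  assume *: "sum \<alpha> {..<m} \<le> k"
  have "\<alpha> i \<le> k" if "i < m" for i
    using * member_le_sum[of i "{..<m}" \<alpha>] that by simp
  then show ?thesis using * by (auto simp: exps_def)
qed

lemma polys_monomial:
  assumes "sum \<alpha> {..<m} \<le> k"
  shows "(\<lambda>y. \<Prod>i<m. y i ^ \<alpha> i) \<in> polys m k"
proof -
  define c :: "(nat \<Rightarrow> nat) \<Rightarrow> real" where "c \<beta> = (if \<beta> = restrict \<alpha> {..<m} then 1 else 0)" for \<beta>
  have "(\<Sum>\<beta>\<in>exps m k. c \<beta> * (\<Prod>i<m. y i ^ \<beta> i)) = (\<Prod>i<m. y i ^ \<alpha> i)" for y :: "nat \<Rightarrow> real"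
    by (simp add: c_def if_distrib[of "\<lambda>x. x * _"] restrict_in_exps[OF assms] cong: if_cong)
  then show ?thesis unfolding polys_def by (auto intro!: exI[of _ c])
qed

lemma polys_add: "f \<in> polys m k \<Longrightarrow> g \<in> polys m k \<Longrightarrow> (\<lambda>y. f y + g y) \<in> polys m k"
proof -
  assume "f \<in> polys m k" "g \<in> polys m k"
  then obtain c d where "\<forall>y. f y = (\<Sum>\<alpha>\<in>exps m k. c \<alpha> * (\<Prod>i<m. y i ^ \<alpha> i))"
    "\<forall>y. g y = (\<Sum>\<alpha>\<in>exps m k. d \<alpha> * (\<Prod>i<m. y i ^ \<alpha> i))"
    unfolding polys_def by blast
  then have "\<forall>y. f y + g y = (\<Sum>\<alpha>\<in>exps m k. (c \<alpha> + d \<alpha>) * (\<Prod>i<m. y i ^ \<alpha> i))"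
    by (simp add: distrib_right sum.distrib)
  then show ?thesis unfolding polys_def mem_Collect_eq by (rule exI[of _ "\<lambda>\<alpha>. c \<alpha> + d \<alpha>"])
qed

lemma polys_scale: "f \<in> polys m k \<Longrightarrow> (\<lambda>y. c * f y) \<in> polys m k"
proof -
  assume "f \<in> polys m k"
  then obtain d where "\<forall>y. f y = (\<Sum>\<alpha>\<in>exps m k. d \<alpha> * (\<Prod>i<m. y i ^ \<alpha> i))"
    unfolding polys_def by blast
  then have "\<forall>y. c * f y = (\<Sum>\<alpha>\<in>exps m k. (c * d \<alpha>) * (\<Prod>i<m. y i ^ \<alpha> i))"
    by (simp add: sum_distrib_left mult.assoc)
  then show ?thesis unfolding polys_def mem_Collect_eq by (rule exI[of _ "\<lambda>\<alpha>. c * d \<alpha>"])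
qed

lemma polys_const: "(\<lambda>_. c) \<in> polys m k"
  using polys_scale[OF polys_monomial[of "\<lambda>_. 0" m k], of c] by simp

lemma polys_diff: "f \<in> polys m k \<Longrightarrow> g \<in> polys m k \<Longrightarrow> (\<lambda>y. f y - g y) \<in> polys m k"
  using polys_add[of f m k "\<lambda>y. (-1) * g y"] polys_scale[of g m k "-1"] by simp

lemma polys_sum: "(\<And>i. i \<in> I \<Longrightarrow> f i \<in> polys m k) \<Longrightarrow> (\<lambda>y. \<Sum>i\<in>I. f i y) \<in> polys m k"
  by (induction I rule: infinite_finite_induct) (auto intro: polys_add polys_const)

lemma polys_mult:
  assumes "f \<in> polys m k" "g \<in> polys m k'"
  shows "(\<lambda>y. f y * g y) \<in> polys m (k + k')"
proof -
  obtain c d where cd: "\<And>y. f y = (\<Sum>\<alpha>\<in>exps m k. c \<alpha> * (\<Prod>i<m. y i ^ \<alpha> i))"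
    "\<And>y. g y = (\<Sum>\<alpha>\<in>exps m k'. d \<alpha> * (\<Prod>i<m. y i ^ \<alpha> i))"
    using assms unfolding polys_def by blast
  have "f y * g y = (\<Sum>\<alpha>\<in>exps m k. \<Sum>\<beta>\<in>exps m k'. (c \<alpha> * d \<beta>) * (\<Prod>i<m. y i ^ (\<alpha> i + \<beta> i)))" for y
    unfolding cd sum_product by (intro sum.cong refl) (simp add: power_add prod.distrib mult_ac)
  moreover have "(\<lambda>y. \<Sum>\<alpha>\<in>exps m k. \<Sum>\<beta>\<in>exps m k'. (c \<alpha> * d \<beta>) * (\<Prod>i<m. y i ^ (\<alpha> i + \<beta> i))) \<in> polys m (k + k')"
    by (intro polys_sum polys_scale polys_monomial) (auto simp: exps_def sum.distrib)
  ultimately show ?thesis by presburger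
qed

lemma polys_mono:
  assumes "f \<in> polys m k" "k \<le> k'"
  shows "f \<in> polys m k'"
  using polys_mult[OF assms(1) polys_const[of 1 m "k' - k"]] assms(2) by simp

lemma polys_coord: "i < m \<Longrightarrow> (\<lambda>y. y i) \<in> polys m 1"
  using polys_monomial[of "\<lambda>j. if j = i then 1 else 0" m 1]
  by (simp add: if_distrib[of "power _"] cong: if_cong)

lemma polys_coord_power: "i < m \<Longrightarrow> (\<lambda>y. y i ^ r) \<in> polys m r"
  using polys_monomial[of "\<lambda>j. if j = i then r else 0" m r]
  by (simp add: if_distrib[of "power _"] cong: if_cong)

lemma polys_sigma: "sigma m \<in> polys m 1"
  unfolding sigma_def[abs_def] by (intro polys_sum polys_coord) auto

lemma polys_sigma_power_mult:
  assumes "f \<in> polys m k"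
  shows "(\<lambda>y. sigma m y ^ N * f y) \<in> polys m (k + N)"
proof (induction N)
  case 0
  then show ?case using assms by simp
next
  case (Suc N)
  show ?case using polys_mult[OF polys_sigma Suc] by (simp add: mult.assoc)
qed

lemma polys_poly_coord:
  assumes "i < m" "degree q \<le> d"
  shows "(\<lambda>y. poly q (y i)) \<in> polys m d"
  unfolding poly_altdef
  by (intro polys_sum polys_scale polys_mono[OF polys_coord_power[OF assms(1)]]) (use assms(2) in auto)

lemma polys_prod_poly:
  assumes "I \<subseteq> {..<m}" "\<And>i. i \<in> I \<Longrightarrow> degree (q i) \<le> d i"
  shows "(\<lambda>y. \<Prod>i\<in>I. poly (q i) (y i)) \<in> polys m (\<Sum>i\<in>I. d i)"
proof -
  have "finite I" using assms(1) finite_subset by blast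
  then show ?thesis using assms
  proof (induction I)
    case empty
    then show ?case by (simp add: polys_const)
  next
    case (insert i I)
    then show ?case
      using polys_mult[OF polys_poly_coord[of i m "q i" "d i"], of "\<lambda>y. \<Prod>i\<in>I. poly (q i) (y i)" "sum d I"] by auto
  qed
qed

text \<open>Freezing all coordinates but one leaves a univariate polynomial, to which one-variable
  estimates apply inside an iterated integral.\<close>

lemma polys_fun_upd:
  assumes "f \<in> polys m k" "i < m"
  shows "\<exists>q. degree q \<le> k \<and> (\<forall>t. f (y(i := t)) = poly q t)"
proof -
  obtain c where c: "\<And>y. f y = (\<Sum>\<alpha>\<in>exps m k. c \<alpha> * (\<Prod>i<m. y i ^ \<alpha> i))"
    using assms unfolding polys_def by blast
  define q where "q = (\<Sum>\<alpha>\<in>exps m k. monom (c \<alpha> * (\<Prod>j\<in>{..<m}-{i}. y j ^ \<alpha> j)) (\<alpha> i))"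
  have "degree q \<le> k"
    unfolding q_def using assms(2)
    by (intro degree_sum_le order_trans[OF degree_monom_le] finite_exps) (auto simp: exps_def)
  moreover have "f (y(i := t)) = poly q t" for t
  proof -
    have "(\<Prod>j<m. (y(i := t)) j ^ \<alpha> j) = t ^ \<alpha> i * (\<Prod>j\<in>{..<m}-{i}. y j ^ \<alpha> j)" for \<alpha>
      using assms(2) by (subst prod.remove[of _ i]) (auto intro!: prod.cong)
    then show ?thesis unfolding c q_def by (simp add: poly_sum poly_monom mult_ac)
  qed
  ultimately show ?thesis by blast
qed

lemma polys_bounded:
  assumes "f \<in> polys m k"
  shows "\<exists>B. \<forall>y. (\<forall>i<m. 0 \<le> y i \<and> y i \<le> 1) \<longrightarrow> \<bar>f y\<bar> \<le> B"
proof -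
  obtain c where c: "\<And>y. f y = (\<Sum>\<alpha>\<in>exps m k. c \<alpha> * (\<Prod>i<m. y i ^ \<alpha> i))"
    using assms unfolding polys_def by blast
  have "\<bar>f y\<bar> \<le> (\<Sum>\<alpha>\<in>exps m k. \<bar>c \<alpha>\<bar>)" if y: "\<forall>i<m. 0 \<le> y i \<and> y i \<le> 1" for y
    unfolding c
  proof (rule order_trans[OF sum_abs], rule sum_mono)
    fix \<alpha>
    have "0 \<le> (\<Prod>i<m. y i ^ \<alpha> i) \<and> (\<Prod>i<m. y i ^ \<alpha> i) \<le> 1"
      using y by (auto intro!: prod_nonneg prod_le_1 power_le_one)
    then show "\<bar>c \<alpha> * (\<Prod>i<m. y i ^ \<alpha> i)\<bar> \<le> \<bar>c \<alpha>\<bar>"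
      by (simp add: abs_mult mult_left_le)
  qed
  then show ?thesis by blast
qed

lemma polys_measurable:
  assumes "f \<in> polys m k" "\<And>i. i < m \<Longrightarrow> sets (M i) = sets borel"
  shows "f \<in> borel_measurable (PiM {..<m} M)"
proof -
  obtain c where c: "\<And>y. f y = (\<Sum>\<alpha>\<in>exps m k. c \<alpha> * (\<Prod>i<m. y i ^ \<alpha> i))"
    using assms unfolding polys_def by blast
  have [measurable]: "(\<lambda>y. y i) \<in> borel_measurable (PiM {..<m} M)" if "i \<in> {..<m}" for i
    using measurable_component_singleton[OF that, of M] assms(2)[of i] that
      measurable_cong_sets[OF refl, of "M i" borel "PiM {..<m} M"] by auto
  show ?thesis unfolding c by measurable
qed

section \<open>The Vandermonde product and symmetric polynomials\<close>

definition vd :: "nat \<Rightarrow> (nat \<Rightarrow> real) \<Rightarrow> real" where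
  "vd m y = (\<Prod>i<m. \<Prod>j\<in>{i<..<m}. y i - y j)"

text \<open>As one product over pairs, the Vandermonde factor can be built up by induction on a set
  of pairs.\<close>

lemma vd_eq: "vd m y = (\<Prod>x\<in>(SIGMA i:{..<m}. {i<..<m}). y (fst x) - y (snd x))"
  unfolding vd_def by (subst prod.Sigma) (auto simp: case_prod_beta)

lemma abs_vd_le_1:
  assumes "\<And>i. i < m \<Longrightarrow> 0 \<le> y i \<and> y i \<le> 1"
  shows "\<bar>vd m y\<bar> \<le> 1"
proof -
  have "\<bar>y i - y j\<bar> \<le> 1" if "i < m" "j < m" for i j
    using assms[OF that(1)] assms[OF that(2)] by (simp add: abs_le_iff)
  then show ?thesis
    unfolding vd_def by (auto simp: abs_prod intro!: prod_le_1 prod_nonneg)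
qed

lemma polys_diff_power:
  assumes "S \<subseteq> (SIGMA i:{..<m}. {i<..<m})" "f \<in> polys m k"
  shows "(\<lambda>y. (\<Prod>x\<in>S. y (fst x) - y (snd x)) * f y) \<in> polys m (k + card S)"
proof -
  have "finite S" using assms(1) by (rule finite_subset) auto
  then show ?thesis using assms
  proof (induction S)
    case (insert x S)
    have "(\<lambda>y. y (fst x) - y (snd x)) \<in> polys m 1"
      using insert.prems by (intro polys_diff polys_coord) auto
    from polys_mult[OF this insert.IH] insert show ?case by (auto simp: mult.assoc)
  qed auto
qed

lemma Sk_polys: "f \<in> Sk m k \<Longrightarrow> f \<in> polys m k"
  by (simp add: Sk_def)

lemma Sk_mono: "f \<in> Sk m k \<Longrightarrow> k \<le> k' \<Longrightarrow> f \<in> Sk m k'"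
  by (auto simp: Sk_def intro: polys_mono)

lemma Sk_add: "f \<in> Sk m k \<Longrightarrow> g \<in> Sk m k \<Longrightarrow> (\<lambda>y. f y + g y) \<in> Sk m k"
  by (simp add: Sk_def polys_add)

lemma Sk_scale: "f \<in> Sk m k \<Longrightarrow> (\<lambda>y. c * f y) \<in> Sk m k"
  by (simp add: Sk_def polys_scale)

lemma Sk_const: "(\<lambda>_. c) \<in> Sk m k"
  by (simp add: Sk_def polys_const)

lemma sigma_permute: "\<pi> permutes {..<m} \<Longrightarrow> sigma m (y \<circ> \<pi>) = sigma m y"
  unfolding sigma_def comp_def by (rule sum.permute[symmetric, unfolded comp_def])

lemma Sk_sigma_power_mult: "f \<in> Sk m k \<Longrightarrow> (\<lambda>y. sigma m y ^ N * f y) \<in> Sk m (k + N)"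
  by (simp add: Sk_def polys_sigma_power_mult sigma_permute)

lemma Sk_prod_poly:
  assumes "m * degree v \<le> k"
  shows "(\<lambda>y. \<Prod>i<m. poly v (y i)) \<in> Sk m k"
proof -
  have "(\<lambda>y. \<Prod>i<m. poly v (y i)) \<in> polys m k"
    using polys_prod_poly[of "{..<m}" m "\<lambda>_. v" "\<lambda>_. degree v"] polys_mono assms by simp
  moreover have "(\<Prod>i<m. poly v ((y \<circ> \<pi>) i)) = (\<Prod>i<m. poly v (y i))" if "\<pi> permutes {..<m}" for \<pi> y
    using prod.permute[OF that, of "\<lambda>i. poly v (y i)"] by (simp add: comp_def)
  ultimately show ?thesis by (simp add: Sk_def)
qed

section \<open>Jacobi polynomials\<close>

text \<open>\<open>a\<close> is the exponent of \<open>1 - y\<close> in the weight,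
  \<open>n/2 - m - 1/2\<close>. The bound holds for all large \<open>n\<close> and keeps quantities
  such as \<open>(a - 1/2)^2 - 1\<close> positive.\<close>

locale jacobi =
  fixes a :: real
  assumes a_ge: "2 \<le> a"
begin

text \<open>The indicator builds the restriction to the cube into the measure, so that integrals run
  over all of \<open>real\<close>.\<close>

definition w :: "real \<Rightarrow> real" where
  "w y = indicator {0..1} y * (y powr (-1/2) * (1 - y) powr a)"

definition nu :: "real measure" where
  "nu = density lborel (\<lambda>y. ennreal (w y))"

definition E :: "real poly \<Rightarrow> real" where
  "E p = (\<integral>y. poly p y \<partial>nu)"

lemma w_measurable [measurable]: "w \<in> borel_measurable borel"
  unfolding w_def by measurable

lemma w_nonneg [simp]: "0 \<le> w y"
  by (auto simp: w_def indicator_def)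

lemma sets_nu [measurable_cong, simp]: "sets nu = sets borel"
  by (simp add: nu_def)

lemma space_nu [simp]: "space nu = UNIV"
  by (simp add: nu_def)

lemma w_moment:
  "has_bochner_integral lborel (\<lambda>y. w y * y ^ j) (Beta (real j + 1/2) (a + 1))"
proof -
  have B: "((\<lambda>t. t powr (real j + 1/2 - 1) * (1 - t) powr (a + 1 - 1)) has_integral
      Beta (real j + 1/2) (a + 1)) {0..1}"
    by (rule has_integral_Beta_real) (use a_ge in auto)
  have eq: "t powr (real j + 1/2 - 1) * (1 - t) powr (a + 1 - 1) =
      t powr (-1/2) * (1 - t) powr a * t ^ j" if "t \<in> {0..1}" for t
  \<comment> \<open>At \<open>t = 0\<close> both sides are \<open>0\<close>, since
    \<open>0 powr x = 0\<close>.\<close>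
  proof (cases "t = 0")
    case False
    then have "t powr (real j + 1/2 - 1) = t powr (-1/2) * t powr real j"
      by (simp flip: powr_add)
    then show ?thesis using False that by (simp add: powr_realpow)
  qed simp
  have B': "((\<lambda>t. t powr (-1/2) * (1 - t) powr a * t ^ j) has_integral
      Beta (real j + 1/2) (a + 1)) {0..1}"
    using has_integral_cong[THEN iffD1, OF eq B] by blast
  have "0 \<le> Beta (real j + 1/2) (a + 1)"
    by (rule has_integral_nonneg[OF B']) auto
  moreover have "(\<integral>\<^sup>+t. ennreal (w t * t ^ j) \<partial>lborel) = ennreal (Beta (real j + 1/2) (a + 1))"
  proof -
    have "(\<integral>\<^sup>+t. ennreal (t powr (-1/2) * (1 - t) powr a * t ^ j) * indicator {0..1} t \<partial>lborel)
        = ennreal (Beta (real j + 1/2) (a + 1))"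
      by (rule nn_integral_has_integral_lebesgue'[OF _ B']) auto
    moreover have "ennreal (t powr (-1/2) * (1 - t) powr a * t ^ j) * indicator {0..1} t
        = ennreal (w t * t ^ j)" for t
      by (auto simp: w_def indicator_def)
    ultimately show ?thesis by simp
  qed
  moreover have "AE t in lborel. 0 \<le> w t * t ^ j"
    by (auto simp: w_def indicator_def)
  ultimately show ?thesis
    by (intro has_bochner_integral_nn_integral) auto
qed

lemma integrable_monomial: "integrable nu (\<lambda>y. y ^ j)"
  unfolding nu_def using w_moment[of j]
  by (subst integrable_density) (auto simp: has_bochner_integral_iff mult.commute)

lemma moment: "(\<integral>y. y ^ j \<partial>nu) = Beta (real j + 1/2) (a + 1)"
  unfolding nu_def using w_moment[of j]
  by (subst integral_density) (auto simp: has_bochner_integral_iff mult.commute)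

lemma integrable_poly [simp]: "integrable nu (poly p)"
  unfolding poly_altdef by (auto intro!: integrable_monomial)

lemma E_add: "E (p + q) = E p + E q"
  by (simp add: E_def)

lemma E_diff: "E (p - q) = E p - E q"
  by (simp add: E_def)

lemma E_smult: "E (smult c p) = c * E p"
  by (simp add: E_def)

lemma E_0 [simp]: "E 0 = 0"
  by (simp add: E_def)

lemma E_sum: "E (sum f A) = (\<Sum>i\<in>A. E (f i))"
  by (induction A rule: infinite_finite_induct) (simp_all add: E_add)

lemma AE_nu: "AE y in nu. 0 \<le> y \<and> y \<le> 1"
  unfolding nu_def by (subst AE_density) (auto simp: w_def indicator_def)

lemma E_mono: "(\<And>y. 0 \<le> y \<Longrightarrow> y \<le> 1 \<Longrightarrow> poly p y \<le> poly q y) \<Longrightarrow> E p \<le> E q"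
  unfolding E_def by (intro integral_mono_AE) (use AE_nu in auto)

lemma E_nonneg: "(\<And>y. 0 \<le> y \<Longrightarrow> y \<le> 1 \<Longrightarrow> 0 \<le> poly p y) \<Longrightarrow> 0 \<le> E p"
  using E_mono[of 0 p] by simp

text \<open>If the integral were \<open>0\<close>, a polynomial with finitely many roots would
  vanish almost everywhere on the open unit interval, where \<open>w\<close> is positive.\<close>

lemma E_square_pos:
  assumes "p \<noteq> 0"
  shows "0 < E (p * p)"
proof -
  have "E (p * p) \<noteq> 0"
  proof
    assume "E (p * p) = 0"
    then have "AE y in nu. poly (p * p) y = 0"
      unfolding E_def by (subst (asm) integral_nonneg_eq_0_iff_AE) auto
    then have "AE y in lborel. ennreal (w y) > 0 \<longrightarrow> poly p y = 0"
      unfolding nu_def by (subst (asm) AE_density) auto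
    moreover have "AE y in lborel. poly p y \<noteq> 0"
      using finite_imp_null_set_lborel[OF poly_roots_finite[OF assms]] AE_not_in by fastforce
    ultimately have "AE y in lborel. y \<notin> {0<..<1::real}"
      by eventually_elim (auto simp: w_def)
    then have "{0<..<1::real} \<in> null_sets lborel"
      by (subst (asm) AE_iff_null_sets[symmetric]) auto
    then have "emeasure lborel {0<..<1::real} = 0" by auto
    then show False by simp
  qed
  moreover have "0 \<le> E (p * p)" by (rule E_nonneg) auto
  ultimately show ?thesis by simp
qed

section \<open>The Jacobi differential operator and its eigenpolynomials\<close>

definition phi :: "real poly" where "phi = [:0, 1, -1:]"
definition psi :: "real poly" where "psi = [:1/2, -(a + 3/2):]"

text \<open>On the open interval \<open>(phi w)' = psi w\<close>, so the integrand times
  \<open>w\<close> is the derivative of \<open>phi w p\<close>, and \<open>phi w\<close> vanishes at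
  both ends. The proof checks monomials, where the identity is the recursion of the Beta
  function.\<close>

lemma E_ibp: "E (phi * pderiv p + psi * p) = 0"
proof -
  have mono: "E (phi * pderiv (monom 1 i) + psi * monom 1 i) = 0" for i
  proof -
    have nz: "real i + 1/2 \<notin> \<int>\<^sub>\<le>\<^sub>0"
      using nonpos_Ints_nonpos[of "real i + 1/2"] by force
    have "(real i + 1/2 + (a + 1)) * Beta (real i + 1/2 + 1) (a + 1) = (real i + 1/2) * Beta (real i + 1/2) (a + 1)"
      by (rule Beta_plus1_left[OF nz])
    then have *: "(real i + a + 3/2) * (\<integral>y. y ^ Suc i \<partial>nu) = (real i + 1/2) * (\<integral>y. y ^ i \<partial>nu)"
      by (simp only: moment) (simp add: algebra_simps)
    have eq: "poly (phi * pderiv (monom 1 i) + psi * monom 1 i) y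
        = (real i + 1/2) * y ^ i - (real i + a + 3/2) * y ^ Suc i" for y
      by (cases i) (simp_all add: phi_def psi_def pderiv_monom poly_monom algebra_simps)
    show ?thesis
      unfolding E_def eq using * integrable_monomial by (simp del: power_Suc)
  qed
  have "E (phi * pderiv p + psi * p) =
      (\<Sum>i\<le>degree p. coeff p i * E (phi * pderiv (monom 1 i) + psi * monom 1 i))"
  proof -
    have "phi * pderiv p + psi * p =
      (\<Sum>i\<le>degree p. smult (coeff p i) (phi * pderiv (monom 1 i) + psi * monom 1 i))"
    proof -
      have p: "p = (\<Sum>i\<le>degree p. smult (coeff p i) (monom 1 i))"
        by (simp add: smult_monom poly_as_sum_of_monoms)
      have "pderiv p = (\<Sum>i\<le>degree p. smult (coeff p i) (pderiv (monom 1 i)))"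
        by (subst p) (simp add: pderiv_sum pderiv_smult)
      moreover have "psi * p = (\<Sum>i\<le>degree p. smult (coeff p i) (psi * monom 1 i))"
        using arg_cong[OF p, of "(*) psi"] by (simp add: sum_distrib_left)
      ultimately show ?thesis
        by (simp add: sum_distrib_left smult_add_right sum.distrib)
    qed
    then show ?thesis by (simp add: E_sum E_smult)
  qed
  then show ?thesis by (simp add: mono)
qed

text \<open>\<open>cf j r\<close> is the coefficient of \<open>y^(j-r)\<close> in the monic solution of \<open>L q = - eig j * q\<close>,
  where \<open>L\<close> is the Jacobi differential operator; the recursion compares coefficients.\<close>

primrec cf :: "nat \<Rightarrow> nat \<Rightarrow> real" where
  "cf j 0 = 1"
| "cf j (Suc r) = - ((real j - real r) * (real j - real r - 1/2)) /
     ((real r + 1) * (2 * real j - real r + a - 1/2)) * cf j r"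

definition P :: "nat \<Rightarrow> real poly" where
  "P j = (\<Sum>r\<le>j. monom (cf j r) (j - r))"

definition eig :: "nat \<Rightarrow> real" where
  "eig j = real j * (real j + a + 1/2)"

text \<open>In Sturm-Liouville form, \<open>L q = (phi w q')' / w\<close>.\<close>

definition L :: "real poly \<Rightarrow> real poly" where
  "L q = phi * pderiv (pderiv q) + psi * pderiv q"

text \<open>The factor \<open>real j - real r\<close> is \<open>0\<close> at \<open>r = j\<close>,
  which ends the recursion.\<close>

lemma cf_eq_0: "j < r \<Longrightarrow> cf j r = 0"
  by (induction r) (auto simp: less_Suc_eq)

lemma coeff_P: "coeff (P j) i = (if i \<le> j then cf j (j - i) else 0)"
proof -
  have "coeff (P j) i = (\<Sum>r\<le>j. if j - r = i then cf j r else 0)"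
    by (simp add: P_def coeff_sum)
  also have "\<dots> = (\<Sum>r\<le>j. if r = j - i \<and> i \<le> j then cf j r else 0)"
    by (rule sum.cong) auto
  also have "\<dots> = (if i \<le> j then cf j (j - i) else 0)"
    by (cases "i \<le> j") simp_all
  finally show ?thesis .
qed

lemma degree_P [simp]: "degree (P j) = j"
proof (rule antisym)
  show "degree (P j) \<le> j" by (rule degree_le) (auto simp: coeff_P)
  show "j \<le> degree (P j)" by (rule le_degree) (auto simp: coeff_P)
qed

lemma P_nonzero [simp]: "P j \<noteq> 0"
proof
  assume "P j = 0"
  then have "coeff (P j) j = 0" by simp
  then show False by (simp add: coeff_P)
qed

text \<open>The recursion for \<open>cf\<close> indexed by the exponent and cleared of denominators;
  in this form it holds for all \<open>i\<close>, both sides being \<open>0\<close> when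
  \<open>j <= i\<close>.\<close>

lemma coeff_P_rec:
  "(real i + 1) * (real i + 1/2) * coeff (P j) (Suc i) =
   - (real j - real i) * (real i + real j + a + 1/2) * coeff (P j) i"
proof (cases "i < j")
  case True
  define r where "r = j - Suc i"
  have r: "j - i = Suc r" "real r = real j - real i - 1" and "j - Suc i = r"
    using True by (auto simp: r_def)
  have nz: "real i + real j + a + 1/2 \<noteq> 0" "real j - real i \<noteq> 0"
    using a_ge True by auto
  have "real j - real r = real i + 1" "real j - real r - 1/2 = real i + 1/2"
    "real r + 1 = real j - real i" "2 * real j - real r + a - 1/2 = real i + real j + a + 1/2"
    by (simp_all add: r(2))
  then have "cf j (Suc r) = - ((real i + 1) * (real i + 1/2)) /
     ((real j - real i) * (real i + real j + a + 1/2)) * cf j r"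
    by (simp only: cf.simps)
  moreover have "n * c = - d * d' * x" if "x = - n / (d * d') * c" "d \<noteq> 0" "d' \<noteq> 0"
    for n c d d' x :: real
    using that by (simp add: field_simps)
  ultimately have "(real i + 1) * (real i + 1/2) * cf j r =
      - (real j - real i) * (real i + real j + a + 1/2) * cf j (Suc r)"
    using nz by blast
  then show ?thesis using True r(1) \<open>j - Suc i = r\<close> by (simp add: coeff_P)
next
  case False
  then show ?thesis by (auto simp: coeff_P)
qed

lemma coeff_L:
  "coeff (L q) i = (real i + 1) * (real i + 1/2) * coeff q (Suc i) - real i * (real i + a + 1/2) * coeff q i"
proof -
  have phi: "phi * r = pCons 0 (r + pCons 0 (- r))" for r
    by (simp add: phi_def)
  have psi: "psi * r = smult (1/2) r + pCons 0 (smult (-(a + 3/2)) r)" for r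
    by (simp add: psi_def)
  show ?thesis
    unfolding L_def phi psi by (cases i) (simp_all add: coeff_pCons coeff_pderiv field_simps split: nat.split)
qed

lemma L_P: "L (P j) = smult (- eig j) (P j)"
proof (rule poly_eqI)
  fix i
  show "coeff (L (P j)) i = coeff (smult (- eig j) (P j)) i"
    unfolding coeff_L coeff_P_rec by (simp add: eig_def field_simps)
qed

text \<open>\<open>E_ibp\<close> applied to \<open>p' q\<close>. The right-hand side is symmetric in
  \<open>p\<close> and \<open>q\<close>, hence \<open>L\<close> is a symmetric operator.\<close>

lemma E_L: "E (L p * q) = - E (phi * (pderiv p * pderiv q))"
proof -
  have "L p * q + phi * (pderiv p * pderiv q)
      = phi * pderiv (pderiv p * q) + psi * (pderiv p * q)"
    by (simp add: L_def pderiv_mult algebra_simps)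
  then have "E (L p * q) + E (phi * (pderiv p * pderiv q)) = 0"
    using E_ibp[of "pderiv p * q"] by (simp flip: E_add)
  then show ?thesis by simp
qed

lemma eig_strict_mono: "i < j \<Longrightarrow> eig i < eig j"
  unfolding eig_def using a_ge by (intro mult_strict_mono) auto

lemma eig_mono: "i \<le> j \<Longrightarrow> eig i \<le> eig j"
  using eig_strict_mono[of i j] by (cases "i = j") auto

text \<open>Eigenvectors of the symmetric operator \<open>L\<close> with different eigenvalues are
  orthogonal.\<close>

lemma E_P_orth:
  assumes "i \<noteq> j"
  shows "E (P i * P j) = 0"
proof -
  have "E (L (P i) * P j) = E (L (P j) * P i)"
    by (simp only: E_L mult.commute[of "pderiv (P i)"])
  then have "(eig i - eig j) * E (P i * P j) = 0"
    by (simp add: L_P E_smult[of "- _", simplified] E_smult mult.commute[of "P j"] algebra_simps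
        flip: smult_minus_left)
  moreover have "eig i \<noteq> eig j"
    using eig_strict_mono[of i j] eig_strict_mono[of j i] assms by (cases i j rule: linorder_cases) auto
  ultimately show ?thesis by simp
qed

definition sqnorm :: "nat \<Rightarrow> real" where "sqnorm j = E (P j * P j)"

lemma sqnorm_pos [simp]: "0 < sqnorm j"
  unfolding sqnorm_def by (rule E_square_pos) simp

lemma sqnorm_nonzero [simp]: "sqnorm j \<noteq> 0"
  using sqnorm_pos[of j] by linarith

definition p :: "nat \<Rightarrow> real poly" where "p j = smult (1 / sqrt (sqnorm j)) (P j)"

lemma E_p: "E (p i * p j) = (if i = j then 1 else 0)"
proof (cases "i = j")
  case True
  have "sqnorm j / (sqrt (sqnorm j) * sqrt (sqnorm j)) = 1" using sqnorm_pos[of j] by (simp add: less_imp_le)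
  then show ?thesis using True by (simp add: p_def E_smult sqnorm_def[symmetric])
qed (simp add: p_def E_smult E_P_orth)

lemma L_p: "L (p j) = smult (- eig j) (p j)"
proof -
  have "L (smult c q) = smult c (L q)" for c q
    by (simp add: L_def pderiv_smult smult_add_right)
  then show ?thesis by (simp add: p_def L_P)
qed

lemma degree_p [simp]: "degree (p j) = j"
  using sqnorm_pos[of j] by (simp add: p_def)

lemma coeff_p_top: "coeff (p j) j \<noteq> 0"
  using sqnorm_pos[of j] by (simp add: p_def coeff_P)

lemma p_expansion:
  assumes "degree q \<le> K"
  shows "\<exists>c. q = (\<Sum>j\<le>K. smult (c j) (p j))"
  using assms
proof (induction K arbitrary: q)
  case 0
  define c where "c = (\<lambda>_::nat. coeff q 0 / coeff (p 0) 0)"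
  have "q = smult (c 0) (p 0)"
  proof (rule poly_eqI)
    fix i show "coeff q i = coeff (smult (c 0) (p 0)) i"
      using 0 coeff_p_top[of 0] by (cases "i = 0") (auto simp: c_def coeff_eq_0)
  qed
  then show ?case by (intro exI[of _ c]) simp
next
  case (Suc K)
  define d where "d = coeff q (Suc K) / coeff (p (Suc K)) (Suc K)"
  define q' where "q' = q - smult d (p (Suc K))"
  have "coeff q' i = 0" if "i > K" for i
    using that Suc.prems coeff_p_top[of "Suc K"]
    by (cases "i = Suc K") (auto simp: q'_def d_def coeff_eq_0)
  then have "degree q' \<le> K" by (intro degree_le) auto
  from Suc.IH[OF this] obtain c where c: "q' = (\<Sum>j\<le>K. smult (c j) (p j))" by blast
  have "(\<Sum>j\<le>K. smult (c j) (p j)) = (\<Sum>j\<le>K. smult ((c(Suc K := d)) j) (p j))"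
    by (rule sum.cong) auto
  then have "q = (\<Sum>j\<le>Suc K. smult ((c(Suc K := d)) j) (p j))"
    using c by (simp add: q'_def algebra_simps)
  then show ?case by blast
qed

lemma E_sum_smult:
  "E ((\<Sum>i\<in>I. smult (c i) (f i)) * (\<Sum>j\<in>J. smult (d j) (g j))) =
   (\<Sum>i\<in>I. \<Sum>j\<in>J. c i * d j * E (f i * g j))"
  by (simp add: sum_product E_sum E_smult mult_ac)

text \<open>A Bernstein-type inequality: the energy form is diagonal in the basis \<open>p j\<close>
  with the increasing values \<open>eig j\<close>.\<close>

lemma energy_le:
  assumes "degree q \<le> K"
  shows "E (phi * (pderiv q * pderiv q)) \<le> eig K * E (q * q)"
proof -
  from p_expansion[OF assms] obtain c where c: "q = (\<Sum>j\<le>K. smult (c j) (p j))" by blast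
  have Lq: "L q = (\<Sum>j\<le>K. smult (- eig j * c j) (p j))"
  proof -
    have "L q = (\<Sum>j\<le>K. smult (c j) (L (p j)))"
      by (simp add: c L_def pderiv_sum pderiv_smult sum_distrib_left smult_add_right sum.distrib)
    then show ?thesis by (simp add: L_p mult.commute)
  qed
  have "E (phi * (pderiv q * pderiv q)) = - E (L q * q)"
    by (simp add: E_L)
  also have "\<dots> = (\<Sum>j\<le>K. eig j * (c j)\<^sup>2)"
    unfolding Lq unfolding c by (subst E_sum_smult)
      (simp add: E_p if_distrib power2_eq_square mult_ac sum_negf cong: if_cong)
  also have "\<dots> \<le> (\<Sum>j\<le>K. eig K * (c j)\<^sup>2)"
    by (intro sum_mono mult_right_mono eig_mono) auto
  also have "\<dots> = eig K * E (q * q)"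
  proof -
    have "E (q * q) = (\<Sum>j\<le>K. (c j)\<^sup>2)"
      unfolding c by (subst E_sum_smult) (simp add: E_p if_distrib power2_eq_square cong: if_cong)
    then show ?thesis by (simp add: sum_distrib_left)
  qed
  finally show ?thesis .
qed

lemma E_cauchy_schwarz:
  assumes "\<And>y. 0 \<le> y \<Longrightarrow> y \<le> 1 \<Longrightarrow> 0 \<le> poly r y"
  shows "\<bar>E (r * (f * g))\<bar> \<le> sqrt (E (r * (f * f))) * sqrt (E (r * (g * g)))"
proof -
  have "0 \<le> E (r * (f * f)) * t\<^sup>2 - 2 * E (r * (f * g)) * t + E (r * (g * g))" for t
  proof -
    have "0 \<le> E (r * ((g - smult t f) * (g - smult t f)))" by (rule E_nonneg) (use assms in auto)
    also have "r * ((g - smult t f) * (g - smult t f)) =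
        r * (g * g) - smult t (r * (f * g)) - smult t (r * (f * g)) + smult (t * t) (r * (f * f))"
      by (simp add: algebra_simps)
    finally show ?thesis
      by (simp only: E_add E_diff E_smult) (simp add: power2_eq_square algebra_simps)
  qed
  then have "(E (r * (f * g)))\<^sup>2 \<le> E (r * (f * f)) * E (r * (g * g))"
    using assms by (intro quadratic_nonneg_imp E_nonneg) auto
  then have "sqrt ((E (r * (f * g)))\<^sup>2) \<le> sqrt (E (r * (f * f)) * E (r * (g * g)))"
    by (rule real_sqrt_le_mono)
  then show ?thesis by (simp add: real_sqrt_mult)
qed

section \<open>The uncertainty inequality for polynomials in one variable\<close>

definition Q :: "nat \<Rightarrow> real" where "Q K = 7 * (real K + a + 3)"

lemma Q_pos: "0 < Q K"
  using a_ge by (simp add: Q_def)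

lemma Q_ge_1: "1 \<le> Q K"
  using a_ge by (simp add: Q_def)

lemma sqrt_eig_le: "sqrt (eig K) \<le> real K + a + 1/2"
  using a_ge by (intro real_le_lsqrt) (auto simp: eig_def power2_eq_square intro!: mult_right_mono)

lemma phi_bounds:
  assumes "0 \<le> y" "y \<le> 1"
  shows "0 \<le> poly phi y" "poly phi y \<le> 1"
proof -
  have eq: "poly phi y = y * (1 - y)" by (simp add: phi_def algebra_simps)
  show "0 \<le> poly phi y" "poly phi y \<le> 1"
    unfolding eq using assms by (auto intro: mult_le_one)
qed

text \<open>Since \<open>psi\<close> and \<open>phi\<close> are coprime, \<open>1 = u psi + v phi\<close>; integration by parts turns the term
  with \<open>psi\<close> into terms with \<open>phi\<close>.\<close>

lemma norm_le_norm_phi: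
  assumes deg: "degree q \<le> K"
  shows "E (q * q) \<le> (Q K)\<^sup>2 * E (phi * (q * q))"
proof -
  \<comment> \<open>Comparing coefficients in \<open>u psi + v phi = 1\<close> with
    \<open>u = 2 - u1 y\<close> and constant \<open>v\<close> gives
    \<open>u1 (a + 1) = 2 a + 3\<close> and \<open>v = u1 (a + 3/2)\<close>.\<close>
  define u1 where "u1 = 2 + 1 / (a + 1)"
  define v where "v = u1 * (a + 3/2)"
  define u where "u = [:2, - u1:]"
  define X where "X = sqrt (E (phi * (q * q)))"
  define Y where "Y = sqrt (E (q * q))"
  have u1: "2 \<le> u1" "u1 \<le> 7/3" and u1a: "u1 * (a + 1) = 2 * a + 3"
    using a_ge by (auto simp: u1_def field_simps)
  have X0: "0 \<le> E (phi * (q * q))" by (rule E_nonneg) (auto simp: phi_bounds)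
  have Y0: "0 \<le> E (q * q)" by (rule E_nonneg) auto
  have XY: "X \<le> Y"
    unfolding X_def Y_def
    by (intro real_sqrt_le_mono E_mono) (auto intro!: mult_left_le_one_le simp: phi_bounds)
  have "u * psi + smult v phi = 1"
    using u1a by (simp add: u_def psi_def phi_def v_def algebra_simps one_pCons)
  then have "q * q = (u * psi + smult v phi) * (q * q)" by simp
  also have "\<dots> = (u * psi) * (q * q) + smult v (phi * (q * q))" by (simp add: distrib_right)
  finally have "E (q * q) = E ((u * psi) * (q * q) + smult v (phi * (q * q)))"
    by (rule arg_cong)
  then have E1: "E (q * q) = E ((u * psi) * (q * q)) + v * E (phi * (q * q))"
    by (simp only: E_add E_smult)
  have "phi * pderiv (u * (q * q)) + psi * (u * (q * q)) =
      (u * psi) * (q * q) - smult u1 (phi * (q * q)) + phi * (u * q * pderiv q) + phi * (u * q * pderiv q)"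
  proof -
    have "pderiv u = [:- u1:]" by (simp add: u_def pderiv_pCons)
    then show ?thesis by (simp add: pderiv_mult algebra_simps)
  qed
  from arg_cong[OF this, of E, unfolded E_ibp]
  have "E (q * q) = (v + u1) * E (phi * (q * q)) - 2 * E (phi * (u * q * pderiv q))"
    unfolding E_add E_diff E_smult using E1 by (simp only: distrib_right)
  then have "E (q * q) = (v + u1) * X\<^sup>2 - 2 * E (phi * (u * q * pderiv q))"
    using X0 by (simp add: X_def)
  moreover have "\<bar>E (phi * (u * q * pderiv q))\<bar> \<le> (2 * X) * ((real K + a + 1/2) * Y)"
  proof (rule order_trans[OF E_cauchy_schwarz], fact phi_bounds(1), rule mult_mono)
    have "E (phi * (u * q * (u * q))) \<le> E (smult 4 (phi * (q * q)))"
    proof (rule E_mono)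
      fix y :: real assume y: "0 \<le> y" "y \<le> 1"
      have "0 \<le> u1 * y" "u1 * y \<le> 7/3 * 1" by (intro mult_nonneg_nonneg mult_mono; use y u1 in auto)+
      then have "\<bar>poly u y\<bar> \<le> 2" by (simp add: u_def abs_le_iff mult.commute)
      then have "(poly u y)\<^sup>2 \<le> 4" using abs_le_square_iff[of "poly u y" 2] by simp
      then have "(poly u y)\<^sup>2 * (poly phi y * (poly q y)\<^sup>2) \<le> 4 * (poly phi y * (poly q y)\<^sup>2)"
        using y by (intro mult_right_mono) (auto simp: phi_bounds)
      then show "poly (phi * (u * q * (u * q))) y \<le> poly (smult 4 (phi * (q * q))) y"
        by (simp add: power2_eq_square mult_ac)
    qed
    then have "sqrt (E (phi * (u * q * (u * q)))) \<le> sqrt (4 * E (phi * (q * q)))"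
      by (simp add: E_smult)
    then show "sqrt (E (phi * (u * q * (u * q)))) \<le> 2 * X"
      by (simp add: X_def real_sqrt_mult)
    have "sqrt (E (phi * (pderiv q * pderiv q))) \<le> sqrt (eig K * E (q * q))"
      using energy_le[OF deg] by simp
    also have "\<dots> = sqrt (eig K) * Y" by (simp add: Y_def real_sqrt_mult)
    also have "\<dots> \<le> (real K + a + 1/2) * Y"
      by (intro mult_right_mono sqrt_eig_le) (auto simp: Y_def Y0)
    finally show "sqrt (E (phi * (pderiv q * pderiv q))) \<le> (real K + a + 1/2) * Y" .
  qed (auto simp: X_def X0 intro!: E_nonneg simp: phi_bounds)
  moreover have "Y\<^sup>2 = E (q * q)" using Y0 by (simp add: Y_def)
  moreover have "2 * ((2 * X) * ((real K + a + 1/2) * Y)) = 4 * (real K + a + 1/2) * X * Y" by simp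
  ultimately have "Y\<^sup>2 \<le> (v + u1) * X\<^sup>2 + 4 * (real K + a + 1/2) * X * Y"
    by linarith
  \<comment> \<open>Since \<open>phi <= 1\<close>, also \<open>X <= Y\<close>. Every term becomes a
    multiple of \<open>X * Y\<close>, and afterwards one factor \<open>Y\<close> is
    cancelled.\<close>
  also have "\<dots> \<le> (v + u1) * (X * Y) + 4 * (real K + a + 1/2) * X * Y"
  proof -
    have "0 \<le> X" using X0 by (simp add: X_def)
    then have "X\<^sup>2 \<le> X * Y" using XY by (simp add: power2_eq_square mult_left_mono)
    moreover have "0 \<le> v + u1" using u1 a_ge by (simp add: v_def)
    ultimately show ?thesis by (simp add: mult_left_mono)
  qed
  also have "\<dots> = (u1 * (a + 5/2) + 4 * (real K + a + 1/2)) * (X * Y)"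
    by (simp add: v_def algebra_simps)
  also have "\<dots> \<le> Q K * (X * Y)"
  proof (rule mult_right_mono)
    have "u1 * (a + 5/2) \<le> 7/3 * (a + 5/2)" using u1 a_ge by (intro mult_right_mono) auto
    then show "u1 * (a + 5/2) + 4 * (real K + a + 1/2) \<le> Q K"
      using a_ge by (simp add: Q_def)
    show "0 \<le> X * Y" by (simp add: X_def Y_def X0 Y0)
  qed
  finally have YX: "Y * Y \<le> (Q K * X) * Y" by (simp add: power2_eq_square mult_ac)
  have "Y \<le> Q K * X"
  proof (cases "Y = 0")
    case True
    then show ?thesis using Q_pos[of K] X0 by (simp add: X_def)
  next
    case False
    then have "Y > 0" using Y0 by (simp add: Y_def less_le)
    then show ?thesis using YX by simp
  qed
  then have "Y\<^sup>2 \<le> (Q K * X)\<^sup>2" using Y0 by (intro power_mono) (auto simp: Y_def)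
  then show ?thesis using X0 Y0 by (simp add: X_def Y_def power_mult_distrib)
qed

text \<open>Integration by parts of \<open>(y - t) phi q\<^sup>2\<close>, as for the uncertainty principle.\<close>

lemma norm_phi_le:
  assumes deg: "degree q \<le> K"
  shows "E (phi * (q * q)) \<le>
    Q K * sqrt (E (([:-t, 1:] * q) * ([:-t, 1:] * q))) * sqrt (E (q * q))"
proof -
  define l where "l = [:-t, 1:]"
  define Z where "Z = sqrt (E ((l * q) * (l * q)))"
  define Y where "Y = sqrt (E (q * q))"
  have Z0: "0 \<le> Z" unfolding Z_def by (intro real_sqrt_ge_zero E_nonneg) auto
  have Y0: "0 \<le> Y" unfolding Y_def by (intro real_sqrt_ge_zero E_nonneg) auto
  have dl: "pderiv l = 1" by (simp add: l_def pderiv_pCons one_pCons)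
  \<comment> \<open>The derivative of \<open>l\<close> is \<open>1\<close>, which isolates
    \<open>phi q^2\<close>; every other term contains \<open>l q\<close> and is estimated by
    Cauchy-Schwarz.\<close>
  have "phi * pderiv (l * (q * q)) + psi * (l * (q * q)) =
      phi * (q * q) + (l * q) * (phi * pderiv q) + (l * q) * (phi * pderiv q) + (l * q) * (psi * q)"
    by (simp add: pderiv_mult dl algebra_simps)
  from arg_cong[OF this, of E, unfolded E_ibp]
  have eq: "E (phi * (q * q)) = - 2 * E ((l * q) * (phi * pderiv q)) - E ((l * q) * (psi * q))"
    unfolding E_add by linarith
  have CS: "\<bar>E (f * g)\<bar> \<le> sqrt (E (f * f)) * sqrt (E (g * g))" for f g
    using E_cauchy_schwarz[of 1 f g] by simp
  have 1: "\<bar>E ((l * q) * (phi * pderiv q))\<bar> \<le> Z * ((real K + a + 1/2) * Y)"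
  proof (rule order_trans[OF CS], rule mult_mono)
    have "E (phi * pderiv q * (phi * pderiv q)) \<le> E (phi * (pderiv q * pderiv q))"
    proof (rule E_mono)
      fix y :: real assume y: "0 \<le> y" "y \<le> 1"
      have "poly phi y * (poly phi y * (poly (pderiv q) y)\<^sup>2) \<le> 1 * (poly phi y * (poly (pderiv q) y)\<^sup>2)"
        by (rule mult_right_mono) (use y phi_bounds in auto)
      then show "poly (phi * pderiv q * (phi * pderiv q)) y \<le> poly (phi * (pderiv q * pderiv q)) y"
        by (simp add: power2_eq_square mult_ac)
    qed
    also have "\<dots> \<le> eig K * E (q * q)" by (rule energy_le[OF deg])
    finally have "sqrt (E (phi * pderiv q * (phi * pderiv q))) \<le> sqrt (eig K) * Y"
      by (simp add: Y_def flip: real_sqrt_mult)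
    also have "\<dots> \<le> (real K + a + 1/2) * Y"
      by (intro mult_right_mono sqrt_eig_le Y0)
    finally show "sqrt (E (phi * pderiv q * (phi * pderiv q))) \<le> (real K + a + 1/2) * Y" .
  qed (auto simp: Z_def intro!: E_nonneg)
  \<comment> \<open>On the unit interval \<open>psi\<close> decreases from \<open>1/2\<close> to
    \<open>-(a + 1)\<close>.\<close>
  have 2: "\<bar>E ((l * q) * (psi * q))\<bar> \<le> Z * ((a + 1) * Y)"
  proof (rule order_trans[OF CS], rule mult_mono)
    have "E (psi * q * (psi * q)) \<le> E (smult ((a + 1)\<^sup>2) (q * q))"
    proof (rule E_mono)
      fix y :: real assume y: "0 \<le> y" "y \<le> 1"
      have "(a + 3/2) * y \<le> (a + 3/2) * 1" "0 \<le> (a + 3/2) * y" using y a_ge by (auto intro!: mult_left_mono)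
      then have "\<bar>poly psi y\<bar> \<le> \<bar>a + 1\<bar>" using a_ge by (simp add: psi_def abs_le_iff algebra_simps)
      then have "(poly psi y)\<^sup>2 \<le> (a + 1)\<^sup>2" by (simp add: abs_le_square_iff)
      then have "(poly psi y)\<^sup>2 * (poly q y)\<^sup>2 \<le> (a + 1)\<^sup>2 * (poly q y)\<^sup>2" by (intro mult_right_mono) auto
      then show "poly (psi * q * (psi * q)) y \<le> poly (smult ((a + 1)\<^sup>2) (q * q)) y"
        by (simp add: power2_eq_square mult_ac)
    qed
    then have "sqrt (E (psi * q * (psi * q))) \<le> sqrt ((a + 1)\<^sup>2 * E (q * q))"
      by (simp add: E_smult)
    then show "sqrt (E (psi * q * (psi * q))) \<le> (a + 1) * Y"
      using a_ge by (simp add: Y_def real_sqrt_mult)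
  qed (auto simp: Z_def intro!: E_nonneg)
  have "E (phi * (q * q)) \<le> 2 * (Z * ((real K + a + 1/2) * Y)) + Z * ((a + 1) * Y)"
    using eq 1 2 by linarith
  also have "\<dots> = (2 * real K + 3 * a + 2) * (Z * Y)" by (simp add: algebra_simps)
  also have "\<dots> \<le> Q K * (Z * Y)"
    using a_ge Z0 Y0 by (intro mult_right_mono) (auto simp: Q_def)
  finally show ?thesis by (simp add: Z_def Y_def l_def mult_ac)
qed

text \<open>Chaining the two preceding bounds gives \<open>Y^2 <= Q^3 Z Y\<close>; cancelling
  \<open>Y\<close> and squaring produces the exponent \<open>6\<close>. The bound is uniform in
  \<open>t\<close>, so \<open>t\<close> may later be another coordinate.\<close>

lemma norm_le_norm_shift:
  assumes deg: "degree q \<le> K"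
  shows "E (q * q) \<le> Q K ^ 6 * E (([:-t, 1:] * q) * ([:-t, 1:] * q))"
proof -
  define Z where "Z = sqrt (E (([:-t, 1:] * q) * ([:-t, 1:] * q)))"
  define Y where "Y = sqrt (E (q * q))"
  have Z0: "0 \<le> E (([:-t, 1:] * q) * ([:-t, 1:] * q))" by (intro E_nonneg) auto
  have Y0: "0 \<le> E (q * q)" by (intro E_nonneg) auto
  have "Y * Y = E (q * q)" using Y0 by (simp add: Y_def)
  also have "\<dots> \<le> (Q K)\<^sup>2 * E (phi * (q * q))" by (rule norm_le_norm_phi[OF deg])
  also have "\<dots> \<le> (Q K)\<^sup>2 * (Q K * Z * Y)"
    unfolding Z_def Y_def by (intro mult_left_mono norm_phi_le[OF deg]) auto
  finally have YZ: "Y * Y \<le> (Q K ^ 3 * Z) * Y"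
    by (simp add: power2_eq_square power3_eq_cube mult_ac)
  have "Y \<le> Q K ^ 3 * Z"
  proof (cases "Y = 0")
    case True
    then show ?thesis using Q_pos[of K] Z0 by (simp add: Z_def)
  next
    case False
    then have "Y > 0" using Y0 by (simp add: Y_def less_le)
    then show ?thesis using YZ by simp
  qed
  then have "Y\<^sup>2 \<le> (Q K ^ 3 * Z)\<^sup>2" using Y0 by (intro power_mono) (auto simp: Y_def)
  then show ?thesis using Z0 Y0 by (simp add: Z_def Y_def power_mult_distrib flip: power_mult)
qed

section \<open>The Jacobi matrix of multiplication by \<open>y\<close>\<close>

definition J :: "nat \<Rightarrow> nat \<Rightarrow> real" where
  "J i j = E (pCons 0 (p i * p j))"

text \<open>\<open>y P\<^sub>j = P\<^sub>j\<^sub>+\<^sub>1 + b\<^sub>j P\<^sub>j + r\<^sub>j P\<^sub>j\<^sub>-\<^sub>1\<close>; both coefficients are read off from the two subleading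
  coefficients of the \<open>P\<^sub>j\<close>.\<close>

definition b :: "nat \<Rightarrow> real" where
  "b j = cf j 1 - cf (Suc j) 1"

definition r :: "nat \<Rightarrow> real" where
  "r j = cf j 2 - cf (Suc j) 2 - b j * cf j 1"

text \<open>The sum of \<open>2 j\<close> and the two Jacobi exponents \<open>a\<close> and
  \<open>-1/2\<close>; the recurrence coefficients have short closed forms in it.\<close>

definition s :: "nat \<Rightarrow> real" where
  "s j = 2 * real j + (a - 1/2)"

lemma s_Suc: "s (Suc j) = s j + 2"
  by (simp add: s_def)

lemma s_ge: "a - 1/2 \<le> s j"
  by (simp add: s_def)

lemma s_gt_1: "1 < s j"
  using a_ge by (simp add: s_def)

lemma E_pCons_smult: "E (pCons 0 (smult c q)) = c * E (pCons 0 q)"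
  using E_smult[of c "pCons 0 q"] by simp

lemma abs_sqnorm [simp]: "\<bar>sqnorm j\<bar> = sqnorm j"
  using sqnorm_pos[of j] by linarith

lemma P_eq_p: "P j = smult (sqrt (sqnorm j)) (p j)"
  using sqnorm_pos[of j] by (simp add: p_def)

text \<open>\<open>P j\<close> is monic and orthogonal to all polynomials of lower degree, so only
  the coefficient of \<open>q\<close> at \<open>j\<close> contributes.\<close>

lemma E_mult_P:
  assumes "degree q \<le> j"
  shows "E (q * P j) = coeff q j * sqnorm j"
proof -
  from p_expansion[OF assms] obtain c where c: "q = (\<Sum>i\<le>j. smult (c i) (p i))" by blast
  have "coeff q j = (\<Sum>i\<le>j. c i * coeff (p i) j)"
    by (subst c) (simp add: coeff_sum)
  also have "\<dots> = (\<Sum>i\<in>{j}. c i * coeff (p i) j)"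
    by (rule sum.mono_neutral_right) (auto simp: coeff_eq_0)
  finally have cj: "coeff q j = c j / sqrt (sqnorm j)" by (simp add: p_def coeff_P)
  have "E (q * P j) = (\<Sum>i\<le>j. c i * E (p i * P j))"
    by (subst c) (simp add: sum_distrib_right E_sum E_smult)
  also have "\<dots> = c j * sqrt (sqnorm j)"
    by (simp add: P_eq_p E_smult E_p if_distrib mult_ac cong: if_cong)
  also have "\<dots> = coeff q j * sqnorm j"
    using real_sqrt_mult_self[of "sqnorm j"] sqnorm_pos[of j] by (simp add: cj field_simps)
  finally show ?thesis .
qed

lemma coeff_P_sub1: "coeff (pCons 0 (P j)) j = cf j 1"
  by (cases j) (simp_all add: coeff_P cf_eq_0)

lemma coeff_P_sub2: "coeff (pCons 0 (P (Suc j))) j = cf (Suc j) 2"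
  by (cases j) (simp_all add: coeff_P cf_eq_0 numeral_2_eq_2)

text \<open>Subtracting \<open>P (Suc j)\<close>, which is orthogonal to \<open>P j\<close>, lowers
  the degree of \<open>y P j\<close> to \<open>j\<close> and leaves \<open>b j\<close> as the
  coefficient there.\<close>

lemma E_y_P_P: "E (pCons 0 (P j * P j)) = b j * sqnorm j"
proof -
  define q where "q = pCons 0 (P j) - P (Suc j)"
  have "degree q \<le> j"
  proof (rule degree_le, intro allI impI)
    fix i assume "j < i"
    then show "coeff q i = 0"
      by (cases i) (auto simp: q_def coeff_P)
  qed
  then have "E (q * P j) = coeff q j * sqnorm j" by (rule E_mult_P)
  moreover have "coeff q j = b j"
    by (simp add: q_def b_def coeff_P_sub1 del: coeff_pCons) (simp add: coeff_P)
  moreover have "E (q * P j) = E (pCons 0 (P j * P j))"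
    by (simp add: q_def left_diff_distrib E_diff E_P_orth)
  ultimately show ?thesis by simp
qed

lemma E_y_P_P_Suc: "E (pCons 0 (P j * P (Suc j))) = sqnorm (Suc j)"
proof -
  have "E (pCons 0 (P j) * P (Suc j)) = coeff (pCons 0 (P j)) (Suc j) * sqnorm (Suc j)"
    by (rule E_mult_P) simp
  then show ?thesis by (simp add: coeff_P)
qed

text \<open>The pairing of \<open>y P (Suc j)\<close> with \<open>P j\<close> is computed twice: it
  equals \<open>sqnorm (Suc j)\<close> by moving \<open>y\<close> to \<open>P j\<close>, and
  \<open>r (Suc j) * sqnorm j\<close> by the three-term recurrence.\<close>

lemma sqnorm_Suc: "sqnorm (Suc j) = r (Suc j) * sqnorm j"
proof -
  define q where "q = pCons 0 (P (Suc j)) - P (Suc (Suc j)) - smult (b (Suc j)) (P (Suc j))"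
  have "degree q \<le> j"
  proof (rule degree_le, intro allI impI)
    fix i assume i: "j < i"
    show "coeff q i = 0"
    proof (cases "i = Suc j")
      case True
      then show ?thesis by (simp add: q_def b_def coeff_P)
    next
      case False
      then show ?thesis using i by (cases i) (auto simp: q_def coeff_P)
    qed
  qed
  then have "E (q * P j) = coeff q j * sqnorm j" by (rule E_mult_P)
  moreover have "coeff q j = r (Suc j)"
    by (simp add: q_def r_def coeff_P_sub2 del: coeff_pCons) (simp add: coeff_P numeral_2_eq_2)
  moreover have "E (q * P j) = E (pCons 0 (P j * P (Suc j)))"
    by (simp add: q_def left_diff_distrib E_diff E_P_orth E_smult mult.commute[of "P (Suc j)"])
  ultimately show ?thesis by (simp add: E_y_P_P_Suc)
qed

lemma J_commute: "J i j = J j i"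
  by (simp add: J_def mult.commute)

lemma J_diag: "J j j = b j"
  using E_y_P_P[of j] sqnorm_pos[of j] by (simp add: J_def p_def E_pCons_smult mult_ac)

lemma r_pos: "0 < r (Suc j)"
  using sqnorm_Suc[of j] sqnorm_pos[of j] sqnorm_pos[of "Suc j"] by (metis zero_less_mult_pos2)

lemma J_Suc: "J j (Suc j) = sqrt (r (Suc j))"
proof -
  have "J j (Suc j) = sqnorm (Suc j) / (sqrt (sqnorm j) * sqrt (sqnorm (Suc j)))"
    using E_y_P_P_Suc[of j] by (simp add: J_def p_def E_pCons_smult mult_ac)
  also have "\<dots> = sqrt (r (Suc j))"
    using sqnorm_pos[of j] r_pos[of j] by (simp add: sqnorm_Suc real_sqrt_mult real_div_sqrt field_simps)
  finally show ?thesis .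
qed

lemma J_eq_0:
  assumes "Suc i < j"
  shows "J i j = 0"
proof -
  have "E (pCons 0 (P i) * P j) = coeff (pCons 0 (P i)) j * sqnorm j"
    by (rule E_mult_P) (use assms in simp)
  also have "coeff (pCons 0 (P i)) j = 0" using assms by (intro coeff_eq_0) simp
  finally show ?thesis by (simp add: J_def p_def E_pCons_smult mult_ac)
qed

lemma cf_1: "cf j 1 = - (real j * (real j - 1/2) / s j)"
proof -
  have "cf j 1 = - ((real j - real 0) * (real j - real 0 - 1/2)) /
     ((real 0 + 1) * (2 * real j - real 0 + a - 1/2)) * cf j 0"
    by (simp only: One_nat_def cf.simps)
  also have "2 * real j - real 0 + a - 1/2 = s j" by (simp add: s_def)
  finally show ?thesis by simp
qed

lemma cf_2: "cf j 2 = (real j - 1) * (real j - 3/2) / (2 * (s j - 1)) * (real j * (real j - 1/2) / s j)"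
proof -
  have "cf j 2 = - ((real j - real 1) * (real j - real 1 - 1/2)) /
     ((real 1 + 1) * (2 * real j - real 1 + a - 1/2)) * cf j 1"
    by (simp only: numeral_2_eq_2 One_nat_def cf.simps)
  also have "real j - real 1 - 1/2 = real j - 3/2" by simp
  also have "2 * real j - real 1 + a - 1/2 = s j - 1" by (simp add: s_def)
  finally show ?thesis unfolding cf_1 by simp
qed

lemma b_eq: "b j = (1 - (a - 1/2) * (a + 1/2) / (s j * (s j + 2))) / 2"
proof -
  \<comment> \<open>Eliminating \<open>a\<close> in favour of \<open>x\<close> and the degree turns
    the claim into an identity of rational functions in two variables; \<open>y\<close> takes the
    place of \<open>real j\<close>.\<close>
  define x where "x = s j"
  have a: "a - 1/2 = x - 2 * real j" "a + 1/2 = x - 2 * real j + 1"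
    by (simp_all add: x_def s_def)
  have nz: "x \<noteq> 0" "x + 2 \<noteq> 0" using s_gt_1[of j] by (auto simp: x_def)
  have "(- (y * (y - 1/2) / x) - - ((1 + y) * ((1 + y) - 1/2) / (x + 2))) =
    (1 - (x - 2 * y) * (x - 2 * y + 1) / (x * (x + 2))) / 2" for y
    using nz by (simp add: divide_simps) (simp add: algebra_simps)
  then show ?thesis
    unfolding b_def cf_1 s_Suc of_nat_Suc x_def[symmetric] a by blast
qed

lemma r_eq: "r j = ((s j)\<^sup>2 - (a - 1/2)\<^sup>2) * ((s j)\<^sup>2 - (a + 1/2)\<^sup>2) / (16 * (s j)\<^sup>2 * ((s j)\<^sup>2 - 1))"
proof -
  define x where "x = s j"
  have a: "a - 1/2 = x - 2 * real j" "a + 1/2 = x - 2 * real j + 1"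
    by (simp_all add: x_def s_def)
  have nz: "x \<noteq> 0" "x + 2 \<noteq> 0" "x + 1 \<noteq> 0" "x - 1 \<noteq> 0" using s_gt_1[of j] by (auto simp: x_def)
  have x2: "x\<^sup>2 - 1 = (x - 1) * (x + 1)" by (simp add: power2_eq_square algebra_simps)
  have x1: "x + 2 - 1 = x + 1" by simp
  have "(y - 1) * (y - 3/2) / (2 * (x - 1)) * (y * (y - 1/2) / x) -
      (1 + y - 1) * (1 + y - 3/2) / (2 * (x + 1)) * ((1 + y) * (1 + y - 1/2) / (x + 2)) -
      (1 - (x - 2 * y) * (x - 2 * y + 1) / (x * (x + 2))) / 2 * - (y * (y - 1/2) / x) =
    (x\<^sup>2 - (x - 2 * y)\<^sup>2) * (x\<^sup>2 - (x - 2 * y + 1)\<^sup>2) / (16 * x\<^sup>2 * ((x - 1) * (x + 1)))" for y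
    using nz by (simp add: divide_simps) (simp add: algebra_simps power2_eq_square)
  then show ?thesis
    unfolding r_def b_eq cf_2 cf_1 s_Suc of_nat_Suc x_def[symmetric] x2 x1 a by blast
qed

section \<open>Bounds for the entries of the Jacobi matrix\<close>

definition row_bound :: "nat \<Rightarrow> real" where
  "row_bound j = 1 - ((a - 1/2)\<^sup>2 - 1) / (s j + 2)\<^sup>2"

text \<open>The diagonal entry receives one half of \<open>row_bound\<close>; each neighbour
  receives a quarter through \<open>sqrt_r_le\<close> with \<open>t = s j + 2\<close>. That shift
  lets one expression serve both \<open>r j\<close> and \<open>r (Suc j)\<close>.\<close>

lemma b_le: "b j \<le> row_bound j / 2"
proof -
  have "((a - 1/2)\<^sup>2 - 1) / (s j + 2)\<^sup>2 \<le> (a - 1/2) * (a + 1/2) / (s j * (s j + 2))"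
  proof (rule frac_le)
    show "0 \<le> (a - 1/2) * (a + 1/2)" using a_ge by (intro mult_nonneg_nonneg) auto
    have "(a - 1/2) * (a + 1/2) = (a - 1/2)\<^sup>2 + (a - 1/2)" by (simp add: power2_eq_square algebra_simps)
    then show "(a - 1/2)\<^sup>2 - 1 \<le> (a - 1/2) * (a + 1/2)" using a_ge by linarith
    show "0 < s j * (s j + 2)" using s_gt_1[of j] by (intro mult_pos_pos) auto
    show "s j * (s j + 2) \<le> (s j + 2)\<^sup>2" using s_gt_1[of j] by (simp add: power2_eq_square mult_right_mono)
  qed
  then show ?thesis unfolding b_eq row_bound_def by (intro divide_right_mono diff_left_mono) auto
qed

lemma b_ge:
  assumes "0 < t" "t \<le> s j"
  shows "(1 - (a + 1/2)\<^sup>2 / t\<^sup>2) / 2 \<le> b j"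
proof -
  have "(a - 1/2) * (a + 1/2) / (s j * (s j + 2)) \<le> (a + 1/2)\<^sup>2 / t\<^sup>2"
    using a_ge assms by (intro frac_le) (auto simp: power2_eq_square intro!: mult_mono)
  then show ?thesis unfolding b_eq by (intro divide_right_mono diff_left_mono) auto
qed

text \<open>Replacing \<open>a + 1/2\<close> by \<open>a - 1/2\<close> in the numerator and
  \<open>x\<close> by \<open>x - 1\<close> in the denominator turns the bound for \<open>r j\<close>
  into a perfect square, whose root is \<open>(1 - (D - 1) / (x - 1)) / 4\<close>.\<close>

lemma sqrt_r_le:
  assumes "s j \<le> t"
  shows "sqrt (r j) \<le> (1 - ((a - 1/2)\<^sup>2 - 1) / t\<^sup>2) / 4"
proof -
  define D where "D = (a - 1/2)\<^sup>2"
  define x where "x = (s j)\<^sup>2"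
  have x1: "1 < x" using s_gt_1[of j] by (simp add: x_def)
  have D1: "1 < D" using a_ge one_less_power[of "a - 1/2" 2] by (simp add: D_def)
  have Dx: "D \<le> x" unfolding D_def x_def using a_ge s_ge[of j] by (intro power_mono) auto
  have "D \<le> (a + 1/2)\<^sup>2" using a_ge by (auto simp: D_def intro!: power_mono)
  then have "(x - D) * (x - (a + 1/2)\<^sup>2) \<le> (x - D) * (x - D)"
    using Dx by (intro mult_left_mono) auto
  then have "r j \<le> ((x - D) * (x - D)) / (16 * ((x - 1) * (x - 1)))"
    unfolding r_eq x_def[symmetric] D_def[symmetric]
    using x1 Dx by (intro frac_le) (auto intro!: mult_right_mono)
  also have "\<dots> = ((x - D) / (4 * (x - 1)))\<^sup>2"
  proof -
    have "u * u / (16 * (z * z)) = (u / (4 * z))\<^sup>2" for u z :: real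
      by (simp add: power2_eq_square)
    then show ?thesis .
  qed
  finally have "sqrt (r j) \<le> sqrt (((x - D) / (4 * (x - 1)))\<^sup>2)"
    by (rule real_sqrt_le_mono)
  also have "\<dots> = (x - D) / (4 * (x - 1))"
    using x1 Dx by simp
  also have "\<dots> = (1 - (D - 1) / (x - 1)) / 4"
    using x1 by (simp add: field_simps)
  also have "\<dots> \<le> (1 - (D - 1) / t\<^sup>2) / 4"
  proof -
    have "x \<le> t\<^sup>2" unfolding x_def using assms s_gt_1[of j] by (intro power_mono) auto
    then have "(D - 1) / t\<^sup>2 \<le> (D - 1) / (x - 1)" using x1 D1 by (intro frac_le) auto
    then show ?thesis by (intro divide_right_mono diff_left_mono) auto
  qed
  finally show ?thesis by (simp add: D_def)
qed

text \<open>Again a perfect square, now with \<open>a + 1/2\<close> in both factors and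
  \<open>x\<close> in place of \<open>x - 1\<close>. The index \<open>Suc j\<close> ensures
  \<open>a + 1/2 <= s (Suc j)\<close>.\<close>

lemma sqrt_r_ge:
  assumes "0 < t" "t \<le> s (Suc j)"
  shows "(1 - (a + 1/2)\<^sup>2 / t\<^sup>2) / 4 \<le> sqrt (r (Suc j))"
proof -
  define D where "D = (a + 1/2)\<^sup>2"
  define x where "x = (s (Suc j))\<^sup>2"
  have x1: "1 < x" using s_gt_1[of "Suc j"] by (simp add: x_def)
  have Dx: "D \<le> x" unfolding D_def x_def using a_ge by (intro power_mono) (auto simp: s_def)
  have "(a - 1/2)\<^sup>2 \<le> D" using a_ge by (auto simp: D_def intro!: power_mono)
  then have "(x - D) * (x - D) \<le> (x - (a - 1/2)\<^sup>2) * (x - D)"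
    using Dx by (intro mult_right_mono) auto
  then have "((x - D) * (x - D)) / (16 * x * x) \<le> r (Suc j)"
    unfolding r_eq x_def[symmetric] D_def[symmetric]
    using x1 Dx \<open>(a - 1/2)\<^sup>2 \<le> D\<close> by (intro frac_le) auto
  then have "((x - D) / (4 * x))\<^sup>2 \<le> r (Suc j)"
    by (simp add: power2_eq_square)
  then have *: "(x - D) / (4 * x) \<le> sqrt (r (Suc j))" by (rule real_le_rsqrt)
  have "D / x \<le> D / t\<^sup>2"
    using x1 assms by (intro divide_left_mono) (auto simp: D_def x_def)
  then have "(1 - D / t\<^sup>2) / 4 \<le> (1 - D / x) / 4"
    by (intro divide_right_mono diff_left_mono) auto
  also have "\<dots> = (x - D) / (4 * x)"
    using x1 by (simp add: field_simps)
  also note *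
  finally show ?thesis by (simp add: D_def)
qed

lemma b_nonneg: "0 \<le> b j"
proof -
  have "s j * (s j + 2) \<ge> (a - 1/2) * (a + 1/2)"
    using s_ge[of j] a_ge by (intro mult_mono) auto
  then show ?thesis using s_gt_1[of j] a_ge by (simp add: b_eq)
qed

lemma J_nonneg: "0 \<le> J i j"
proof -
  have *: "0 \<le> J i j" if "i \<le> j" for i j
  proof -
    have "i = j \<or> j = Suc i \<or> Suc i < j" using that by auto
    then consider "i = j" | "j = Suc i" | "Suc i < j" by blast
    then show ?thesis
      using r_pos[of i] by cases (auto simp: J_diag J_Suc J_eq_0 b_nonneg less_imp_le)
  qed
  show ?thesis using *[of i j] *[of j i] J_commute[of i j] by (cases "i \<le> j") auto
qed

lemma J_row_sum_le:
  assumes "finite I"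
  shows "(\<Sum>j\<in>I. J i j) \<le> row_bound i"
proof -
  have up: "J i (Suc i) \<le> row_bound i / 4"
    using sqrt_r_le[of "Suc i" "s i + 2"] by (simp add: J_Suc s_Suc row_bound_def)
  have down: "J i i' \<le> row_bound i / 4" if "i = Suc i'" for i'
    using sqrt_r_le[of i "s i + 2"] J_commute[of i i'] by (simp add: that J_Suc row_bound_def)
  have diag: "J i i \<le> row_bound i / 2" unfolding J_diag by (rule b_le)
  define N where "N = {j. j = i \<or> j = Suc i \<or> Suc j = i}"
  have N: "N = (if i = 0 then {i, Suc i} else {i, Suc i, i - 1})"
    by (auto simp: N_def)
  have "(\<Sum>j\<in>I. J i j) = (\<Sum>j\<in>I \<inter> N. J i j)"
  proof (rule sum.mono_neutral_right)
    show "\<forall>j\<in>I - I \<inter> N. J i j = 0"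
    proof
      fix j assume "j \<in> I - I \<inter> N"
      then have "Suc i < j \<or> Suc j < i" by (auto simp: N_def)
      then show "J i j = 0" using J_eq_0 J_commute by metis
    qed
  qed (use assms in auto)
  also have "\<dots> \<le> (\<Sum>j\<in>N. J i j)"
    by (rule sum_mono2) (auto simp: J_nonneg N)
  also have "\<dots> \<le> row_bound i"
  \<comment> \<open>Row \<open>0\<close> has no lower neighbour, so only three quarters are used and
    \<open>0 <= row_bound i\<close> supplies the rest.\<close>
  proof (cases i)
    case 0
    then have "row_bound i \<ge> 0" using diag J_nonneg[of i i] by simp
    then show ?thesis using up diag 0 unfolding N by simp
  next
    case (Suc i')
    then show ?thesis using up diag down[OF Suc] unfolding N by simp
  qed
  finally show ?thesis .
qed

text \<open>The window has \<open>M\<close> diagonal entries of size at least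
  \<open>\<kappa> / 2\<close> and \<open>2 (M - 1)\<close> adjacent ones of size at least
  \<open>\<kappa> / 4\<close>; these add up to \<open>\<kappa> (M - 1/2)\<close>.\<close>

lemma J_window_ge:
  assumes t: "0 < s t" and M: "1 \<le> M" and k: "0 \<le> \<kappa>" "\<kappa> \<le> 1 - (a + 1/2)\<^sup>2 / (s t)\<^sup>2"
  shows "\<kappa> * (real M - 1/2) \<le> (\<Sum>i\<in>{t..<t + M}. \<Sum>j\<in>{t..<t + M}. J i j)"
  using M
proof (induction M rule: dec_induct)
  case base
  then show ?case using b_ge[OF t order_refl] k by (simp add: J_diag)
next
  case (step M)
  then obtain M' where M': "M = Suc M'" by (cases M) auto
  have b': "\<kappa> / 2 \<le> J (t + M) (t + M)"
    using b_ge[OF t, of "t + M"] k by (simp add: J_diag s_def)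
  have "\<kappa> / 4 \<le> J (t + M') (Suc (t + M'))"
    using sqrt_r_ge[OF t, of "t + M'"] k by (simp add: J_Suc s_def)
  also have "\<dots> \<le> (\<Sum>i\<in>{t..<t + M}. J i (t + M))"
    using member_le_sum[of "t + M'" "{t..<t + M}" "\<lambda>i. J i (t + M)"] by (simp add: M' J_nonneg)
  finally have off: "\<kappa> / 4 \<le> (\<Sum>i\<in>{t..<t + M}. J i (t + M))" .
  have "(\<Sum>i\<in>{t..<t + Suc M}. \<Sum>j\<in>{t..<t + Suc M}. J i j) =
     (\<Sum>i\<in>{t..<t + M}. \<Sum>j\<in>{t..<t + M}. J i j) + 2 * (\<Sum>i\<in>{t..<t + M}. J i (t + M)) + J (t + M) (t + M)"
  proof -
    have "(\<Sum>j\<in>{t..<t + M}. J (t + M) j) = (\<Sum>i\<in>{t..<t + M}. J i (t + M))"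
      by (intro sum.cong refl J_commute)
    then show ?thesis by (simp add: sum.distrib)
  qed
  with step.IH off b' show ?case by (simp add: algebra_simps)
qed

lemma E_p_sum:
  assumes "finite I" "finite K"
  shows "E (pCons 0 ((\<Sum>i\<in>I. smult (c i) (p i)) * (\<Sum>j\<in>K. smult (d j) (p j)))) =
   (\<Sum>i\<in>I. \<Sum>j\<in>K. c i * d j * J i j)"
proof -
  have "pCons 0 ((\<Sum>i\<in>I. smult (c i) (p i)) * (\<Sum>j\<in>K. smult (d j) (p j))) =
     [:0, 1:] * ((\<Sum>i\<in>I. smult (c i) (p i)) * (\<Sum>j\<in>K. smult (d j) (p j)))" by simp
  also have "\<dots> = (\<Sum>i\<in>I. \<Sum>j\<in>K. smult (c i * d j) ([:0, 1:] * (p i * p j)))"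
    unfolding sum_product unfolding sum_distrib_left by (intro sum.cong refl) (simp add: mult.commute)
  finally show ?thesis by (simp only: E_sum E_smult) (simp add: J_def)
qed

text \<open>The witness is the sum of \<open>p t\<close>, ..., \<open>p (t + M - 1)\<close> divided
  by \<open>sqrt M\<close>. Its Rayleigh quotient is the window sum over \<open>M\<close>; the loss
  \<open>1 / (2 M)\<close> comes from the ends of the window.\<close>

lemma test_poly:
  assumes "0 < s t" "1 \<le> M" "0 \<le> \<kappa>" "\<kappa> \<le> 1 - (a + 1/2)\<^sup>2 / (s t)\<^sup>2"
  obtains v where "degree v < t + M" "E (v * v) = 1" "\<kappa> * (1 - 1 / (2 * real M)) \<le> E (pCons 0 (v * v))"
proof -
  define v' where "v' = (\<Sum>j\<in>{t..<t + M}. smult 1 (p j))"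
  define v where "v = smult (1 / sqrt (real M)) v'"
  have "E (v' * v') = real M"
    unfolding v'_def by (subst E_sum_smult) (simp add: E_p)
  then have 1: "E (v * v) = 1" using assms(2) by (simp add: v_def E_smult)
  have "degree v' < t + M"
    unfolding v'_def using assms(2) by (intro degree_sum_less) auto
  then have 2: "degree v < t + M" by (simp add: v_def)
  have "\<kappa> * (real M - 1/2) \<le> E (pCons 0 (v' * v'))"
    unfolding v'_def by (subst E_p_sum) (use J_window_ge[OF assms] in simp_all)
  then have "\<kappa> * (real M - 1/2) / real M \<le> E (pCons 0 (v' * v')) / real M"
    by (rule divide_right_mono) simp
  also have "\<dots> = E (pCons 0 (v * v))"
    by (simp add: v_def E_pCons_smult)
  also have "\<kappa> * (real M - 1/2) / real M = \<kappa> * (1 - 1 / (2 * real M))"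
    using assms(2) by (simp add: field_simps)
  finally show ?thesis using that 1 2 by blast
qed

section \<open>The product weight and the Vandermonde weight\<close>

definition mu :: "nat \<Rightarrow> (nat \<Rightarrow> real) measure" where
  "mu m = PiM {..<m} (\<lambda>_. nu)"

lemma finite_measure_nu: "finite_measure nu"
proof (rule finite_measureI)
  have "integrable nu (\<lambda>_. 1 :: real)" using integrable_monomial[of 0] by simp
  then show "emeasure nu (space nu) \<noteq> \<infinity>" by (simp add: integrable_iff_bounded)
qed

sublocale nu: finite_measure nu
  by (rule finite_measure_nu)

sublocale PS: product_sigma_finite "\<lambda>_::nat. nu"
  by standard

sublocale mu: finite_measure "mu m" for m
proof (rule finite_measureI)
  have "emeasure (mu m) (\<Pi>\<^sub>E i\<in>{..<m}. space nu) = (\<Prod>i<m. emeasure nu (space nu))"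
    unfolding mu_def by (rule PS.emeasure_PiM) auto
  moreover have "\<dots> < \<infinity>"
    by (simp add: nu.emeasure_eq_measure ennreal_power)
  ultimately show "emeasure (mu m) (space (mu m)) \<noteq> \<infinity>"
    by (simp add: mu_def space_PiM)
qed

text \<open>Both measures agree on boxes. This connects the product measure, where integrals of
  products factor, with Lebesgue measure as used in \<open>ip\<close>.\<close>

lemma mu_density: "mu m = density (lebm m) (\<lambda>y. \<Prod>i<m. ennreal (w (y i)))"
proof -
  interpret L: product_sigma_finite "\<lambda>_::nat. lborel :: real measure" by standard
  have [measurable]: "(\<lambda>y. \<Prod>i<m. ennreal (w (y i))) \<in> borel_measurable (lebm m)"
    unfolding lebm_def by measurable
  show ?thesis unfolding mu_def
  proof (rule PS.PiM_eqI[symmetric])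
    show "sets (density (lebm m) (\<lambda>y. \<Prod>i<m. ennreal (w (y i)))) = sets (PiM {..<m} (\<lambda>_. nu))"
      by (simp add: lebm_def cong: sets_PiM_cong)
    fix A :: "nat \<Rightarrow> real set" assume A: "\<And>i. i \<in> {..<m} \<Longrightarrow> A i \<in> sets nu"
    then have Am: "Pi\<^sub>E {..<m} A \<in> sets (lebm m)"
      unfolding lebm_def by (intro sets_PiM_I_finite) auto
    have [measurable]: "A i \<in> sets borel" if "i < m" for i using A that by simp
    have "emeasure (density (lebm m) (\<lambda>y. \<Prod>i<m. ennreal (w (y i)))) (Pi\<^sub>E {..<m} A)
       = (\<integral>\<^sup>+y. (\<Prod>i<m. ennreal (w (y i))) * indicator (Pi\<^sub>E {..<m} A) y \<partial>lebm m)"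
      using Am by (subst emeasure_density) auto
    also have "\<dots> = (\<integral>\<^sup>+y. (\<Prod>i<m. ennreal (w (y i)) * indicator (A i) (y i)) \<partial>lebm m)"
    proof (rule nn_integral_cong)
      fix y assume "y \<in> space (lebm m)"
      then have "indicator (Pi\<^sub>E {..<m} A) y = (\<Prod>i<m. indicator (A i) (y i) :: ennreal)"
        by (auto simp: lebm_def space_PiM indicator_def PiE_def Pi_def)
      then show "(\<Prod>i<m. ennreal (w (y i))) * indicator (Pi\<^sub>E {..<m} A) y = (\<Prod>i<m. ennreal (w (y i)) * indicator (A i) (y i))"
        by (simp add: prod.distrib)
    qed
    also have "\<dots> = (\<Prod>i<m. \<integral>\<^sup>+t. ennreal (w t) * indicator (A i) t \<partial>lborel)"
      unfolding lebm_def by (rule L.product_nn_integral_prod) auto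
    also have "\<dots> = (\<Prod>i<m. emeasure nu (A i))"
      using A unfolding nu_def by (intro prod.cong refl) (simp add: emeasure_density)
    finally show "emeasure (density (lebm m) (\<lambda>y. \<Prod>i<m. ennreal (w (y i)))) (Pi\<^sub>E {..<m} A) = (\<Prod>i<m. emeasure nu (A i))" .
  qed auto
qed

lemma AE_mu: "AE y in mu m. \<forall>i<m. 0 \<le> y i \<and> y i \<le> 1"
proof -
  have [measurable]: "(\<lambda>y. \<Prod>i<m. ennreal (w (y i))) \<in> borel_measurable (lebm m)"
    unfolding lebm_def by measurable
  have "0 \<le> t \<and> t \<le> 1" if "ennreal (w t) \<noteq> 0" for t
    using that by (auto simp: w_def indicator_def split: if_splits)
  then show ?thesis
    unfolding mu_density by (subst AE_density) (auto simp: zero_less_iff_neq_zero)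
qed

lemma polys_measurable_mu: "f \<in> polys m k \<Longrightarrow> f \<in> borel_measurable (mu m)"
  unfolding mu_def by (rule polys_measurable) auto

lemma vd_measurable: "vd m \<in> borel_measurable (mu m)"
  using polys_diff_power[OF order_refl polys_const[of 1 m 0]] polys_measurable_mu
  unfolding vd_eq[abs_def] by fastforce

lemma integrable_polys:
  assumes "f \<in> polys m k"
  shows "integrable (mu m) f"
proof -
  obtain B where "\<forall>y. (\<forall>i<m. 0 \<le> y i \<and> y i \<le> 1) \<longrightarrow> \<bar>f y\<bar> \<le> B"
    using polys_bounded[OF assms] by blast
  then show ?thesis
    using AE_mu[of m] by (intro mu.integrable_const_bound[of _ B] polys_measurable_mu[OF assms]) auto
qed

lemma integrable_polys_vd:
  assumes "f \<in> polys m k"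
  shows "integrable (mu m) (\<lambda>y. f y * \<bar>vd m y\<bar>)"
proof (rule Bochner_Integration.integrable_bound[OF integrable_polys[OF assms]])
  show "AE y in mu m. norm (f y * \<bar>vd m y\<bar>) \<le> norm (f y)"
    using AE_mu[of m] by eventually_elim (auto simp: abs_mult intro!: mult_left_le abs_vd_le_1)
  note polys_measurable_mu[OF assms, measurable] vd_measurable[of m, measurable]
  show "(\<lambda>y. f y * \<bar>vd m y\<bar>) \<in> borel_measurable (mu m)" by measurable
qed

text \<open>The inner product \<open>ip\<close> is a positive multiple of \<open>ip1\<close>; in \<open>ip0\<close> the Vandermonde factor is dropped.\<close>

definition ip0 :: "nat \<Rightarrow> ((nat \<Rightarrow> real) \<Rightarrow> real) \<Rightarrow> ((nat \<Rightarrow> real) \<Rightarrow> real) \<Rightarrow> real" where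
  "ip0 m f g = (\<integral>y. f y * g y \<partial>mu m)"

definition ip1 :: "nat \<Rightarrow> ((nat \<Rightarrow> real) \<Rightarrow> real) \<Rightarrow> ((nat \<Rightarrow> real) \<Rightarrow> real) \<Rightarrow> real" where
  "ip1 m f g = (\<integral>y. f y * g y * \<bar>vd m y\<bar> \<partial>mu m)"

text \<open>The indicator of the cube is the product of the indicators contained in the factors
  \<open>w (y i)\<close>.\<close>

lemma cube_integral_eq:
  assumes "a = real n / 2 - real m - 1/2" and F: "F \<in> borel_measurable (mu m)"
  shows "(LINT y:cube m|lebm m. F y * weight n m y) = (\<integral>y. F y * \<bar>vd m y\<bar> \<partial>mu m)"
proof -
  have "sets (mu m) = sets (lebm m)"
    unfolding mu_def lebm_def by (rule sets_PiM_cong) auto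
  then have [measurable]: "F \<in> borel_measurable (lebm m)" "vd m \<in> borel_measurable (lebm m)"
    using F vd_measurable[of m] measurable_cong_sets by blast+
  have [measurable]: "(\<lambda>y. \<Prod>i<m. w (y i)) \<in> borel_measurable (lebm m)"
    unfolding lebm_def by measurable
  have "(\<integral>y. F y * \<bar>vd m y\<bar> \<partial>mu m) = (\<integral>y. (\<Prod>i<m. w (y i)) *\<^sub>R (F y * \<bar>vd m y\<bar>) \<partial>lebm m)"
  proof -
    have "mu m = density (lebm m) (\<lambda>y. ennreal (\<Prod>i<m. w (y i)))"
      unfolding mu_density by (simp add: prod_ennreal)
    then show ?thesis by (simp only:) (subst integral_density, auto intro!: AE_I2 prod_nonneg)
  qed
  also have "\<dots> = (LINT y:cube m|lebm m. F y * weight n m y)"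
    unfolding set_lebesgue_integral_def
  proof (rule Bochner_Integration.integral_cong[OF refl])
    fix y assume "y \<in> space (lebm m)"
    then have "indicator (cube m) y = (\<Prod>i<m. indicator {0..1} (y i) :: real)"
      by (auto simp: lebm_def cube_def space_PiM indicator_def PiE_def Pi_def extensional_def)
    moreover have "(\<Prod>i<m. \<Prod>j\<in>{i<..<m}. \<bar>y i - y j\<bar>) = \<bar>vd m y\<bar>"
      by (simp add: vd_def abs_prod)
    ultimately show "(\<Prod>i<m. w (y i)) *\<^sub>R (F y * \<bar>vd m y\<bar>) = indicator (cube m) y *\<^sub>R (F y * weight n m y)"
      by (simp add: weight_def w_def[abs_def] prod.distrib flip: assms(1))
  qed
  finally show ?thesis by simp
qed

section \<open>The basis of products of Jacobi polynomials\<close>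

definition eb :: "nat \<Rightarrow> (nat \<Rightarrow> nat) \<Rightarrow> (nat \<Rightarrow> real) \<Rightarrow> real" where
  "eb m \<alpha> y = (\<Prod>i<m. poly (p (\<alpha> i)) (y i))"

lemma integral_prod_poly:
  "(\<integral>y. (\<Prod>i<m. poly (q i) (y i)) \<partial>mu m) = (\<Prod>i<m. E (q i))"
  unfolding mu_def E_def by (rule PS.product_integral_prod) auto

text \<open>\<open>t ^ n\<close> is a combination of the \<open>p j\<close> with
  \<open>j <= n\<close>, so expanding each factor of a monomial never raises the total
  degree.\<close>

lemma eb_expansion:
  assumes "f \<in> polys m k"
  shows "\<exists>c. \<forall>y. f y = (\<Sum>\<alpha>\<in>exps m k. c \<alpha> * eb m \<alpha> y)"
proof -
  obtain c where c: "\<And>y. f y = (\<Sum>\<alpha>\<in>exps m k. c \<alpha> * (\<Prod>i<m. y i ^ \<alpha> i))"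
    using assms unfolding polys_def by blast
  have "\<exists>d. \<forall>n. monom 1 n = (\<Sum>j\<le>n. smult (d n j) (p j))"
    using p_expansion[OF degree_monom_le] by (intro choice) auto
  then obtain d where d: "\<And>n. monom 1 n = (\<Sum>j\<le>n. smult (d n j) (p j))" by blast
  have pw: "t ^ n = (\<Sum>j\<le>n. d n j * poly (p j) t)" for n t
    using arg_cong[OF d[of n], of "\<lambda>q. poly q t"] by (simp add: poly_monom poly_sum)
  \<comment> \<open>Setting \<open>D\<close> to \<open>0\<close> outside the box below
    \<open>\<alpha>\<close> allows the sum to be extended to all of \<open>exps m k\<close>.\<close>
  define D where "D \<alpha> \<beta> = (if \<beta> \<in> PiE {..<m} (\<lambda>i. {..\<alpha> i}) then \<Prod>i<m. d (\<alpha> i) (\<beta> i) else 0)" for \<alpha> \<beta>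
  have "(\<Prod>i<m. y i ^ \<alpha> i) = (\<Sum>\<beta>\<in>exps m k. D \<alpha> \<beta> * eb m \<beta> y)" if "\<alpha> \<in> exps m k" for \<alpha> y
  proof -
    have sub: "PiE {..<m} (\<lambda>i. {..\<alpha> i}) \<subseteq> exps m k"
    proof
      fix \<beta> assume \<beta>: "\<beta> \<in> PiE {..<m} (\<lambda>i. {..\<alpha> i})"
      have "sum \<beta> {..<m} \<le> sum \<alpha> {..<m}" using \<beta> by (intro sum_mono) auto
      moreover have "restrict \<beta> {..<m} = \<beta>" using \<beta> by (auto simp: PiE_def extensional_restrict)
      ultimately show "\<beta> \<in> exps m k" using that restrict_in_exps[of \<beta> m k] by (simp add: exps_def)
    qed
    have "(\<Prod>i<m. y i ^ \<alpha> i) = (\<Prod>i<m. \<Sum>j\<le>\<alpha> i. d (\<alpha> i) j * poly (p j) (y i))"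
      by (simp only: pw)
    also have "\<dots> = (\<Sum>\<beta>\<in>PiE {..<m} (\<lambda>i. {..\<alpha> i}). \<Prod>i<m. d (\<alpha> i) (\<beta> i) * poly (p (\<beta> i)) (y i))"
      by (rule prod_sum_PiE) auto
    also have "\<dots> = (\<Sum>\<beta>\<in>PiE {..<m} (\<lambda>i. {..\<alpha> i}). D \<alpha> \<beta> * eb m \<beta> y)"
      by (intro sum.cong refl) (simp add: D_def eb_def prod.distrib)
    also have "\<dots> = (\<Sum>\<beta>\<in>exps m k. D \<alpha> \<beta> * eb m \<beta> y)"
      by (rule sum.mono_neutral_left[OF finite_exps sub]) (auto simp: D_def)
    finally show ?thesis .
  qed
  then have "f y = (\<Sum>\<alpha>\<in>exps m k. c \<alpha> * (\<Sum>\<beta>\<in>exps m k. D \<alpha> \<beta> * eb m \<beta> y))" for y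
    unfolding c by (intro sum.cong refl) simp
  also have "\<dots> y = (\<Sum>\<beta>\<in>exps m k. (\<Sum>\<alpha>\<in>exps m k. c \<alpha> * D \<alpha> \<beta>) * eb m \<beta> y)" for y
    by (simp add: sum_distrib_left sum_distrib_right mult.assoc) (rule sum.swap)
  finally show ?thesis by (intro exI[of _ "\<lambda>\<beta>. \<Sum>\<alpha>\<in>exps m k. c \<alpha> * D \<alpha> \<beta>"] allI)
qed

lemma eb_polys: "\<alpha> \<in> exps m k \<Longrightarrow> eb m \<alpha> \<in> polys m k"
  using polys_prod_poly[of "{..<m}" m "\<lambda>i. p (\<alpha> i)" \<alpha>] polys_mono[of _ m "sum \<alpha> {..<m}" k]
  unfolding eb_def[abs_def] by (auto simp: exps_def)

lemma exps_eq_iff: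
  assumes "\<alpha> \<in> exps m k" "\<beta> \<in> exps m k"
  shows "\<alpha> = \<beta> \<longleftrightarrow> (\<forall>i<m. \<alpha> i = \<beta> i)"
  using assms by (auto simp: exps_def PiE_def intro: extensionalityI)

lemma ip0_eb:
  assumes "\<alpha> \<in> exps m k" "\<beta> \<in> exps m k"
  shows "ip0 m (eb m \<alpha>) (eb m \<beta>) = (if \<alpha> = \<beta> then 1 else 0)"
proof -
  have "ip0 m (eb m \<alpha>) (eb m \<beta>) = (\<Prod>i<m. E (p (\<alpha> i) * p (\<beta> i)))"
    using integral_prod_poly[of m "\<lambda>i. p (\<alpha> i) * p (\<beta> i)"]
    by (simp add: ip0_def eb_def prod.distrib)
  then show ?thesis
    unfolding exps_eq_iff[OF assms] by (auto simp: E_p intro!: prod.neutral)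
qed

lemma ip0_sum:
  assumes "\<And>i. i \<in> I \<Longrightarrow> f i \<in> polys m k" "\<And>j. j \<in> K \<Longrightarrow> g j \<in> polys m k'"
  shows "ip0 m (\<lambda>y. \<Sum>i\<in>I. c i * f i y) (\<lambda>y. \<Sum>j\<in>K. d j * g j y) = (\<Sum>i\<in>I. \<Sum>j\<in>K. c i * d j * ip0 m (f i) (g j))"
proof -
  have int: "integrable (mu m) (\<lambda>y. f i y * g j y)" if "i \<in> I" "j \<in> K" for i j
    using integrable_polys[OF polys_mult] assms that by blast
  have "ip0 m (\<lambda>y. \<Sum>i\<in>I. c i * f i y) (\<lambda>y. \<Sum>j\<in>K. d j * g j y) =
    (\<integral>y. (\<Sum>i\<in>I. \<Sum>j\<in>K. c i * d j * (f i y * g j y)) \<partial>mu m)"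
    unfolding ip0_def sum_product by (simp add: mult_ac)
  also have "\<dots> = (\<Sum>i\<in>I. \<Sum>j\<in>K. c i * d j * ip0 m (f i) (g j))"
    using int by (simp add: ip0_def)
  finally show ?thesis .
qed

lemma ip0_expansion:
  assumes "\<And>y. f y = (\<Sum>\<alpha>\<in>exps m k. c \<alpha> * eb m \<alpha> y)"
  shows "ip0 m f f = (\<Sum>\<alpha>\<in>exps m k. (c \<alpha>)\<^sup>2)"
proof -
  have "f = (\<lambda>y. \<Sum>\<alpha>\<in>exps m k. c \<alpha> * eb m \<alpha> y)" using assms by blast
  then have "ip0 m f f = (\<Sum>\<alpha>\<in>exps m k. \<Sum>\<beta>\<in>exps m k. c \<alpha> * c \<beta> * ip0 m (eb m \<alpha>) (eb m \<beta>))"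
    by (simp only:) (rule ip0_sum; rule eb_polys)
  also have "\<dots> = (\<Sum>\<alpha>\<in>exps m k. (c \<alpha>)\<^sup>2)"
    by (intro sum.cong refl) (simp add: ip0_eb if_distrib power2_eq_square cong: if_cong)
  finally show ?thesis .
qed

text \<open>By orthonormality the squared norm is the sum of the squared coefficients, and a
  function that is not identically \<open>0\<close> has a non-zero one.\<close>

lemma ip0_pos:
  assumes "f \<in> polys m k" "f \<noteq> (\<lambda>_. 0)"
  shows "0 < ip0 m f f"
proof -
  obtain c where c: "\<And>y. f y = (\<Sum>\<alpha>\<in>exps m k. c \<alpha> * eb m \<alpha> y)" using eb_expansion[OF assms(1)] by blast
  have "\<exists>\<alpha>\<in>exps m k. c \<alpha> \<noteq> 0"
  proof (rule ccontr)
    assume "\<not> ?thesis"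
    then have "f y = 0" for y unfolding c by simp
    then show False using assms(2) by blast
  qed
  then show ?thesis unfolding ip0_expansion[OF c] by (auto intro!: sum_pos2)
qed

text \<open>\<open>m\<close> times \<open>row_bound\<close> continued to the real degree
  \<open>k / m\<close>, where \<open>s + 2\<close> becomes \<open>a + 3/2 + 2 k / m\<close>.\<close>

definition upper :: "nat \<Rightarrow> nat \<Rightarrow> real" where
  "upper m k = real m * (1 - ((a - 1/2)\<^sup>2 - 1) / (a + 3/2 + 2 * real k / real m)\<^sup>2)"

text \<open>The tangent-line bound \<open>1/x\<^sup>2 \<ge> 3/X\<^sup>2 - 2x/X\<^sup>3\<close> expresses the concavity of \<open>row_bound\<close>;
  it is summed with \<open>X\<close> the largest possible mean of the arguments.\<close>

lemma sum_row_bound_le: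
  assumes \<alpha>: "\<alpha> \<in> exps m k" and m: "1 \<le> m"
  shows "(\<Sum>i<m. row_bound (\<alpha> i)) \<le> upper m k"
proof -
  define X where "X = a + 3/2 + 2 * real k / real m"
  have X: "0 < X" using a_ge by (simp add: X_def add_pos_nonneg)
  have tangent: "3 / X\<^sup>2 - 2 * x / X ^ 3 \<le> 1 / x\<^sup>2" if "0 < x" for x
  proof -
    \<comment> \<open>Divided by \<open>x^2 X^3\<close>, this is the tangent inequality; the double
      root at \<open>x = X\<close> expresses tangency.\<close>
    have "0 \<le> (X - x)\<^sup>2 * (X + 2 * x)" using X that by simp
    also have "\<dots> = X ^ 3 + 2 * x ^ 3 - 3 * x\<^sup>2 * X" by (simp add: power2_eq_square power3_eq_cube algebra_simps)
    finally have "3 * x\<^sup>2 * X - 2 * x ^ 3 \<le> X ^ 3" by simp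
    then have "(3 * x\<^sup>2 * X - 2 * x ^ 3) / (x\<^sup>2 * X ^ 3) \<le> X ^ 3 / (x\<^sup>2 * X ^ 3)"
      using X that by (intro divide_right_mono) auto
    then show ?thesis using X that by (simp add: diff_divide_distrib power2_eq_square power3_eq_cube)
  qed
  have pos: "0 < s (\<alpha> i) + 2" for i using s_gt_1[of "\<alpha> i"] by simp
  have sum_s: "(\<Sum>i<m. s (\<alpha> i) + 2) \<le> real m * X"
  proof -
    have "sum \<alpha> {..<m} \<le> k" using \<alpha> by (simp add: exps_def)
    then have "(\<Sum>i<m. real (\<alpha> i)) \<le> real k" unfolding of_nat_sum[symmetric] of_nat_le_iff .
    moreover have "(\<Sum>i<m. s (\<alpha> i) + 2) = 2 * (\<Sum>i<m. real (\<alpha> i)) + real m * (a + 3/2)"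
      by (simp add: s_def sum.distrib sum_distrib_left algebra_simps)
    moreover have "real m * X = real m * (a + 3/2) + 2 * real k" using m by (simp add: X_def algebra_simps)
    ultimately show ?thesis by linarith
  qed
  have "real m / X\<^sup>2 = 3 * real m / X\<^sup>2 - 2 * (real m * X) / X ^ 3"
    using X by (simp add: field_simps power2_eq_square power3_eq_cube)
  also have "\<dots> \<le> 3 * real m / X\<^sup>2 - 2 * (\<Sum>i<m. s (\<alpha> i) + 2) / X ^ 3"
    using sum_s X by (intro diff_left_mono divide_right_mono) auto
  also have "\<dots> = (\<Sum>i<m. 3 / X\<^sup>2 - 2 * (s (\<alpha> i) + 2) / X ^ 3)"
    by (simp add: sum_subtractf sum_divide_distrib sum_distrib_left)
  also have "\<dots> \<le> (\<Sum>i<m. 1 / (s (\<alpha> i) + 2)\<^sup>2)"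
    by (intro sum_mono tangent pos)
  finally have "((a - 1/2)\<^sup>2 - 1) * (real m / X\<^sup>2) \<le> ((a - 1/2)\<^sup>2 - 1) * (\<Sum>i<m. 1 / (s (\<alpha> i) + 2)\<^sup>2)"
    using a_ge one_le_power[of "a - 1/2" 2] by (intro mult_left_mono) auto
  moreover have "(\<Sum>i<m. row_bound (\<alpha> i)) = real m - ((a - 1/2)\<^sup>2 - 1) * (\<Sum>i<m. 1 / (s (\<alpha> i) + 2)\<^sup>2)"
    by (simp add: row_bound_def sum_subtractf sum_distrib_left)
  moreover have "upper m k = real m - ((a - 1/2)\<^sup>2 - 1) * (real m / X\<^sup>2)"
  proof -
    have "real m * (1 - c / X\<^sup>2) = real m - c * (real m / X\<^sup>2)" for c
      by (simp add: right_diff_distrib)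
    then show ?thesis unfolding upper_def X_def[symmetric] .
  qed
  ultimately show ?thesis by linarith
qed

lemma upper_nonneg: "0 \<le> upper m k"
proof -
  have "(a - 1/2)\<^sup>2 - 1 \<le> (a + 3/2 + 2 * real k / real m)\<^sup>2"
  proof -
    have "0 \<le> 2 * real k / real m" by simp
    then have "a - 1/2 \<le> a + 3/2 + 2 * real k / real m" by linarith
    then have "(a - 1/2)\<^sup>2 \<le> (a + 3/2 + 2 * real k / real m)\<^sup>2" using a_ge by (intro power_mono) auto
    then show ?thesis by simp
  qed
  moreover have "0 < (a + 3/2 + 2 * real k / real m)\<^sup>2"
    using a_ge by (intro zero_less_power add_pos_nonneg) auto
  ultimately show ?thesis by (simp add: upper_def)
qed

text \<open>Each summand of \<open>sigma\<close> acts on one coordinate. By orthonormality in the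
  others it contributes only if all other degrees agree, so the matrix is a Kronecker sum of Jacobi
  matrices.\<close>

lemma ip0_sigma_eb:
  assumes "\<alpha> \<in> exps m k" "\<beta> \<in> exps m k"
  shows "ip0 m (\<lambda>y. sigma m y * eb m \<alpha> y) (eb m \<beta>) =
    (\<Sum>i<m. if \<forall>r<m. r \<noteq> i \<longrightarrow> \<alpha> r = \<beta> r then J (\<alpha> i) (\<beta> i) else 0)"
proof -
  define q where "q i r = (if r = i then pCons 0 (p (\<alpha> r) * p (\<beta> r)) else p (\<alpha> r) * p (\<beta> r))" for i r
  have q: "(\<Prod>r<m. poly (q i r) (y r)) = y i * eb m \<alpha> y * eb m \<beta> y" if "i < m" for i y
  proof -
    have "(\<Prod>r<m. poly (q i r) (y r)) = (\<Prod>r<m. (if r = i then y i else 1) * poly (p (\<alpha> r) * p (\<beta> r)) (y r))"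
      by (intro prod.cong refl) (simp add: q_def)
    then show ?thesis using that by (simp add: eb_def prod.distrib)
  qed
  have int: "integrable (mu m) (\<lambda>y. \<Prod>r<m. poly (q i r) (y r))" for i
    unfolding mu_def by (rule PS.product_integrable_prod) auto
  have "ip0 m (\<lambda>y. sigma m y * eb m \<alpha> y) (eb m \<beta>) = (\<integral>y. (\<Sum>i<m. \<Prod>r<m. poly (q i r) (y r)) \<partial>mu m)"
    by (simp add: ip0_def q sigma_def sum_distrib_right)
  also have "\<dots> = (\<Sum>i<m. \<Prod>r<m. E (q i r))"
    using int by (simp add: integral_prod_poly)
  also have "\<dots> = (\<Sum>i<m. if \<forall>r<m. r \<noteq> i \<longrightarrow> \<alpha> r = \<beta> r then J (\<alpha> i) (\<beta> i) else 0)"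
  proof (rule sum.cong[OF refl])
    fix i assume i: "i \<in> {..<m}"
    then have "(\<Prod>r<m. E (q i r)) = J (\<alpha> i) (\<beta> i) * (\<Prod>r\<in>{..<m}-{i}. if \<alpha> r = \<beta> r then 1 else 0)"
      by (subst prod.remove[of _ i]) (auto simp: q_def J_def E_p intro!: prod.cong)
    also have "(\<Prod>r\<in>{..<m}-{i}. if \<alpha> r = \<beta> r then 1 else (0::real)) = (if \<forall>r<m. r \<noteq> i \<longrightarrow> \<alpha> r = \<beta> r then 1 else 0)"
      by (auto intro!: prod.neutral)
    finally show "(\<Prod>r<m. E (q i r)) = (if \<forall>r<m. r \<noteq> i \<longrightarrow> \<alpha> r = \<beta> r then J (\<alpha> i) (\<beta> i) else 0)"
      by auto
  qed
  finally show ?thesis .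
qed

text \<open>For fixed \<open>i\<close>, the \<open>\<beta>\<close> agreeing with
  \<open>\<alpha>\<close> away from \<open>i\<close> are determined by \<open>\<beta> i\<close>;
  hence each inner sum is part of a row sum of \<open>J\<close>.\<close>

lemma sigma_row_sum_le:
  assumes \<alpha>: "\<alpha> \<in> exps m k"
  shows "(\<Sum>\<beta>\<in>exps m k. ip0 m (\<lambda>y. sigma m y * eb m \<alpha> y) (eb m \<beta>)) \<le> (\<Sum>i<m. row_bound (\<alpha> i))"
proof -
  have "(\<Sum>\<beta>\<in>exps m k. ip0 m (\<lambda>y. sigma m y * eb m \<alpha> y) (eb m \<beta>)) =
    (\<Sum>\<beta>\<in>exps m k. \<Sum>i<m. if \<forall>r<m. r \<noteq> i \<longrightarrow> \<alpha> r = \<beta> r then J (\<alpha> i) (\<beta> i) else 0)"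
    by (intro sum.cong refl ip0_sigma_eb[OF \<alpha>])
  also have "\<dots> = (\<Sum>i<m. \<Sum>\<beta>\<in>exps m k. if \<forall>r<m. r \<noteq> i \<longrightarrow> \<alpha> r = \<beta> r then J (\<alpha> i) (\<beta> i) else 0)"
    by (rule sum.swap)
  also have "\<dots> \<le> (\<Sum>i<m. row_bound (\<alpha> i))"
  proof (rule sum_mono)
    fix i assume i: "i \<in> {..<m}"
    define S where "S = {\<beta> \<in> exps m k. \<forall>r<m. r \<noteq> i \<longrightarrow> \<alpha> r = \<beta> r}"
    have S: "finite S" by (simp add: S_def)
    have inj: "inj_on (\<lambda>\<beta>. \<beta> i) S"
    proof (rule inj_onI)
      fix \<beta> \<gamma> assume h: "\<beta> \<in> S" "\<gamma> \<in> S" "\<beta> i = \<gamma> i"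
      then have "\<beta> r = \<gamma> r" if "r < m" for r using that by (cases "r = i") (auto simp: S_def)
      then show "\<beta> = \<gamma>" using h exps_eq_iff[of \<beta> m k \<gamma>] by (auto simp: S_def)
    qed
    have "(\<Sum>\<beta>\<in>exps m k. if \<forall>r<m. r \<noteq> i \<longrightarrow> \<alpha> r = \<beta> r then J (\<alpha> i) (\<beta> i) else 0) = (\<Sum>\<beta>\<in>S. J (\<alpha> i) (\<beta> i))"
      unfolding S_def by (rule sum.inter_filter[symmetric]) simp
    also have "\<dots> = (\<Sum>j\<in>(\<lambda>\<beta>. \<beta> i) ` S. J (\<alpha> i) j)"
      by (simp add: sum.reindex[OF inj])
    also have "\<dots> \<le> row_bound (\<alpha> i)" using S by (intro J_row_sum_le) auto
    finally show "(\<Sum>\<beta>\<in>exps m k. if \<forall>r<m. r \<noteq> i \<longrightarrow> \<alpha> r = \<beta> r then J (\<alpha> i) (\<beta> i) else 0) \<le> row_bound (\<alpha> i)" .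
  qed
  finally show ?thesis .
qed

text \<open>The Schur test: for a symmetric matrix with non-negative entries,
  \<open>2 c d <= c^2 + d^2\<close> bounds the quadratic form by the largest row sum.\<close>

lemma ip0_sigma_le:
  assumes f: "f \<in> polys m k" and m: "1 \<le> m"
  shows "ip0 m (\<lambda>y. sigma m y * f y) f \<le> upper m k * ip0 m f f"
proof -
  obtain c where c: "\<And>y. f y = (\<Sum>\<alpha>\<in>exps m k. c \<alpha> * eb m \<alpha> y)" using eb_expansion[OF f] by blast
  define S where "S \<alpha> \<beta> = ip0 m (\<lambda>y. sigma m y * eb m \<alpha> y) (eb m \<beta>)" for \<alpha> \<beta>
  have S_nonneg: "0 \<le> S \<alpha> \<beta>" if "\<alpha> \<in> exps m k" "\<beta> \<in> exps m k" for \<alpha> \<beta>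
    unfolding S_def ip0_sigma_eb[OF that] by (auto intro!: sum_nonneg J_nonneg)
  have S_sym: "S \<alpha> \<beta> = S \<beta> \<alpha>" for \<alpha> \<beta>
    by (simp add: S_def ip0_def mult_ac)
  have f_eq: "f = (\<lambda>y. \<Sum>\<alpha>\<in>exps m k. c \<alpha> * eb m \<alpha> y)" using c by blast
  have sf_eq: "(\<lambda>y. sigma m y * f y) = (\<lambda>y. \<Sum>\<alpha>\<in>exps m k. c \<alpha> * (sigma m y * eb m \<alpha> y))"
    by (simp add: c sum_distrib_left mult_ac)
  have "ip0 m (\<lambda>y. sigma m y * f y) f = (\<Sum>\<alpha>\<in>exps m k. \<Sum>\<beta>\<in>exps m k. c \<alpha> * c \<beta> * S \<alpha> \<beta>)"
    unfolding sf_eq S_def unfolding f_eq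
    by (rule ip0_sum[where k = "1 + k" and k' = k]) (intro polys_mult polys_sigma eb_polys; assumption)+
  also have "\<dots> \<le> (\<Sum>\<alpha>\<in>exps m k. \<Sum>\<beta>\<in>exps m k. ((c \<alpha>)\<^sup>2 * S \<alpha> \<beta> + (c \<beta>)\<^sup>2 * S \<alpha> \<beta>) / 2)"
  proof (intro sum_mono)
    fix \<alpha> \<beta> assume ab: "\<alpha> \<in> exps m k" "\<beta> \<in> exps m k"
    have "c \<alpha> * c \<beta> \<le> ((c \<alpha>)\<^sup>2 + (c \<beta>)\<^sup>2) / 2"
      using sum_squares_bound[of "c \<alpha>" "c \<beta>"] by simp
    then have "c \<alpha> * c \<beta> * S \<alpha> \<beta> \<le> ((c \<alpha>)\<^sup>2 + (c \<beta>)\<^sup>2) / 2 * S \<alpha> \<beta>"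
      by (rule mult_right_mono) (rule S_nonneg[OF ab])
    then show "c \<alpha> * c \<beta> * S \<alpha> \<beta> \<le> ((c \<alpha>)\<^sup>2 * S \<alpha> \<beta> + (c \<beta>)\<^sup>2 * S \<alpha> \<beta>) / 2"
      by (simp add: algebra_simps)
  qed
  also have "\<dots> = (\<Sum>\<alpha>\<in>exps m k. \<Sum>\<beta>\<in>exps m k. (c \<alpha>)\<^sup>2 * S \<alpha> \<beta>)"
  proof -
    have "(\<Sum>\<alpha>\<in>exps m k. \<Sum>\<beta>\<in>exps m k. (c \<beta>)\<^sup>2 * S \<alpha> \<beta>) = (\<Sum>\<alpha>\<in>exps m k. \<Sum>\<beta>\<in>exps m k. (c \<alpha>)\<^sup>2 * S \<alpha> \<beta>)"
      by (subst sum.swap) (simp add: S_sym)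
    then show ?thesis by (simp add: sum_divide_distrib[symmetric] sum.distrib)
  qed
  also have "\<dots> = (\<Sum>\<alpha>\<in>exps m k. (c \<alpha>)\<^sup>2 * (\<Sum>\<beta>\<in>exps m k. S \<alpha> \<beta>))"
    by (simp add: sum_distrib_left)
  also have "\<dots> \<le> (\<Sum>\<alpha>\<in>exps m k. (c \<alpha>)\<^sup>2 * upper m k)"
    unfolding S_def
    by (intro sum_mono mult_left_mono order_trans[OF sigma_row_sum_le sum_row_bound_le] m) auto
  also have "\<dots> = upper m k * ip0 m f f"
    by (simp add: ip0_expansion[OF c] sum_distrib_left mult.commute)
  finally show ?thesis .
qed

section \<open>Comparison of the weights with and without the Vandermonde factor\<close>

lemma poly_measurable [measurable]: "poly (q :: real poly) \<in> borel_measurable borel"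
  using continuous_on_poly[OF continuous_on_id, of UNIV q]
  by (intro borel_measurable_continuous_onI) simp

text \<open>With the other coordinates fixed, \<open>y i - y j\<close> is a shift by
  \<open>t = y j\<close>, so \<open>norm_le_norm_shift\<close> applies in the variable
  \<open>y i\<close> and is then integrated. Non-negative integrals permit the iteration without
  integrability conditions.\<close>

lemma ip0_le_diff:
  assumes f: "f \<in> polys m k" and ij: "i < m" "j < m" "i \<noteq> j"
  shows "ip0 m f f \<le> Q k ^ 6 * ip0 m (\<lambda>y. (y i - y j) * f y) (\<lambda>y. (y i - y j) * f y)"
proof -
  define G where "G = (\<lambda>y. (y i - y j) * f y)"
  have G: "G \<in> polys m (1 + k)"
    unfolding G_def using ij by (intro polys_mult f polys_diff polys_coord)
  have nn: "(\<integral>\<^sup>+y. ennreal (F y * F y) \<partial>mu m) = ennreal (ip0 m F F)" if "F \<in> polys m d" for F d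
    unfolding ip0_def by (rule nn_integral_eq_integral) (auto intro: integrable_polys polys_mult that)
  define I where "I = {..<m} - {i}"
  have I: "finite I" "i \<notin> I" and mu: "mu m = PiM (insert i I) (\<lambda>_. nu)"
    using ij by (auto simp: I_def mu_def insert_absorb)
  have meas: "(\<lambda>y. ennreal (F y * F y)) \<in> borel_measurable (mu m)" if "F \<in> polys m d" for F d
    using polys_measurable_mu[OF that] by measurable
  have "ennreal (ip0 m f f) = (\<integral>\<^sup>+x. \<integral>\<^sup>+t. ennreal (f (x(i := t)) * f (x(i := t))) \<partial>nu \<partial>PiM I (\<lambda>_. nu))"
    unfolding nn[OF f, symmetric] mu
    by (rule PS.product_nn_integral_insert[OF I]) (rule meas[OF f, unfolded mu])
  also have "\<dots> \<le> (\<integral>\<^sup>+x. \<integral>\<^sup>+t. ennreal (Q k ^ 6) * ennreal (G (x(i := t)) * G (x(i := t))) \<partial>nu \<partial>PiM I (\<lambda>_. nu))"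
  proof (rule nn_integral_mono)
    fix x
    obtain q where q: "degree q \<le> k" "\<And>t. f (x(i := t)) = poly q t"
      using polys_fun_upd[OF f ij(1)] by blast
    define l where "l = [:- x j, 1:] * q"
    have Gl: "G (x(i := t)) = poly l t" for t
      using ij by (simp add: G_def q l_def algebra_simps)
    have E: "(\<integral>\<^sup>+t. ennreal (poly u t * poly u t) \<partial>nu) = ennreal (E (u * u))" for u
      unfolding E_def poly_mult[symmetric] by (rule nn_integral_eq_integral[OF integrable_poly]) auto
    have "(\<integral>\<^sup>+t. ennreal (f (x(i := t)) * f (x(i := t))) \<partial>nu) = ennreal (E (q * q))"
      unfolding q E ..
    also have "\<dots> \<le> ennreal (Q k ^ 6 * E (l * l))"
      unfolding l_def by (intro ennreal_leI norm_le_norm_shift q)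
    also have "\<dots> = ennreal (Q k ^ 6) * ennreal (E (l * l))"
      using Q_pos[of k] by (intro ennreal_mult E_nonneg) auto
    also have "\<dots> = (\<integral>\<^sup>+t. ennreal (Q k ^ 6) * ennreal (G (x(i := t)) * G (x(i := t))) \<partial>nu)"
      unfolding Gl E[symmetric] by (rule nn_integral_cmult[symmetric]) measurable
    finally show "(\<integral>\<^sup>+t. ennreal (f (x(i := t)) * f (x(i := t))) \<partial>nu) \<le>
        (\<integral>\<^sup>+t. ennreal (Q k ^ 6) * ennreal (G (x(i := t)) * G (x(i := t))) \<partial>nu)" .
  qed
  also have "\<dots> = (\<integral>\<^sup>+y. ennreal (Q k ^ 6) * ennreal (G y * G y) \<partial>mu m)"
    unfolding mu
    by (rule PS.product_nn_integral_insert[OF I, symmetric])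
      (intro borel_measurable_times_ennreal borel_measurable_const meas[OF G, unfolded mu])
  also have "\<dots> = ennreal (Q k ^ 6) * (\<integral>\<^sup>+y. ennreal (G y * G y) \<partial>mu m)"
    by (rule nn_integral_cmult[OF meas[OF G]])
  also have "\<dots> = ennreal (Q k ^ 6 * ip0 m G G)"
    unfolding nn[OF G] using Q_pos[of k] by (subst ennreal_mult) (auto simp: ip0_def)
  finally show ?thesis
    unfolding G_def[symmetric] using Q_pos[of k]
    by (subst (asm) ennreal_le_iff) (auto simp: ip0_def)
qed

lemma Q_mono: "k \<le> k' \<Longrightarrow> Q k \<le> Q k'"
  by (simp add: Q_def)

text \<open>Each factor raises the degree by one, so all the constants are majorised by
  \<open>Q\<close> at the final degree \<open>k + card S\<close>.\<close>

lemma ip0_le_diffs: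
  assumes f: "f \<in> polys m k" and S: "S \<subseteq> (SIGMA i:{..<m}. {i<..<m})"
  shows "ip0 m f f \<le> (Q (k + card S) ^ 6) ^ card S *
    ip0 m (\<lambda>y. (\<Prod>x\<in>S. y (fst x) - y (snd x)) * f y) (\<lambda>y. (\<Prod>x\<in>S. y (fst x) - y (snd x)) * f y)"
proof -
  have "finite S" using S by (rule finite_subset) auto
  then show ?thesis using S
  proof (induction S)
    case (insert x S)
    define F where "F = (\<lambda>y. (\<Prod>x\<in>S. y (fst x) - y (snd x)) * f y)"
    define G where "G = (\<lambda>y. (y (fst x) - y (snd x)) * F y)"
    have F: "F \<in> polys m (k + card S)"
      unfolding F_def using insert.prems by (intro polys_diff_power f) auto
    have Fnn: "0 \<le> ip0 m F F" and Gnn: "0 \<le> ip0 m G G" by (simp_all add: ip0_def)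
    have Q: "Q (k + card S) ^ 6 \<le> Q (k + card (insert x S)) ^ 6" "0 \<le> Q (k + card S) ^ 6"
      using Q_mono Q_pos[of "k + card S"] insert.hyps by (auto intro!: power_mono simp: less_imp_le)
    have "ip0 m f f \<le> (Q (k + card S) ^ 6) ^ card S * ip0 m F F"
      unfolding F_def using insert by auto
    also have "\<dots> \<le> (Q (k + card S) ^ 6) ^ card S * (Q (k + card S) ^ 6 * ip0 m G G)"
      unfolding G_def using insert.prems Q_pos[of "k + card S"]
      by (intro mult_left_mono ip0_le_diff[OF F]) auto
    also have "\<dots> = (Q (k + card S) ^ 6) ^ card (insert x S) * ip0 m G G"
      using insert.hyps by simp
    also have "\<dots> \<le> (Q (k + card (insert x S)) ^ 6) ^ card (insert x S) * ip0 m G G"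
      by (intro mult_right_mono power_mono[OF Q] Gnn)
    also have "G = (\<lambda>y. (\<Prod>x\<in>insert x S. y (fst x) - y (snd x)) * f y)"
      using insert.hyps by (simp add: G_def F_def mult.assoc)
    finally show ?case .
  qed simp
qed

text \<open>A factor \<open>Q^6\<close> for each pair of coordinates, with \<open>m^2\<close> as a
  crude bound for the number of pairs. For fixed \<open>m\<close> it is polynomial in
  \<open>k\<close> and \<open>a\<close>.\<close>

definition dist_const :: "nat \<Rightarrow> nat \<Rightarrow> real" where
  "dist_const m k = Q (k + m\<^sup>2) ^ (6 * m\<^sup>2)"

lemma dist_const_ge_1: "1 \<le> dist_const m k"
  unfolding dist_const_def by (rule one_le_power) (rule Q_ge_1)

lemma ip1_le_ip0:
  assumes "f \<in> polys m k"
  shows "ip1 m f f \<le> ip0 m f f"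
  unfolding ip1_def ip0_def
proof (rule integral_mono_AE)
  show "AE y in mu m. f y * f y * \<bar>vd m y\<bar> \<le> f y * f y"
    using AE_mu[of m] by eventually_elim (auto intro!: mult_left_le abs_vd_le_1)
qed (use polys_mult[OF assms assms] integrable_polys_vd integrable_polys in auto)

text \<open>All Vandermonde factors are inserted at once by \<open>ip0_le_diffs\<close>; this yields
  the squared Vandermonde product, which is at most its absolute value on the cube.\<close>

lemma ip0_le_ip1:
  assumes f: "f \<in> polys m k"
  shows "ip0 m f f \<le> dist_const m k * ip1 m f f"
proof -
  define S where "S = (SIGMA i:{..<m}. {i<..<m})"
  have "card S \<le> card ({..<m} \<times> {..<m})"
    unfolding S_def by (intro card_mono) auto
  then have card_S: "card S \<le> m\<^sup>2" by (simp add: power2_eq_square)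
  have F: "(\<lambda>y. vd m y * f y) \<in> polys m (k + card S)"
    unfolding vd_eq S_def by (rule polys_diff_power[OF order_refl f])
  have "ip0 m f f \<le> (Q (k + card S) ^ 6) ^ card S * ip0 m (\<lambda>y. vd m y * f y) (\<lambda>y. vd m y * f y)"
    using ip0_le_diffs[OF f order_refl] unfolding vd_eq S_def .
  also have "\<dots> \<le> dist_const m k * ip0 m (\<lambda>y. vd m y * f y) (\<lambda>y. vd m y * f y)"
  proof (rule mult_right_mono)
    have "(Q (k + card S) ^ 6) ^ card S = Q (k + card S) ^ (6 * card S)" by (simp add: power_mult)
    also have "\<dots> \<le> Q (k + m\<^sup>2) ^ (6 * card S)"
      using card_S by (intro power_mono Q_mono) (auto intro: less_imp_le Q_pos)
    also have "\<dots> \<le> dist_const m k"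
      unfolding dist_const_def using card_S by (intro power_increasing Q_ge_1) auto
    finally show "(Q (k + card S) ^ 6) ^ card S \<le> dist_const m k" .
  qed (simp add: ip0_def)
  also have "\<dots> \<le> dist_const m k * ip1 m f f"
  proof (rule mult_left_mono)
    show "ip0 m (\<lambda>y. vd m y * f y) (\<lambda>y. vd m y * f y) \<le> ip1 m f f"
      unfolding ip1_def ip0_def
    proof (rule integral_mono_AE)
      show "AE y in mu m. vd m y * f y * (vd m y * f y) \<le> f y * f y * \<bar>vd m y\<bar>"
        using AE_mu[of m]
      proof eventually_elim
        case (elim y)
        then have "\<bar>vd m y\<bar> * \<bar>vd m y\<bar> \<le> \<bar>vd m y\<bar>" by (intro mult_left_le abs_vd_le_1) auto
        then have "f y * f y * (\<bar>vd m y\<bar> * \<bar>vd m y\<bar>) \<le> f y * f y * \<bar>vd m y\<bar>" by (intro mult_left_mono) auto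
        then show ?case by (simp add: mult_ac)
      qed
    qed (use polys_mult[OF f f] polys_mult[OF F F] integrable_polys_vd integrable_polys in auto)
  qed (use dist_const_ge_1[of m k] in linarith)
  finally show ?thesis .
qed

section \<open>Rayleigh quotients\<close>

lemma sigma_bounds: "AE y in mu m. 0 \<le> sigma m y"
  using AE_mu[of m] by eventually_elim (auto simp: sigma_def intro!: sum_nonneg)

text \<open>Cauchy-Schwarz, from integrating \<open>sigma^i (t sigma - 1)^2 f^2 u\<close>, which is
  non-negative for every \<open>t\<close>. The factor \<open>u\<close> covers both weights.\<close>

lemma moments_logconvex:
  assumes f: "f \<in> polys m k" and u: "\<And>y. 0 \<le> u y"
    and int: "\<And>g K. g \<in> polys m K \<Longrightarrow> integrable (mu m) (\<lambda>y. g y * u y)"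
  defines "M \<equiv> \<lambda>i. \<integral>y. sigma m y ^ i * f y * f y * u y \<partial>mu m"
  shows "0 \<le> M i" "(M (Suc i))\<^sup>2 \<le> M i * M (Suc (Suc i))"
proof -
  have intM: "integrable (mu m) (\<lambda>y. sigma m y ^ i * f y * f y * u y)" for i
    by (rule int) (rule polys_mult[OF polys_sigma_power_mult[OF f] f])
  show nn: "0 \<le> M i" for i
    unfolding M_def
  proof (rule integral_nonneg_AE)
    show "AE y in mu m. 0 \<le> sigma m y ^ i * f y * f y * u y"
      using sigma_bounds[of m]
    proof eventually_elim
      case (elim y)
      then have "0 \<le> sigma m y ^ i * (f y * f y) * u y" using u by (intro mult_nonneg_nonneg[of "_ * _"] mult_nonneg_nonneg[of "_ ^ _"]) auto
      then show ?case by (simp add: mult.assoc)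
    qed
  qed
  have "0 \<le> M (Suc (Suc i)) * t\<^sup>2 - 2 * M (Suc i) * t + M i" for t
  proof -
    have "0 \<le> (\<integral>y. sigma m y ^ i * (t * sigma m y - 1)\<^sup>2 * (f y)\<^sup>2 * u y \<partial>mu m)"
    proof (rule integral_nonneg_AE)
      show "AE y in mu m. 0 \<le> sigma m y ^ i * (t * sigma m y - 1)\<^sup>2 * (f y)\<^sup>2 * u y"
        using sigma_bounds[of m] by eventually_elim (auto simp: u)
    qed
    also have "\<dots> = (\<integral>y. t\<^sup>2 * (sigma m y ^ Suc (Suc i) * f y * f y * u y) -
        2 * t * (sigma m y ^ Suc i * f y * f y * u y) + sigma m y ^ i * f y * f y * u y \<partial>mu m)"
      by (intro Bochner_Integration.integral_cong refl) (simp add: power2_eq_square algebra_simps)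
    also have "\<dots> = M (Suc (Suc i)) * t\<^sup>2 - 2 * M (Suc i) * t + M i"
      unfolding M_def using intM[of i] intM[of "Suc i"] intM[of "Suc (Suc i)"] by (simp del: power_Suc)
    finally show ?thesis .
  qed
  then have "(M (Suc i))\<^sup>2 \<le> M (Suc (Suc i)) * M i"
    by (intro quadratic_nonneg_imp nn)
  then show "(M (Suc i))\<^sup>2 \<le> M i * M (Suc (Suc i))" by (simp add: mult.commute)
qed

definition mom0 :: "nat \<Rightarrow> ((nat \<Rightarrow> real) \<Rightarrow> real) \<Rightarrow> nat \<Rightarrow> real" where
  "mom0 m f i = ip0 m (\<lambda>y. sigma m y ^ i * f y) f"

definition mom1 :: "nat \<Rightarrow> ((nat \<Rightarrow> real) \<Rightarrow> real) \<Rightarrow> nat \<Rightarrow> real" where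
  "mom1 m f i = ip1 m (\<lambda>y. sigma m y ^ i * f y) f"

lemma mom0_logconvex:
  assumes "f \<in> polys m k"
  shows "0 \<le> mom0 m f i" "(mom0 m f (Suc i))\<^sup>2 \<le> mom0 m f i * mom0 m f (Suc (Suc i))"
  using moments_logconvex[OF assms, of "\<lambda>_. 1"] integrable_polys by (auto simp: mom0_def ip0_def)

lemma mom1_logconvex:
  assumes "f \<in> polys m k"
  shows "0 \<le> mom1 m f i" "(mom1 m f (Suc i))\<^sup>2 \<le> mom1 m f i * mom1 m f (Suc (Suc i))"
  using moments_logconvex[OF assms, of "\<lambda>y. \<bar>vd m y\<bar>"] integrable_polys_vd by (auto simp: mom1_def ip1_def)

text \<open>An even moment is the squared norm of the polynomial \<open>sigma^N f\<close>, to which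
  the comparison of \<open>ip0\<close> with \<open>ip1\<close> applies; the next odd one is the
  numerator of its Rayleigh quotient. This is why the powers below are \<open>2 * N\<close>.\<close>

lemma mom_even:
  "mom0 m f (2 * N) = ip0 m (\<lambda>y. sigma m y ^ N * f y) (\<lambda>y. sigma m y ^ N * f y)"
  "mom1 m f (2 * N) = ip1 m (\<lambda>y. sigma m y ^ N * f y) (\<lambda>y. sigma m y ^ N * f y)"
  unfolding mom0_def mom1_def ip0_def ip1_def mult_2 power_add power_Suc by (simp_all add: mult_ac)

lemma mom_odd:
  "mom0 m f (Suc (2 * N)) = ip0 m (\<lambda>y. sigma m y * (sigma m y ^ N * f y)) (\<lambda>y. sigma m y ^ N * f y)"
  "mom1 m f (Suc (2 * N)) = ip1 m (\<lambda>y. sigma m y * (sigma m y ^ N * f y)) (\<lambda>y. sigma m y ^ N * f y)"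
  unfolding mom0_def mom1_def ip0_def ip1_def mult_2 power_add power_Suc by (simp_all add: mult_ac)

lemma ip1_pos:
  assumes "f \<in> polys m k" "f \<noteq> (\<lambda>_. 0)"
  shows "0 < ip1 m f f"
proof -
  have "0 < dist_const m k * ip1 m f f"
    using ip0_pos[OF assms] ip0_le_ip1[OF assms(1)] by linarith
  then show ?thesis using dist_const_ge_1[of m k] by (simp add: zero_less_mult_iff)
qed

lemma ip1_commute: "ip1 m f g = ip1 m g f"
  by (simp add: ip1_def mult_ac)

lemma ip1_integrable:
  assumes "f \<in> polys m k" "g \<in> polys m k'"
  shows "integrable (mu m) (\<lambda>y. f y * g y * \<bar>vd m y\<bar>)"
  by (rule integrable_polys_vd[OF polys_mult[OF assms]])

lemma ip1_add:
  assumes "f \<in> polys m k" "g \<in> polys m k" "h \<in> polys m k'"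
  shows "ip1 m (\<lambda>y. f y + g y) h = ip1 m f h + ip1 m g h"
  using ip1_integrable[OF assms(1,3)] ip1_integrable[OF assms(2,3)] by (simp add: ip1_def distrib_right)

lemma ip1_diff:
  assumes "f \<in> polys m k" "g \<in> polys m k" "h \<in> polys m k'"
  shows "ip1 m (\<lambda>y. f y - g y) h = ip1 m f h - ip1 m g h"
  using ip1_integrable[OF assms(1,3)] ip1_integrable[OF assms(2,3)] by (simp add: ip1_def left_diff_distrib)

lemma ip1_scale: "ip1 m (\<lambda>y. c * f y) h = c * ip1 m f h"
  by (simp add: ip1_def mult.assoc)

text \<open>The monomials span a space containing \<open>Sk m k\<close> but need not be symmetric
  themselves, so the spanning set inside \<open>Sk m k\<close> comes from
  \<open>subspace_finite_span\<close>.\<close>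

sublocale sym: ip_space "Sk m k" "ip1 m" for m k
proof
  have "finite ((\<lambda>\<alpha> y. \<Prod>i<m. y i ^ \<alpha> i) ` exps m k :: ((nat \<Rightarrow> real) \<Rightarrow> real) set)" by simp
  moreover have "Sk m k \<subseteq> lin ((\<lambda>\<alpha> y. \<Prod>i<m. y i ^ \<alpha> i) ` exps m k)"
  proof
    fix f assume "f \<in> Sk m k"
    then obtain c where "\<And>y. f y = (\<Sum>\<alpha>\<in>exps m k. c \<alpha> * (\<Prod>i<m. y i ^ \<alpha> i))"
      unfolding Sk_def polys_def by blast
    then have "f = (\<lambda>y. \<Sum>\<alpha>\<in>exps m k. c \<alpha> * (\<Prod>i<m. y i ^ \<alpha> i))" by blast
    then show "f \<in> lin ((\<lambda>\<alpha> y. \<Prod>i<m. y i ^ \<alpha> i) ` exps m k)"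
      using lin_imageI[OF finite_exps, where c = c and g = "\<lambda>\<alpha> y. \<Prod>i<m. y i ^ \<alpha> i"] by simp
  qed
  ultimately show "\<exists>S. finite S \<and> S \<subseteq> Sk m k \<and> Sk m k \<subseteq> lin S"
    by (rule subspace_finite_span) (intro Sk_add Sk_scale)
qed (auto intro: Sk_add Sk_scale Sk_const ip1_pos Sk_polys ip1_commute ip1_add simp: ip1_scale)

section \<open>The operator \<open>Tk\<close> and its largest eigenvalue\<close>

definition A_form :: "nat \<Rightarrow> ((nat \<Rightarrow> real) \<Rightarrow> real) \<Rightarrow> ((nat \<Rightarrow> real) \<Rightarrow> real) \<Rightarrow> real" where
  "A_form m f g = ip1 m (\<lambda>y. sigma m y * f y) g"

lemma sigma_mult_polys: "f \<in> Sk m k \<Longrightarrow> (\<lambda>y. sigma m y * f y) \<in> polys m (1 + k)"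
  by (rule polys_mult[OF polys_sigma Sk_polys])

lemma A_form_add:
  assumes "f \<in> Sk m k" "g \<in> Sk m k" "h \<in> Sk m k"
  shows "A_form m (\<lambda>x. f x + g x) h = A_form m f h + A_form m g h"
  using ip1_add[OF sigma_mult_polys[OF assms(1)] sigma_mult_polys[OF assms(2)] Sk_polys[OF assms(3)]]
  by (simp add: A_form_def distrib_left)

lemma A_form_scale: "A_form m (\<lambda>x. c * f x) h = c * A_form m f h"
  using ip1_scale[of m c "\<lambda>y. sigma m y * f y" h] by (simp add: A_form_def mult.left_commute)

lemma A_form_commute: "A_form m f g = A_form m g f"
  by (simp add: A_form_def ip1_def mult_ac)

lemma ip_eq:
  assumes n: "a = real n / 2 - real m - 1/2" and fg: "f \<in> polys m k" "g \<in> polys m k'"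
  shows "ip n m f g = cnorm n m * ip1 m f g"
  unfolding ip_def ip1_def
  using cube_integral_eq[OF n polys_measurable_mu[OF polys_mult[OF fg]]] by simp

lemma cnorm_pos:
  assumes n: "a = real n / 2 - real m - 1/2"
  shows "0 < cnorm n m"
proof -
  have "(LINT y:cube m|lebm m. weight n m y) = ip1 m (\<lambda>_. 1) (\<lambda>_. 1)"
    unfolding ip1_def using cube_integral_eq[OF n, of "\<lambda>_. 1"] by simp
  moreover have "0 < ip1 m (\<lambda>_. 1) (\<lambda>_. 1)"
    by (rule ip1_pos[OF polys_const]) (simp add: fun_eq_iff)
  ultimately show ?thesis by (simp add: cnorm_def)
qed

text \<open>\<open>riesz\<close> gives existence and positivity of \<open>ip1\<close> gives
  uniqueness of the projection, so the description in \<open>projS\<close> denotes it; the positive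
  factor \<open>cnorm n m\<close> cancels. The eigenvalue equation thereby takes the weak form of
  \<open>max_eigenvalue\<close>.\<close>

lemma Tk_eq_iff:
  assumes n: "a = real n / 2 - real m - 1/2" and f: "f \<in> Sk m k"
  shows "Tk n m k f = (\<lambda>y. e * f y) \<longleftrightarrow> (\<forall>h\<in>Sk m k. A_form m f h = e * ip1 m f h)"
proof -
  have "\<exists>g\<in>Sk m k. \<forall>h\<in>Sk m k. ip1 m g h = A_form m f h"
    by (rule sym.riesz)
      (auto simp: A_form_commute[of m f] A_form_scale intro: A_form_add f)
  then obtain g where g: "g \<in> Sk m k" "\<And>h. h \<in> Sk m k \<Longrightarrow> ip1 m g h = A_form m f h" by blast
  have proj_iff: "(\<forall>h\<in>Sk m k. ip n m (\<lambda>y. sigma m y * f y - g' y) h = 0) \<longleftrightarrow>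
      (\<forall>h\<in>Sk m k. ip1 m g' h = A_form m f h)" if g': "g' \<in> Sk m k" for g'
  proof -
    have g'': "g' \<in> polys m (1 + k)" using polys_mono[OF Sk_polys[OF g']] by simp
    have "ip n m (\<lambda>y. sigma m y * f y - g' y) h = cnorm n m * (A_form m f h - ip1 m g' h)" if h: "h \<in> Sk m k" for h
      unfolding A_form_def
      using ip_eq[OF n polys_diff[OF sigma_mult_polys[OF f] g''] Sk_polys[OF h]]
        ip1_diff[OF sigma_mult_polys[OF f] g'' Sk_polys[OF h]] by simp
    then show ?thesis using cnorm_pos[OF n] by auto
  qed
  have uniq: "g' = g" if g': "g' \<in> Sk m k" "\<forall>h\<in>Sk m k. ip1 m g' h = A_form m f h" for g'
  proof (rule ccontr)
    assume "g' \<noteq> g"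
    define d where "d = (\<lambda>y. g' y - g y)"
    have d: "d \<in> Sk m k" unfolding d_def by (rule sym.V_diff[OF g'(1) g(1)])
    have "d \<noteq> (\<lambda>_. 0)" using \<open>g' \<noteq> g\<close> by (auto simp: d_def fun_eq_iff)
    then have "0 < ip1 m d d" by (rule sym.B_pos[OF d])
    moreover have "ip1 m d d = ip1 m g' d - ip1 m g d"
      by (subst (1) d_def) (rule ip1_diff[OF Sk_polys[OF g'(1)] Sk_polys[OF g(1)] Sk_polys[OF d]])
    ultimately show False using g'(2) g(2) d by simp
  qed
  have "Tk n m k f = g"
    unfolding Tk_def projS_def
  proof (rule the_equality)
    show "g \<in> Sk m k \<and> (\<forall>h\<in>Sk m k. ip n m (\<lambda>y. sigma m y * f y - g y) h = 0)"
      using g proj_iff[OF g(1)] by blast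
  qed (use proj_iff uniq in blast)
  moreover have "g = (\<lambda>y. e * f y) \<longleftrightarrow> (\<forall>h\<in>Sk m k. A_form m f h = e * ip1 m f h)"
  proof
    assume g_eq: "g = (\<lambda>y. e * f y)"
    show "\<forall>h\<in>Sk m k. A_form m f h = e * ip1 m f h"
    proof
      fix h assume "h \<in> Sk m k"
      from g(2)[OF this] show "A_form m f h = e * ip1 m f h" unfolding g_eq ip1_scale ..
    qed
  next
    assume "\<forall>h\<in>Sk m k. A_form m f h = e * ip1 m f h"
    then have "\<forall>h\<in>Sk m k. ip1 m (\<lambda>y. e * f y) h = A_form m f h" by (simp add: ip1_scale)
    then show "g = (\<lambda>y. e * f y)" using uniq[OF Sk_scale[OF f]] by metis
  qed
  ultimately show ?thesis by (simp only:)
qed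

lemma lambda_max_props:
  assumes n: "a = real n / 2 - real m - 1/2"
  shows "f \<in> Sk m k \<Longrightarrow> A_form m f f \<le> lambda_max n m k * ip1 m f f"
    and "\<exists>P\<in>Sk m k. P \<noteq> (\<lambda>_. 0) \<and> A_form m P P = lambda_max n m k * ip1 m P P"
proof -
  have Ev: "eigenvalues_T n m k = {e. \<exists>P\<in>Sk m k. P \<noteq> (\<lambda>_. 0) \<and> (\<forall>h\<in>Sk m k. A_form m P h = e * ip1 m P h)}"
    unfolding eigenvalues_T_def using Tk_eq_iff[OF n] by blast
  have "(\<lambda>_. 1) \<in> Sk m k" "(\<lambda>_. 1) \<noteq> (\<lambda>_::nat \<Rightarrow> real. 0 :: real)"
    by (auto simp: Sk_const fun_eq_iff)
  then have "Sk m k \<noteq> {\<lambda>_. 0}" by blast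
  note max = sym.max_eigenvalue[of m k "A_form m", OF A_form_add[where k = k] A_form_scale A_form_commute this]
  show "f \<in> Sk m k \<Longrightarrow> A_form m f f \<le> lambda_max n m k * ip1 m f f"
    using max(2) unfolding lambda_max_def Ev .
  show "\<exists>P\<in>Sk m k. P \<noteq> (\<lambda>_. 0) \<and> A_form m P P = lambda_max n m k * ip1 m P P"
  proof -
    have "lambda_max n m k \<in> {e. \<exists>P\<in>Sk m k. P \<noteq> (\<lambda>_. 0) \<and> (\<forall>h\<in>Sk m k. A_form m P h = e * ip1 m P h)}"
      using max(1) unfolding lambda_max_def Ev .
    then show ?thesis by blast
  qed
qed

text \<open>For a maximising \<open>f\<close>, log-convexity passes from the first to the
  \<open>2 N\<close>-th moment, where \<open>ip1\<close> is exchanged for \<open>ip0\<close> at the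
  cost of \<open>dist_const\<close>. Log-convexity for \<open>ip0\<close> then leads to the Rayleigh
  quotient of \<open>sigma^N f\<close>, of degree \<open>k + N\<close>.\<close>

lemma lambda_max_le:
  assumes n: "a = real n / 2 - real m - 1/2" and m: "1 \<le> m"
  shows "0 \<le> lambda_max n m k" "lambda_max n m k ^ (2 * N) \<le> dist_const m k * upper m (k + N) ^ (2 * N)"
proof -
  obtain f where f: "f \<in> Sk m k" "f \<noteq> (\<lambda>_. 0)" and Af: "A_form m f f = lambda_max n m k * ip1 m f f"
    using lambda_max_props(2)[OF n] by blast
  note fp = Sk_polys[OF f(1)]
  have F: "(\<lambda>y. sigma m y ^ N * f y) \<in> polys m (k + N)" by (rule polys_sigma_power_mult[OF fp])
  have M0: "mom0 m f 0 = ip0 m f f" "mom1 m f 0 = ip1 m f f" "mom1 m f 1 = A_form m f f"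
    by (simp_all add: mom0_def mom1_def A_form_def)
  have pos: "0 < mom1 m f 0" "0 < mom0 m f 0"
    using ip1_pos[OF fp f(2)] ip0_pos[OF fp f(2)] by (simp_all add: M0)
  have lam: "lambda_max n m k = mom1 m f 1 / mom1 m f 0"
    unfolding M0 Af using pos(1)[unfolded M0] by simp
  show "0 \<le> lambda_max n m k" unfolding lam using mom1_logconvex(1)[OF fp] pos by simp
  have D: "0 < dist_const m k" using dist_const_ge_1[of m k] by linarith
  have "lambda_max n m k ^ (2 * N) \<le> mom1 m f (2 * N) / mom1 m f 0"
    unfolding lam by (rule logconvex_ratio_le) (use mom1_logconvex[OF fp] pos in auto)
  also have "\<dots> \<le> mom0 m f (2 * N) / (mom0 m f 0 / dist_const m k)"
  proof (rule frac_le)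
    show "mom1 m f (2 * N) \<le> mom0 m f (2 * N)"
      unfolding mom_even by (rule ip1_le_ip0[OF F])
    show "mom0 m f 0 / dist_const m k \<le> mom1 m f 0"
      using ip0_le_ip1[OF fp] D by (simp add: M0 divide_le_eq mult.commute)
  qed (use mom0_logconvex[OF fp] pos D in auto)
  also have "\<dots> = dist_const m k * (mom0 m f (2 * N) / mom0 m f 0)" by simp
  also have "\<dots> \<le> dist_const m k * (mom0 m f (Suc (2 * N)) / mom0 m f (2 * N)) ^ (2 * N)"
    by (intro mult_left_mono logconvex_ratio_le) (use mom0_logconvex[OF fp] pos D in auto)
  also have "\<dots> \<le> dist_const m k * upper m (k + N) ^ (2 * N)"
  proof (intro mult_left_mono power_mono)
    have "mom0 m f (Suc (2 * N)) \<le> upper m (k + N) * mom0 m f (2 * N)"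
      unfolding mom_even mom_odd by (rule ip0_sigma_le[OF F m])
    moreover have "0 \<le> mom0 m f (2 * N)" by (rule mom0_logconvex(1)[OF fp])
    ultimately show "mom0 m f (Suc (2 * N)) / mom0 m f (2 * N) \<le> upper m (k + N)"
      using upper_nonneg[of m "k + N"] by (cases "mom0 m f (2 * N) = 0") (auto simp: divide_le_eq)
  qed (use mom0_logconvex[OF fp] D in auto)
  finally show "lambda_max n m k ^ (2 * N) \<le> dist_const m k * upper m (k + N) ^ (2 * N)" .
qed

text \<open>The same chain with the two weights exchanged, started from a product of copies of the
  test polynomial. The degree condition leaves room for \<open>sigma^N\<close>, so that
  \<open>sigma^N f\<close> still lies in \<open>Sk m k\<close>.\<close>

lemma lambda_max_ge:
  assumes n: "a = real n / 2 - real m - 1/2" and M: "1 \<le> M"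
    and k: "m * (t + M) + N \<le> k" and \<kappa>: "0 \<le> \<kappa>" "\<kappa> \<le> 1 - (a + 1/2)\<^sup>2 / (s t)\<^sup>2"
  shows "(real m * (\<kappa> * (1 - 1 / (2 * real M)))) ^ (2 * N) \<le> dist_const m k * lambda_max n m k ^ (2 * N)"
proof -
  have st: "0 < s t" using s_gt_1[of t] by linarith
  obtain v where v: "degree v < t + M" "E (v * v) = 1" "\<kappa> * (1 - 1 / (2 * real M)) \<le> E (pCons 0 (v * v))"
    using test_poly[OF st M \<kappa>] by blast
  define f where "f = (\<lambda>y :: nat \<Rightarrow> real. \<Prod>i<m. poly v (y i))"
  have "m * degree v \<le> m * (t + M)" using v(1) by simp
  then have f: "f \<in> Sk m (m * (t + M))"
    unfolding f_def by (rule Sk_prod_poly)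
  note fp = Sk_polys[OF f]
  define F where "F = (\<lambda>y. sigma m y ^ N * f y)"
  have F: "F \<in> Sk m k" unfolding F_def using Sk_mono[OF Sk_sigma_power_mult[OF f] k] .
  have ff: "f y * f y = (\<Prod>i<m. poly (v * v) (y i))" for y by (simp add: f_def prod.distrib)
  have M00: "mom0 m f 0 = 1"
    using integral_prod_poly[of m "\<lambda>_. v * v"] v(2) by (simp add: mom0_def ip0_def ff)
  have M01: "mom0 m f 1 = real m * E (pCons 0 (v * v))"
  proof -
    define q where "q i r = (if r = i then pCons 0 (v * v) else v * v)" for i r :: nat
    have q: "(\<Prod>r<m. poly (q i r) (y r)) = y i * (f y * f y)" if "i < m" for i y
    proof -
      have "(\<Prod>r<m. poly (q i r) (y r)) = (\<Prod>r<m. (if r = i then y i else 1) * poly (v * v) (y r))"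
        by (intro prod.cong refl) (simp add: q_def)
      then show ?thesis using that by (simp add: prod.distrib ff)
    qed
    have int: "integrable (mu m) (\<lambda>y. \<Prod>r<m. poly (q i r) (y r))" for i
      unfolding mu_def by (rule PS.product_integrable_prod) auto
    have "mom0 m f 1 = (\<integral>y. (\<Sum>i<m. \<Prod>r<m. poly (q i r) (y r)) \<partial>mu m)"
      by (simp add: mom0_def ip0_def q sigma_def sum_distrib_right mult.assoc)
    also have "\<dots> = (\<Sum>i<m. \<Prod>r<m. E (q i r))"
      using int by (simp add: integral_prod_poly)
    also have "\<dots> = (\<Sum>i<m. E (pCons 0 (v * v)))"
      by (intro sum.cong refl) (simp add: q_def if_distrib[of E] v(2) cong: if_cong)
    finally show ?thesis by simp
  qed
  have D: "0 < dist_const m k" using dist_const_ge_1[of m k] by linarith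
  have f0: "f \<noteq> (\<lambda>_. 0)"
  proof
    assume "f = (\<lambda>_. 0)"
    then have "mom0 m f 0 = 0" by (simp add: mom0_def ip0_def)
    then show False using M00 by simp
  qed
  have pos: "0 < mom1 m f 0" using ip1_pos[OF fp f0] by (simp add: mom1_def)
  have nn: "0 \<le> real m * (\<kappa> * (1 - 1 / (2 * real M)))" using \<kappa> M by simp
  have "(real m * (\<kappa> * (1 - 1 / (2 * real M)))) ^ (2 * N) \<le> (mom0 m f 1 / mom0 m f 0) ^ (2 * N)"
    unfolding M00 M01 using mult_left_mono[OF v(3), of "real m"] by (intro power_mono nn) simp
  also have "\<dots> \<le> mom0 m f (2 * N) / mom0 m f 0"
    by (rule logconvex_ratio_le) (use mom0_logconvex[OF fp] M00 in auto)
  also have "\<dots> = ip0 m F F" by (simp add: M00 mom_even F_def)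
  also have "\<dots> \<le> dist_const m k * ip1 m F F" by (rule ip0_le_ip1[OF Sk_polys[OF F]])
  also have "\<dots> \<le> dist_const m k * (mom1 m f (2 * N) / mom1 m f 0)"
  proof (rule mult_left_mono)
    have "mom1 m f 0 \<le> 1" using ip1_le_ip0[OF fp] M00 by (simp add: mom1_def mom0_def)
    then show "ip1 m F F \<le> mom1 m f (2 * N) / mom1 m f 0"
      using pos mom1_logconvex(1)[OF fp, of "2 * N"]
      by (simp add: mom_even(2)[symmetric] F_def le_divide_eq mult_left_le)
  qed (use D in simp)
  also have "\<dots> \<le> dist_const m k * (mom1 m f (Suc (2 * N)) / mom1 m f (2 * N)) ^ (2 * N)"
    by (intro mult_left_mono logconvex_ratio_le) (use mom1_logconvex[OF fp] pos D in auto)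
  also have "\<dots> \<le> dist_const m k * lambda_max n m k ^ (2 * N)"
  proof (intro mult_left_mono power_mono)
    have "mom1 m f (Suc (2 * N)) \<le> lambda_max n m k * mom1 m f (2 * N)"
      unfolding mom_even mom_odd F_def[symmetric]
      using lambda_max_props(1)[OF n F] by (simp add: A_form_def F_def)
    moreover have "0 \<le> lambda_max n m k"
    proof -
      have "(\<lambda>_. 1) \<in> Sk m k" by (rule Sk_const)
      from lambda_max_props(1)[OF n this]
      have "mom1 m (\<lambda>_. 1) 1 \<le> lambda_max n m k * ip1 m (\<lambda>_. 1) (\<lambda>_. 1)"
        by (simp add: mom1_def A_form_def)
      then have "0 \<le> lambda_max n m k * ip1 m (\<lambda>_. 1) (\<lambda>_. 1)"
        using mom1_logconvex(1)[OF polys_const, of m 1 1] by linarith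
      moreover have "0 < ip1 m (\<lambda>_. 1) (\<lambda>_. 1)"
        by (rule ip1_pos[OF polys_const]) (simp add: fun_eq_iff)
      ultimately show ?thesis by (simp add: zero_le_mult_iff)
    qed
    ultimately show "mom1 m f (Suc (2 * N)) / mom1 m f (2 * N) \<le> lambda_max n m k"
      using mom1_logconvex(1)[OF fp, of "2 * N"]
      by (cases "mom1 m f (2 * N) = 0") (auto simp: divide_le_eq)
  qed (use mom1_logconvex[OF fp] D in auto)
  finally show ?thesis .
qed

end

section \<open>The limit\<close>

text \<open>The \<open>2N\<close>-th root of \<open>dist_const m k\<close>.\<close>

definition err :: "nat \<Rightarrow> nat \<Rightarrow> real \<Rightarrow> nat \<Rightarrow> real" where
  "err m k a N = exp (3 * real m ^ 2 * ln (7 * (real k + real m ^ 2 + a + 3)) / real N)"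

lemma (in jacobi) err_power:
  assumes "1 \<le> N"
  shows "err m k a N ^ (2 * N) = dist_const m k"
proof -
  have Q: "7 * (real k + real m ^ 2 + a + 3) = Q (k + m\<^sup>2)" by (simp add: Q_def)
  have "err m k a N ^ (2 * N) = exp (real (2 * N) * (3 * real m ^ 2 * ln (Q (k + m\<^sup>2)) / real N))"
    unfolding err_def Q by (rule exp_of_nat_mult[symmetric])
  also have "real (2 * N) * (3 * real m ^ 2 * ln (Q (k + m\<^sup>2)) / real N) = real (6 * m\<^sup>2) * ln (Q (k + m\<^sup>2))"
    using assms by simp
  also have "exp \<dots> = dist_const m k"
    unfolding exp_of_nat_mult dist_const_def using Q_pos[of "k + m\<^sup>2"] by simp
  finally show ?thesis .
qed

lemma err_pos: "0 < err m k a N"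
  by (simp add: err_def)

lemma lambda_max_upper:
  assumes "1 \<le> m" "1 \<le> N" "a = real n / 2 - real m - 1/2" "2 \<le> a"
  shows "lambda_max n m k \<le> err m k a N *
    (real m * (1 - ((a - 1/2)\<^sup>2 - 1) / (a + 3/2 + 2 * real (k + N) / real m)\<^sup>2))"
proof -
  interpret jacobi a using assms(4) by unfold_locales
  have "lambda_max n m k ^ (2 * N) \<le> (err m k a N * upper m (k + N)) ^ (2 * N)"
    unfolding power_mult_distrib err_power[OF assms(2)] by (rule lambda_max_le(2)[OF assms(3,1)])
  then have "lambda_max n m k \<le> err m k a N * upper m (k + N)"
    using assms(2) upper_nonneg[of m "k + N"] err_pos[of m k a N]
    by (subst (asm) power_mono_iff) (auto intro: lambda_max_le(1)[OF assms(3,1)] mult_nonneg_nonneg less_imp_le)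
  then show ?thesis by (simp add: upper_def)
qed

text \<open>The window has length \<open>N\<close>. \<open>\<tau>\<close> bounds \<open>s t\<close>
  from below for the starting degree \<open>t\<close> chosen in the proof and is free of integer
  division, hence easier to pass to the limit with.\<close>

lemma lambda_max_lower:
  assumes "1 \<le> m" "1 \<le> N" "a = real n / 2 - real m - 1/2" "2 \<le> a" "(m + 1) * N \<le> k"
  defines "\<tau> \<equiv> 2 * ((real k - (real m + 1) * real N) / real m - 1) + a - 1/2"
  assumes \<tau>: "0 < \<tau>" and \<kappa>: "0 \<le> 1 - (a + 1/2)\<^sup>2 / \<tau>\<^sup>2"
  shows "real m * ((1 - (a + 1/2)\<^sup>2 / \<tau>\<^sup>2) * (1 - 1 / (2 * real N))) / err m k a N \<le> lambda_max n m k"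
proof -
  interpret jacobi a using assms(4) by unfold_locales
  \<comment> \<open>The largest \<open>t\<close> with \<open>m * (t + N) + N <= k\<close>.\<close>
  define t where "t = (k - (m + 1) * N) div m"
  have "m * t \<le> k - (m + 1) * N" by (simp add: t_def)
  then have le: "m * (t + N) + N \<le> k" using assms(5) by (simp add: algebra_simps)
  have "k - (m + 1) * N < m * (t + 1)"
    using assms(1) by (simp add: t_def dividend_less_times_div)
  then have "real (k - (m + 1) * N) < real m * (real t + 1)"
    by (metis of_nat_1 of_nat_add of_nat_less_iff of_nat_mult)
  then have "real k - (real m + 1) * real N < real m * (real t + 1)"
    using assms(5) by (simp add: of_nat_diff algebra_simps)
  moreover define X where "X = (real k - (real m + 1) * real N) / real m"
  ultimately have "X \<le> real t + 1"
    using assms(1) by (simp add: divide_le_eq mult.commute)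
  moreover have "\<tau> = 2 * (X - 1) + a - 1/2" unfolding \<tau>_def X_def ..
  ultimately have "\<tau> \<le> s t" by (simp add: s_def algebra_simps)
  then have "(a + 1/2)\<^sup>2 / (s t)\<^sup>2 \<le> (a + 1/2)\<^sup>2 / \<tau>\<^sup>2"
    using \<tau> by (intro divide_left_mono power_mono) auto
  then have \<kappa>': "1 - (a + 1/2)\<^sup>2 / \<tau>\<^sup>2 \<le> 1 - (a + 1/2)\<^sup>2 / (s t)\<^sup>2" by linarith
  have "(real m * ((1 - (a + 1/2)\<^sup>2 / \<tau>\<^sup>2) * (1 - 1 / (2 * real N)))) ^ (2 * N) \<le> (err m k a N * lambda_max n m k) ^ (2 * N)"
    unfolding power_mult_distrib[of "err m k a N"] err_power[OF assms(2)]
    by (rule lambda_max_ge[OF assms(3,2) le \<kappa> \<kappa>'])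
  moreover have "0 \<le> err m k a N * lambda_max n m k"
    using err_pos[of m k a N] lambda_max_le(1)[OF assms(3,1)] by (simp add: less_imp_le)
  moreover have "0 \<le> real m * ((1 - (a + 1/2)\<^sup>2 / \<tau>\<^sup>2) * (1 - 1 / (2 * real N)))"
    using \<kappa> assms(2) by (intro mult_nonneg_nonneg) auto
  ultimately have "real m * ((1 - (a + 1/2)\<^sup>2 / \<tau>\<^sup>2) * (1 - 1 / (2 * real N))) \<le> err m k a N * lambda_max n m k"
    using assms(2) by (subst (asm) power_mono_iff) auto
  then show ?thesis using err_pos[of m k a N] by (simp add: divide_le_eq mult.commute)
qed

theorem theorem5p3:
  fixes m :: nat and l :: real and n k :: "nat \<Rightarrow> nat"
  assumes "m \<ge> 1" and "l > 0"
    and "\<And>j. 2 * m \<le> n j"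
    and "filterlim n at_top sequentially"
    and "filterlim k at_top sequentially"
    and "(\<lambda>j. real (n j) / (2 * real (k j))) \<longlonglongrightarrow> l"
  shows "(\<lambda>j. lambda_max (n j) m (k j))
           \<longlonglongrightarrow> 4 * (l + 1 / real m) / (l + 2 / real m)^2"
proof -
  define x where "x j = real (k j)" for j
  \<comment> \<open>Of order \<open>sqrt k\<close>: large enough for \<open>ln k / N\<close> to
    vanish in the limit, small enough for \<open>N / k\<close> to vanish.\<close>
  define N where "N j = nat \<lfloor>sqrt (x j)\<rfloor>" for j
  define a where "a j = real (n j) / 2 - real m - 1/2" for j
  have m: "0 < real m" using assms(1) by simp
  have x_lim: "filterlim x at_top sequentially"
    unfolding x_def by (rule filterlim_compose[OF filterlim_real_sequentially assms(5)])
  have n_lim: "filterlim (\<lambda>j. real (n j)) at_top sequentially"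
    by (rule filterlim_compose[OF filterlim_real_sequentially assms(4)])
  have x_ev: "eventually (\<lambda>j. c \<le> x j) sequentially" for c
    using x_lim by (simp add: filterlim_at_top)
  have a_ev: "eventually (\<lambda>j. 2 \<le> a j) sequentially"
  proof -
    have "eventually (\<lambda>j. 2 * real m + 5 \<le> real (n j)) sequentially"
      using n_lim by (simp add: filterlim_at_top)
    then show ?thesis by eventually_elim (simp add: a_def)
  qed
  have N_ge: "sqrt (x j) - 1 \<le> real (N j)" for j
    unfolding N_def x_def by linarith
  have N_le: "real (N j) \<le> sqrt (x j)" for j
    unfolding N_def x_def by (rule of_nat_floor) simp
  have inv_x: "(\<lambda>j. 1 / x j) \<longlonglongrightarrow> 0"
    using tendsto_inverse_0_at_top[OF x_lim] by (simp add: inverse_eq_divide)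
  have N_x: "(\<lambda>j. real (N j) / x j) \<longlonglongrightarrow> 0"
  proof (rule tendsto_sandwich[of "\<lambda>_. 0"])
    have "((\<lambda>x::real. sqrt x / x) \<longlongrightarrow> 0) at_top" by real_asymp
    from filterlim_compose[OF this x_lim] show "(\<lambda>j. sqrt (x j) / x j) \<longlonglongrightarrow> 0" .
  qed (auto simp: x_def intro!: divide_right_mono N_le[unfolded x_def] always_eventually)
  have a_x: "(\<lambda>j. a j / x j) \<longlonglongrightarrow> l"
  proof -
    have "(\<lambda>j. real (n j) / (2 * x j) - (real m + 1/2) * (1 / x j)) \<longlonglongrightarrow> l - (real m + 1/2) * 0"
      using assms(6) unfolding x_def[symmetric] by (intro tendsto_intros inv_x)
    moreover have "real (n j) / (2 * x j) - (real m + 1/2) * (1 / x j) = a j / x j" for j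
      by (simp add: a_def diff_divide_distrib add_divide_distrib)
    ultimately show ?thesis by simp
  qed
  have inv_N: "(\<lambda>j. 1 / real (N j)) \<longlonglongrightarrow> 0"
  proof -
    have "filterlim (\<lambda>x::real. sqrt x - 1) at_top at_top" by real_asymp
    from filterlim_compose[OF this x_lim] have "filterlim (\<lambda>j. sqrt (x j) - 1) at_top sequentially" .
    then have "filterlim (\<lambda>j. real (N j)) at_top sequentially"
      by (rule filterlim_at_top_mono) (simp add: N_ge)
    from tendsto_inverse_0_at_top[OF this] show ?thesis by (simp add: inverse_eq_divide)
  qed
  have ln_x_N: "(\<lambda>j. ln (x j) / real (N j)) \<longlonglongrightarrow> 0"
  proof (rule tendsto_sandwich[of "\<lambda>_. 0"])
    have "((\<lambda>x::real. ln x / (sqrt x - 1)) \<longlongrightarrow> 0) at_top" by real_asymp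
    from filterlim_compose[OF this x_lim] show "(\<lambda>j. ln (x j) / (sqrt (x j) - 1)) \<longlonglongrightarrow> 0" .
    show "\<forall>\<^sub>F j in sequentially. 0 \<le> ln (x j) / real (N j)"
      using x_ev[of 1] by eventually_elim simp
    show "\<forall>\<^sub>F j in sequentially. ln (x j) / real (N j) \<le> ln (x j) / (sqrt (x j) - 1)"
      using x_ev[of 4]
    proof eventually_elim
      case (elim j)
      then have "2 \<le> sqrt (x j)" by (intro real_le_rsqrt) simp
      then show ?case using elim N_ge[of j] by (intro divide_left_mono mult_pos_pos) auto
    qed
  qed simp
  define \<delta> where "\<delta> j = err m (k j) (a j) (N j)" for j
  have \<delta>: "\<delta> \<longlonglongrightarrow> 1"
  proof -
    \<comment> \<open>\<open>q\<close> is the argument of the logarithm in \<open>err\<close>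
      divided by \<open>k\<close>. Its logarithm stays bounded, so only \<open>ln k / N\<close> has
      to be controlled.\<close>
    define q where "q j = 7 * (1 + (real m ^ 2 + 3) * (1 / x j) + a j / x j)" for j
    have q: "q \<longlonglongrightarrow> 7 * (1 + (real m ^ 2 + 3) * 0 + l)"
      unfolding q_def by (intro tendsto_intros inv_x a_x)
    define c where "c = ln (7 * (1 + (real m ^ 2 + 3) * 0 + l))"
    have "(\<lambda>j. ln (q j)) \<longlonglongrightarrow> c"
      unfolding c_def using assms(2) by (intro tendsto_ln q) auto
    then have "(\<lambda>j. exp (3 * real m ^ 2 * (ln (x j) / real (N j) + ln (q j) * (1 / real (N j))))) \<longlonglongrightarrow>
      exp (3 * real m ^ 2 * (0 + c * 0))"
      by (intro tendsto_exp tendsto_mult tendsto_add tendsto_const ln_x_N inv_N)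
    moreover have "\<forall>\<^sub>F j in sequentially. exp (3 * real m ^ 2 * (ln (x j) / real (N j) + ln (q j) * (1 / real (N j)))) = \<delta> j"
      using x_ev[of 1] a_ev
    proof eventually_elim
      case (elim j)
      have "0 < q j" using elim unfolding q_def by (intro mult_pos_pos add_pos_nonneg) auto
      moreover have "7 * (x j + real m ^ 2 + a j + 3) = x j * q j"
        using elim by (simp add: q_def field_simps)
      ultimately have "ln (7 * (x j + real m ^ 2 + a j + 3)) = ln (x j) + ln (q j)"
        using elim by (simp add: ln_mult)
      then show ?case unfolding \<delta>_def err_def x_def[symmetric] by (simp flip: add_divide_distrib)
    qed
    ultimately show ?thesis by (simp add: tendsto_cong)
  qed
  \<comment> \<open>\<open>L = g(1/m)\<close>, the value at equal degrees \<open>k / m\<close> in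
    all coordinates.\<close>
  define L where "L = 1 - l\<^sup>2 / (l + 2 / real m)\<^sup>2"
  have l2: "0 < l + 2 / real m" using assms(2) m by (simp add: add_pos_pos)
  then have nz: "l + 2 / real m \<noteq> 0" by linarith
  have L_eq: "real m * L = 4 * (l + 1 / real m) / (l + 2 / real m)\<^sup>2"
  proof -
    have "L = ((l + 2 / real m)\<^sup>2 - l\<^sup>2) / (l + 2 / real m)\<^sup>2"
      using l2 by (simp add: L_def diff_divide_distrib)
    moreover have "real m * ((l + 2 / real m)\<^sup>2 - l\<^sup>2) = 4 * (l + 1 / real m)"
      using m by (simp add: power2_eq_square field_simps)
    ultimately show ?thesis by (metis times_divide_eq_right)
  qed
  \<comment> \<open>Positivity of the limit makes \<open>W j\<close> eventually non-negative, as
    required by \<open>lambda_max_lower\<close>.\<close>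
  have L_pos: "0 < L"
  proof -
    have "0 < real m * L" unfolding L_eq using assms(2) m by (intro divide_pos_pos) (auto simp: nz add_pos_pos)
    then show ?thesis using m by (simp add: zero_less_mult_iff)
  qed
  define U where "U j = 1 - ((a j - 1/2)\<^sup>2 - 1) / (a j + 3/2 + 2 * real (k j + N j) / real m)\<^sup>2" for j
  have U: "U \<longlonglongrightarrow> L"
  proof -
    have "(\<lambda>j. 1 - ((a j / x j - 1/2 * (1 / x j))\<^sup>2 - (1 / x j)\<^sup>2) /
        (a j / x j + 3/2 * (1 / x j) + 2 * (1 + real (N j) / x j) / real m)\<^sup>2)
      \<longlonglongrightarrow> 1 - ((l - 1/2 * 0)\<^sup>2 - 0\<^sup>2) / (l + 3/2 * 0 + 2 * (1 + 0) / real m)\<^sup>2"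
      using nz m by (intro tendsto_intros inv_x a_x N_x) auto
    moreover have "\<forall>\<^sub>F j in sequentially. 1 - ((a j / x j - 1/2 * (1 / x j))\<^sup>2 - (1 / x j)\<^sup>2) /
        (a j / x j + 3/2 * (1 / x j) + 2 * (1 + real (N j) / x j) / real m)\<^sup>2 = U j"
      using x_ev[of 1]
    proof eventually_elim
      case (elim j)
      have "(a j - 1/2)\<^sup>2 - 1 = (x j)\<^sup>2 * ((a j / x j - 1/2 * (1 / x j))\<^sup>2 - (1 / x j)\<^sup>2)"
        using elim by (simp add: power2_eq_square field_simps)
      moreover have "a j + 3/2 + 2 * real (k j + N j) / real m =
          x j * (a j / x j + 3/2 * (1 / x j) + 2 * (1 + real (N j) / x j) / real m)"
        using elim m unfolding of_nat_add x_def[symmetric] by (simp add: field_simps)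
      ultimately show ?case unfolding U_def using elim by (simp add: power_mult_distrib)
    qed
    ultimately show ?thesis by (simp add: tendsto_cong L_def)
  qed
  define \<tau> where "\<tau> j = 2 * ((real (k j) - (real m + 1) * real (N j)) / real m - 1) + a j - 1/2" for j
  \<comment> \<open>\<open>\<tau>\<close> divided by \<open>k\<close>; its limit is
    \<open>l + 2 / m\<close>.\<close>
  define y where "y j = 2 * ((1 - (real m + 1) * (real (N j) / x j)) / real m - 1 / x j) + a j / x j - 1/2 * (1 / x j)" for j
  have y: "y \<longlonglongrightarrow> 2 * ((1 - (real m + 1) * 0) / real m - 0) + l - 1/2 * 0"
    unfolding y_def using m by (intro tendsto_intros inv_x a_x N_x) auto
  have y_pos: "\<forall>\<^sub>F j in sequentially. 0 < y j"
    using order_tendstoD(1)[OF y, of 0] l2 by (simp add: add.commute)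
  have \<tau>_eq: "\<tau> j = x j * y j" if "1 \<le> x j" for j
    using that m unfolding \<tau>_def y_def x_def[symmetric] by (simp add: field_simps)
  define W where "W j = 1 - (a j + 1/2)\<^sup>2 / (\<tau> j)\<^sup>2" for j
  have W: "W \<longlonglongrightarrow> L"
  proof -
    have "(\<lambda>j. 1 - (a j / x j + 1/2 * (1 / x j))\<^sup>2 / (y j)\<^sup>2)
      \<longlonglongrightarrow> 1 - (l + 1/2 * 0)\<^sup>2 / (2 * ((1 - (real m + 1) * 0) / real m - 0) + l - 1/2 * 0)\<^sup>2"
      using nz by (intro tendsto_intros inv_x a_x y) (auto simp: add.commute)
    moreover have "\<forall>\<^sub>F j in sequentially. 1 - (a j / x j + 1/2 * (1 / x j))\<^sup>2 / (y j)\<^sup>2 = W j"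
      using x_ev[of 1]
    proof eventually_elim
      case (elim j)
      have "a j + 1/2 = x j * (a j / x j + 1/2 * (1 / x j))" using elim by (simp add: field_simps)
      then show ?case unfolding W_def \<tau>_eq[OF elim] using elim by (simp add: power_mult_distrib)
    qed
    ultimately show ?thesis by (simp add: tendsto_cong L_def add.commute)
  qed
  have N1: "\<forall>\<^sub>F j in sequentially. 1 \<le> N j"
    using x_ev[of 4]
  proof eventually_elim
    case (elim j)
    then have "2 \<le> sqrt (x j)" by (intro real_le_rsqrt) simp
    then show ?case using N_ge[of j] by linarith
  qed
  have "(\<lambda>j. \<delta> j * (real m * U j)) \<longlonglongrightarrow> 1 * (real m * L)"
    by (intro tendsto_intros \<delta> U)
  then have up_lim: "(\<lambda>j. \<delta> j * (real m * U j)) \<longlonglongrightarrow> real m * L" by simp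
  have "(\<lambda>j. real m * (W j * (1 - 1/2 * (1 / real (N j)))) / \<delta> j) \<longlonglongrightarrow> real m * (L * (1 - 1/2 * 0)) / 1"
    by (intro tendsto_intros W inv_N \<delta>) auto
  then have low_lim: "(\<lambda>j. real m * (W j * (1 - 1 / (2 * real (N j)))) / \<delta> j) \<longlonglongrightarrow> real m * L" by simp
  have up: "\<forall>\<^sub>F j in sequentially. lambda_max (n j) m (k j) \<le> \<delta> j * (real m * U j)"
    using N1 a_ev
    by eventually_elim (unfold \<delta>_def U_def, rule lambda_max_upper[OF assms(1)], auto simp: a_def)
  have N_small: "\<forall>\<^sub>F j in sequentially. (m + 1) * N j \<le> k j"
  proof -
    have "\<forall>\<^sub>F j in sequentially. real (N j) / x j < 1 / (real m + 1)"
      using order_tendstoD(2)[OF N_x, of "1 / (real m + 1)"] m by (simp add: add_pos_pos)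
    then show ?thesis using x_ev[of 1]
    proof eventually_elim
      case (elim j)
      then have "(real m + 1) * real (N j) \<le> x j" using m by (simp add: field_simps)
      then have "real ((m + 1) * N j) \<le> real (k j)" by (simp add: x_def distrib_right)
      then show ?case by (simp only: of_nat_le_iff)
    qed
  qed
  have low: "\<forall>\<^sub>F j in sequentially. real m * (W j * (1 - 1 / (2 * real (N j)))) / \<delta> j \<le> lambda_max (n j) m (k j)"
    using N1 a_ev N_small y_pos x_ev[of 1] order_tendstoD(1)[OF W L_pos]
  proof eventually_elim
    case (elim j)
    have \<tau>_pos: "0 < \<tau> j" using elim \<tau>_eq[of j] by simp
    have W_nonneg: "0 \<le> W j" using elim by simp
    have a_eq: "a j = real (n j) / 2 - real m - 1/2" by (simp add: a_def)
    show ?case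
      unfolding W_def \<delta>_def \<tau>_def
      by (rule lambda_max_lower[OF assms(1) elim(1) a_eq elim(2,3) \<tau>_pos[unfolded \<tau>_def]
            W_nonneg[unfolded W_def \<tau>_def]])
  qed
  show ?thesis
    using tendsto_sandwich[OF low up low_lim up_lim] unfolding L_eq .
qed

end
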